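(* Let $\phi$ be the solution of the convection-diffusion problem described in the context, and suppose that $\phi\in Z^3\cap H^2(0,T;H^2(\Omega))\cap H^1(0,T;H^3(\Omega))$. Let $\{P_i^n\}$ be a moving mesh with associated mesh velocity $w$, with global mesh size $h$ and time increment $\Delta t$. Then the following hold for every $n\in\{1,\dots,N_T\}$. (i) There exists a positive constant $C=C(\|w\|_{C^0(L^\infty)})$, independent of $\Delta t$ and $h$, such that $$\left\| \bar D_{\Delta t}(\Pi_h^n\phi^n)-\frac1{\Delta t}\int_{t^{n-1}}^{t^n}\Pi_h(t)\frac{\partial\phi}{\partial t}(\cdot,t)\,dt\right\|\le\frac{C\,h}{\sqrt{\Delta t}}\,\|\phi\|_{L^2(t^{n-1},t^n;H^2(\Omega))}.$$ (ii) There exists a positive constant $C'=C'(\|w\|_{C^0(W^{1,\infty})})$, independent of $\Delta t$ and $h$, such that $$\left\| \bar D_{\Delta t}(\Pi_h^n\phi^n)-\frac1{\Delta t}\int_{t^{n-1}}^{t^n}\Pi_h(t)\frac{\partial\phi}{\partial t}(\cdot,t)\,dt\right\|_{\Psi'}\le C'\,h^2\,\|\phi\|_{H^1(0,T;H^3(\Omega))}.$$ The constants do not depend on $n$ or $\phi$, and depend on the mesh only through the indicated norms of $w$.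
   Context: $\Omega=(a,b)$ is a bounded interval, $\Gamma=\{a,b\}$, $T>0$, $\nu>0$. $(\cdot,\cdot)$ and $\|\cdot\|$ are the inner product and norm of $L^2(\Omega)$; $\Psi=H^1(\Omega)$ with dual $\Psi'$, and a function $v\in L^2(\Omega)$ is identified with the functional $\psi\mapsto(v,\psi)$, so $\|v\|_{\Psi'}=\sup_{\|\psi\|_{H^1}\le1}(v,\psi)$. We write $\nabla=\partial_x$. Problem: for given functions $u,f:\Omega\times(0,T)\to\mathbb{R}$, $g:\Gamma\times(0,T)\to\mathbb{R}$, $\phi^0:\Omega\to\mathbb{R}$, $\phi$ solves $\partial_t\phi+\partial_x(u\phi)-\nu\partial_x^2\phi=f$ in $\Omega\times(0,T)$, $\nu\,n\,\partial_x\phi-\phi u\,n=g$ on $\Gamma\times(0,T)$ with $n(a)=-1$, $n(b)=1$, and $\phi(\cdot,0)=\phi^0$; in weak form, $\phi(t)\in\Psi$ and $(\partial_t\phi(t),\psi)+\nu(\nabla\phi(t),\nabla\psi)-(\phi(t),u(t)\nabla\psi)=(f(t),\psi)+\int_\Gamma g(t)\psi\,ds$ for all $\psi\in\Psi$, $t\in(0,T)$. Function space: $Z^m=Z^m(0,T)$, where $Z^m(t_0,t_1)=\{\psi\in C^j(t_0,t_1;H^{m-j}(\Omega)),\ j=0,\dots,m,\ \|\psi\|_{Z^m(t_0,t_1)}<\infty\}$ and $\|\psi\|_{Z^m(t_0,t_1)}=\bigl(\sum_{j=1}^m\|\psi\|^2_{C^j(t_0,t_1;H^{m-j}(\Omega))}\bigr)^{1/2}$.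 Discretization: $\Delta t>0$, $t^n=n\Delta t$, $N_T=\lfloor T/\Delta t\rfloor$. A moving mesh is a set of points $\{P_i^n: i=1,\dots,N_p,\ n=0,\dots,N_T\}\subset\bar\Omega$ with $a=P_1^n<\dots<P_{N_p}^n=b$ for every $n$. The global mesh size is $h=\max_{n}\max_i(P_{i+1}^n-P_i^n)$. Put $w_i^n=(P_i^n-P_i^{n-1})/\Delta t$ and $P_i(t)=P_i^{n-1}+w_i^n(t-t^{n-1})$ for $t\in[t^{n-1},t^n]$. For each $t$, $\psi_i(\cdot,t)$ is the continuous function on $\bar\Omega$, affine on each $[P_j(t),P_{j+1}(t)]$, with $\psi_i(P_j(t),t)=\delta_{ij}$. The mesh velocity is $w(x,t)=\sum_i w_i^n\psi_i(x,t)$ for $t\in[t^{n-1},t^n]$; the norms $\|w\|_{C^0(L^\infty)}$ and $\|w\|_{C^0(W^{1,\infty})}$ denote the suprema over all $n$ and all $t\in[t^{n-1},t^n]$ of $\|w(\cdot,t)\|_{L^\infty(\Omega)}$ and $\|w(\cdot,t)\|_{W^{1,\infty}(\Omega)}$. The time-dependent Lagrange interpolation is $[\Pi_h(t)v](x)=\sum_{i=1}^{N_p}v(P_i(t))\psi_i(x,t)$ for $v\in C^0(\bar\Omega)$, and $\Pi_h^n=\Pi_h(t^n)$, $\phi^n=\phi(\cdot,t^n)$. For a sequence, $\bar D_{\Delta t}\rho^n=(\rho^n-\rho^{n-1})/\Delta t$, so $\bar D_{\Delta t}(\Pi_h^n\phi^n)=(\Pi_h^n\phi^n-\Pi_h^{n-1}\phi^{n-1})/\Delta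 t$. *)

theory Defs
  imports "HOL-Analysis.Analysis" "HOL-Probability.Essential_Supremum"
begin

section \<open>Lebesgue and Sobolev spaces over an open set of reals\<close>

text \<open>
  Elements of function spaces are represented by functions on the reals, of which only
  the values (up to null sets) on the underlying set matter.
\<close>

definition L2_space :: "real set \<Rightarrow> (real \<Rightarrow> real) set" where
  "L2_space S = {v. v \<in> borel_measurable (lebesgue_on S) \<and>
                    integrable (lebesgue_on S) (\<lambda>x. (v x)\<^sup>2)}"

definition L2_inner :: "real set \<Rightarrow> (real \<Rightarrow> real) \<Rightarrow> (real \<Rightarrow> real) \<Rightarrow> real" where
  "L2_inner S v w = (\<integral>x. v x * w x \<partial>lebesgue_on S)"

definition L2_norm :: "real set \<Rightarrow> (real \<Rightarrow> real) \<Rightarrow> real" where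
  "L2_norm S v = sqrt (L2_inner S v v)"

definition Linf_norm :: "real set \<Rightarrow> (real \<Rightarrow> real) \<Rightarrow> real" where
  "Linf_norm S v = real_of_ereal (esssup (lebesgue_on S) (\<lambda>x. ereal \<bar>v x\<bar>))"

definition test_functions :: "real set \<Rightarrow> (real \<Rightarrow> real) set" where
  "test_functions S =
     {\<theta>. (\<forall>k x. (deriv ^^ k) \<theta> differentiable (at x)) \<and>
         compact (closure {x. \<theta> x \<noteq> 0}) \<and> closure {x. \<theta> x \<noteq> 0} \<subseteq> S}"

definition locally_integrable :: "real set \<Rightarrow> (real \<Rightarrow> real) \<Rightarrow> bool" where
  "locally_integrable S v \<longleftrightarrow> (\<forall>K. compact K \<and> K \<subseteq> S \<longrightarrow> set_integrable lebesgue K v)"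

definition has_weak_deriv ::
    "real set \<Rightarrow> nat \<Rightarrow> (real \<Rightarrow> real) \<Rightarrow> (real \<Rightarrow> real) \<Rightarrow> bool" where
  "has_weak_deriv S k v g \<longleftrightarrow> locally_integrable S v \<and> locally_integrable S g \<and>
     (\<forall>\<theta>\<in>test_functions S.
        (\<integral>x. v x * (deriv ^^ k) \<theta> x \<partial>lebesgue_on S) =
        (-1) ^ k * (\<integral>x. g x * \<theta> x \<partial>lebesgue_on S))"

text \<open>Weak derivatives are unique only up to null sets; some representative is chosen.\<close>

definition weak_deriv :: "real set \<Rightarrow> nat \<Rightarrow> (real \<Rightarrow> real) \<Rightarrow> (real \<Rightarrow> real)" where
  "weak_deriv S k v = (if k = 0 then v else (SOME g. has_weak_deriv S k v g))"

definition sobolev :: "real set \<Rightarrow> nat \<Rightarrow> (real \<Rightarrow> real) set" where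
  "sobolev S m = {v \<in> L2_space S. \<forall>k\<in>{1..m}. \<exists>g\<in>L2_space S. has_weak_deriv S k v g}"

definition sobolev_norm :: "real set \<Rightarrow> nat \<Rightarrow> (real \<Rightarrow> real) \<Rightarrow> real" where
  "sobolev_norm S m v = sqrt (\<Sum>k\<le>m. (L2_norm S (weak_deriv S k v))\<^sup>2)"

definition W1inf_norm :: "real set \<Rightarrow> (real \<Rightarrow> real) \<Rightarrow> real" where
  "W1inf_norm S v = max (Linf_norm S v) (Linf_norm S (weak_deriv S 1 v))"

text \<open>The norm of an \<open>L\<^sup>2\<close> function, regarded as a functional on \<open>H\<^sup>1\<close>.\<close>

definition H1_dual_norm :: "real set \<Rightarrow> (real \<Rightarrow> real) \<Rightarrow> real" where
  "H1_dual_norm S v =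
     (SUP \<psi>\<in>{\<psi> \<in> sobolev S 1. sobolev_norm S 1 \<psi> \<le> 1}. L2_inner S v \<psi>)"

section \<open>Functions of time with values in \<open>H\<^sup>m(S)\<close>\<close>

text \<open>
  Such a function is a map \<open>v\<close> with \<open>v t x\<close> its value at time \<open>t\<close> and position \<open>x\<close>.
  The parameter \<open>I\<close> is the time interval.
\<close>

subsection \<open>Spaces of continuously differentiable functions\<close>

text \<open>\<open>D i\<close> is the \<open>i\<close>-th time derivative; all limits are taken in the norm of \<open>H\<^sup>m(S)\<close>.\<close>

definition C_derivs ::
    "nat \<Rightarrow> real set \<Rightarrow> real set \<Rightarrow> nat \<Rightarrow> (real \<Rightarrow> real \<Rightarrow> real) \<Rightarrow>
     (nat \<Rightarrow> real \<Rightarrow> real \<Rightarrow> real) \<Rightarrow> bool" where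
  "C_derivs j I S m v D \<longleftrightarrow>
     (\<forall>t\<in>I. D 0 t = v t) \<and>
     (\<forall>i\<le>j. \<forall>t\<in>I. D i t \<in> sobolev S m \<and>
        ((\<lambda>s. sobolev_norm S m (\<lambda>x. D i s x - D i t x)) \<longlongrightarrow> 0) (at t within I)) \<and>
     (\<forall>i<j. \<forall>t\<in>I.
        ((\<lambda>s. sobolev_norm S m (\<lambda>x. (D i s x - D i t x) / (s - t) - D (Suc i) t x))
           \<longlongrightarrow> 0) (at t within I))"

text \<open>
  The space \<open>Z\<^sup>m\<close>: \<open>v \<in> C\<^sup>j(I; H\<^sup>m\<^sup>-\<^sup>j(S))\<close> for \<open>j = 0, \<dots>, m\<close>, with finite
  \<open>C\<^sup>j(I; H\<^sup>m\<^sup>-\<^sup>j(S))\<close>-norm for \<open>j = 1, \<dots>, m\<close> (these are the terms of the \<open>Z\<^sup>m\<close>-norm).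
\<close>

definition Z_space :: "nat \<Rightarrow> real set \<Rightarrow> real set \<Rightarrow> (real \<Rightarrow> real \<Rightarrow> real) set" where
  "Z_space m I S =
     {v. \<forall>j\<le>m. \<exists>D. C_derivs j I S (m - j) v D \<and>
           (1 \<le> j \<longrightarrow> (\<forall>i\<le>j. bdd_above ((\<lambda>t. sobolev_norm S (m - j) (D i t)) ` I)))}"

subsection \<open>Bochner spaces\<close>

definition simple_valued ::
    "real set \<Rightarrow> real set \<Rightarrow> nat \<Rightarrow> (real \<Rightarrow> real \<Rightarrow> real) \<Rightarrow> bool" where
  "simple_valued I S m s \<longleftrightarrow> finite (s ` I) \<and> s ` I \<subseteq> sobolev S m \<and>
     (\<forall>y. {t\<in>I. s t = y} \<in> sets lebesgue)"

definition strongly_measurable ::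
    "real set \<Rightarrow> real set \<Rightarrow> nat \<Rightarrow> (real \<Rightarrow> real \<Rightarrow> real) \<Rightarrow> bool" where
  "strongly_measurable I S m v \<longleftrightarrow>
     (\<exists>s. (\<forall>i. simple_valued I S m (s i)) \<and>
          (AE t in lebesgue_on I.
             (\<lambda>i::nat. sobolev_norm S m (\<lambda>x. s i t x - v t x)) \<longlonglongrightarrow> 0))"

definition L2_sobolev :: "real set \<Rightarrow> real set \<Rightarrow> nat \<Rightarrow> (real \<Rightarrow> real \<Rightarrow> real) set" where
  "L2_sobolev I S m =
     {v. (AE t in lebesgue_on I. v t \<in> sobolev S m) \<and> strongly_measurable I S m v \<and>
         integrable (lebesgue_on I) (\<lambda>t. (sobolev_norm S m (v t))\<^sup>2)}"

definition L2_sobolev_norm ::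
    "real set \<Rightarrow> real set \<Rightarrow> nat \<Rightarrow> (real \<Rightarrow> real \<Rightarrow> real) \<Rightarrow> real" where
  "L2_sobolev_norm I S m v = sqrt (\<integral>t. (sobolev_norm S m (v t))\<^sup>2 \<partial>lebesgue_on I)"

text \<open>
  The Bochner integral with values in \<open>H\<^sup>m(S)\<close>, as a limit of integrals of simple functions
  (\<open>I\<close> is of finite measure). The library's Bochner integral needs a type of class \<open>banach\<close>.
\<close>

definition has_sobolev_integral ::
    "real set \<Rightarrow> real set \<Rightarrow> nat \<Rightarrow> (real \<Rightarrow> real \<Rightarrow> real) \<Rightarrow> (real \<Rightarrow> real) \<Rightarrow> bool" where
  "has_sobolev_integral I S m v V \<longleftrightarrow>
     V \<in> sobolev S m \<and> (AE t in lebesgue_on I. v t \<in> sobolev S m) \<and>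
     strongly_measurable I S m v \<and>
     (\<exists>s. (\<forall>i::nat. simple_valued I S m (s i) \<and>
             integrable (lebesgue_on I) (\<lambda>t. sobolev_norm S m (\<lambda>x. s i t x - v t x))) \<and>
          (\<lambda>i. \<integral>t. sobolev_norm S m (\<lambda>x. s i t x - v t x) \<partial>lebesgue_on I) \<longlonglongrightarrow> 0 \<and>
          (\<lambda>i. sobolev_norm S m
                 (\<lambda>x. (\<Sum>y\<in>s i ` I. measure lebesgue {t\<in>I. s i t = y} * y x) - V x)) \<longlonglongrightarrow> 0)"

definition has_weak_time_deriv ::
    "real set \<Rightarrow> real set \<Rightarrow> nat \<Rightarrow> nat \<Rightarrow> (real \<Rightarrow> real \<Rightarrow> real) \<Rightarrow>
     (real \<Rightarrow> real \<Rightarrow> real) \<Rightarrow> bool" where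
  "has_weak_time_deriv I S m j v w \<longleftrightarrow> v \<in> L2_sobolev I S m \<and> w \<in> L2_sobolev I S m \<and>
     (\<forall>\<theta>\<in>test_functions I. \<exists>V.
        has_sobolev_integral I S m (\<lambda>t x. (deriv ^^ j) \<theta> t * v t x) V \<and>
        has_sobolev_integral I S m (\<lambda>t x. (-1) ^ j * \<theta> t * w t x) V)"

definition weak_time_deriv ::
    "real set \<Rightarrow> real set \<Rightarrow> nat \<Rightarrow> nat \<Rightarrow> (real \<Rightarrow> real \<Rightarrow> real) \<Rightarrow> (real \<Rightarrow> real \<Rightarrow> real)" where
  "weak_time_deriv I S m j v = (if j = 0 then v else (SOME w. has_weak_time_deriv I S m j v w))"

text \<open>The spaces \<open>H\<^sup>j(I; H\<^sup>m(S))\<close>.\<close>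

definition H_sobolev :: "nat \<Rightarrow> real set \<Rightarrow> real set \<Rightarrow> nat \<Rightarrow> (real \<Rightarrow> real \<Rightarrow> real) set" where
  "H_sobolev j I S m =
     {v \<in> L2_sobolev I S m. \<forall>i\<in>{1..j}. \<exists>w. has_weak_time_deriv I S m i v w}"

definition H_sobolev_norm ::
    "nat \<Rightarrow> real set \<Rightarrow> real set \<Rightarrow> nat \<Rightarrow> (real \<Rightarrow> real \<Rightarrow> real) \<Rightarrow> real" where
  "H_sobolev_norm j I S m v =
     sqrt (\<Sum>i\<le>j. (L2_sobolev_norm I S m (weak_time_deriv I S m i v))\<^sup>2)"

section \<open>The convection-diffusion problem\<close>

text \<open>
  The pointwise partial derivative in time. For a jointly continuous \<open>v\<close> that is \<open>C\<^sup>1\<close> in time with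
  values in \<open>H\<^sup>m\<close>, \<open>m \<ge> 1\<close>, it is the continuous representative of the \<open>H\<^sup>m\<close>-valued derivative,
  so that it can be interpolated at nodes.
\<close>

definition time_deriv :: "(real \<Rightarrow> real \<Rightarrow> real) \<Rightarrow> real \<Rightarrow> real \<Rightarrow> real" where
  "time_deriv v t x = deriv (\<lambda>s. v s x) t"

text \<open>
  Weak solutions. The given functions are only required to make the integrals of the weak form
  meaningful. The boundary integral uses point values of the test function \<open>\<psi>\<close>, which is
  therefore taken to be the continuous representative of its class in \<open>H\<^sup>1(a,b)\<close>.
\<close>

definition solves_conv_diff ::
    "real \<Rightarrow> real \<Rightarrow> real \<Rightarrow> real \<Rightarrow> (real \<Rightarrow> real \<Rightarrow> real) \<Rightarrow> (real \<Rightarrow> real \<Rightarrow> real) \<Rightarrow>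
     (real \<Rightarrow> real \<Rightarrow> real) \<Rightarrow> (real \<Rightarrow> real) \<Rightarrow> (real \<Rightarrow> real \<Rightarrow> real) \<Rightarrow> bool" where
  "solves_conv_diff a b T \<nu> u f g \<phi>0 \<phi> \<longleftrightarrow>
     (let \<Omega> = {a<..<b} in
      (\<forall>t\<in>{0<..<T}. \<phi> t \<in> sobolev \<Omega> 1 \<and>
         (\<forall>\<psi>\<in>sobolev \<Omega> 1. continuous_on {a..b} \<psi> \<longrightarrow>
            integrable (lebesgue_on \<Omega>) (\<lambda>x. \<phi> t x * (u t x * weak_deriv \<Omega> 1 \<psi> x)) \<and>
            integrable (lebesgue_on \<Omega>) (\<lambda>x. f t x * \<psi> x) \<and>
            L2_inner \<Omega> (time_deriv \<phi> t) \<psi>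
              + \<nu> * L2_inner \<Omega> (weak_deriv \<Omega> 1 (\<phi> t)) (weak_deriv \<Omega> 1 \<psi>)
              - L2_inner \<Omega> (\<phi> t) (\<lambda>x. u t x * weak_deriv \<Omega> 1 \<psi> x)
            = L2_inner \<Omega> (f t) \<psi> + (g t a * \<psi> a + g t b * \<psi> b))) \<and>
      (AE x in lebesgue_on \<Omega>. \<phi> 0 x = \<phi>0 x))"

section \<open>Moving meshes\<close>

text \<open>A mesh is given by its nodes \<open>p 1 < \<dots> < p N\<close>; other indices are irrelevant.\<close>

definition hat :: "nat \<Rightarrow> (nat \<Rightarrow> real) \<Rightarrow> nat \<Rightarrow> real \<Rightarrow> real" where
  "hat N p i x =
     (if 1 < i \<and> p (i - 1) \<le> x \<and> x \<le> p i then (x - p (i - 1)) / (p i - p (i - 1))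
      else if i < N \<and> p i \<le> x \<and> x \<le> p (i + 1) then (p (i + 1) - x) / (p (i + 1) - p i)
      else 0)"

definition interp :: "nat \<Rightarrow> (nat \<Rightarrow> real) \<Rightarrow> (real \<Rightarrow> real) \<Rightarrow> real \<Rightarrow> real" where
  "interp N p v x = (\<Sum>i = 1..N. v (p i) * hat N p i x)"

definition num_steps :: "real \<Rightarrow> real \<Rightarrow> nat" where
  "num_steps T \<Delta>t = nat \<lfloor>T / \<Delta>t\<rfloor>"

text \<open>\<open>P n i\<close> is the \<open>i\<close>-th node at the \<open>n\<close>-th time step.\<close>

definition moving_mesh ::
    "real \<Rightarrow> real \<Rightarrow> nat \<Rightarrow> nat \<Rightarrow> (nat \<Rightarrow> nat \<Rightarrow> real) \<Rightarrow> bool" where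
  "moving_mesh a b NT Np P \<longleftrightarrow> 2 \<le> Np \<and>
     (\<forall>n\<le>NT. P n 1 = a \<and> P n Np = b \<and> (\<forall>i\<in>{1..<Np}. P n i < P n (i + 1)))"

definition mesh_size :: "nat \<Rightarrow> nat \<Rightarrow> (nat \<Rightarrow> nat \<Rightarrow> real) \<Rightarrow> real" where
  "mesh_size NT Np P = (MAX n\<in>{0..NT}. MAX i\<in>{1..<Np}. P n (i + 1) - P n i)"

definition node_velocity :: "real \<Rightarrow> (nat \<Rightarrow> nat \<Rightarrow> real) \<Rightarrow> nat \<Rightarrow> nat \<Rightarrow> real" where
  "node_velocity \<Delta>t P n i = (P n i - P (n - 1) i) / \<Delta>t"

text \<open>
  Quantities that are defined piecewise on the time slabs \<open>[t\<^sup>n\<^sup>-\<^sup>1, t\<^sup>n]\<close>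
  take the index \<open>n \<ge> 1\<close> of the slab as an argument.
\<close>

definition time_slab :: "real \<Rightarrow> nat \<Rightarrow> real set" where
  "time_slab \<Delta>t n = {real (n - 1) * \<Delta>t .. real n * \<Delta>t}"

definition node_path :: "real \<Rightarrow> (nat \<Rightarrow> nat \<Rightarrow> real) \<Rightarrow> nat \<Rightarrow> real \<Rightarrow> nat \<Rightarrow> real" where
  "node_path \<Delta>t P n t i = P (n - 1) i + node_velocity \<Delta>t P n i * (t - real (n - 1) * \<Delta>t)"

definition mesh_velocity ::
    "real \<Rightarrow> nat \<Rightarrow> (nat \<Rightarrow> nat \<Rightarrow> real) \<Rightarrow> nat \<Rightarrow> real \<Rightarrow> real \<Rightarrow> real" where
  "mesh_velocity \<Delta>t Np P n t x =
     (\<Sum>i = 1..Np. node_velocity \<Delta>t P n i * hat Np (node_path \<Delta>t P n t) i x)"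

text \<open>
  Supremum over all slabs and all times in them of a spatial norm \<open>N\<close> of \<open>w n t\<close>;
  this yields \<open>\<parallel>w\<parallel>\<close> in \<open>C\<^sup>0(L\<^sup>\<infinity>)\<close> and \<open>C\<^sup>0(W\<^sup>1\<^sup>,\<^sup>\<infinity>)\<close>.
\<close>

definition C0_slab_norm ::
    "((real \<Rightarrow> real) \<Rightarrow> real) \<Rightarrow> real \<Rightarrow> nat \<Rightarrow> (nat \<Rightarrow> real \<Rightarrow> real \<Rightarrow> real) \<Rightarrow> real" where
  "C0_slab_norm N \<Delta>t NT w = Sup {N (w n t) | n t. n \<in> {1..NT} \<and> t \<in> time_slab \<Delta>t n}"

text \<open>
  The function whose norms are estimated: the backward difference quotient of the interpolants
  minus the mean over the slab of the interpolant of the time derivative. The time integral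
  is evaluated pointwise in \<open>x\<close>.
\<close>

definition interp_diff_error ::
    "real \<Rightarrow> nat \<Rightarrow> (nat \<Rightarrow> nat \<Rightarrow> real) \<Rightarrow> (real \<Rightarrow> real \<Rightarrow> real) \<Rightarrow> nat \<Rightarrow> real \<Rightarrow> real" where
  "interp_diff_error \<Delta>t Np P \<phi> n x =
     (interp Np (P n) (\<phi> (real n * \<Delta>t)) x
        - interp Np (P (n - 1)) (\<phi> (real (n - 1) * \<Delta>t)) x) / \<Delta>t
     - 1 / \<Delta>t * (\<integral>t. interp Np (node_path \<Delta>t P n t) (time_deriv \<phi> t) x
                      \<partial>lebesgue_on (time_slab \<Delta>t n))"

subsection \<open>The defining properties of the hat functions\<close>

lemma nodes_mono:
  fixes p :: "nat \<Rightarrow> real"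
  assumes "\<And>i. i \<in> {1..<N} \<Longrightarrow> p i < p (i + 1)" "1 \<le> i" "i < j" "j \<le> N"
  shows "p i < p j"
  using assms(3,4)
proof (induction j)
  case (Suc j)
  then have "p j < p (j + 1)"
    using assms(1,2) by auto
  with Suc show ?case
    by (cases "i = j") auto
qed simp

lemma hat_outside:
  assumes "1 < i \<Longrightarrow> \<not> (p (i - 1) \<le> x \<and> x \<le> p i)"
    and "i < N \<Longrightarrow> \<not> (p i \<le> x \<and> x \<le> p (i + 1))"
  shows "hat N p i x = 0"
  using assms unfolding hat_def by presburger

lemma hat_left:
  assumes "1 < i" "p (i - 1) \<le> x" "x \<le> p i"
  shows "hat N p i x = (x - p (i - 1)) / (p i - p (i - 1))"
  using assms unfolding hat_def by presburger

lemma hat_right: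
  assumes "i < N" "p i \<le> x" "x \<le> p (i + 1)" "1 < i \<Longrightarrow> p i < x"
  shows "hat N p i x = (p (i + 1) - x) / (p (i + 1) - p i)"
proof -
  have "\<not> (1 < i \<and> p (i - 1) \<le> x \<and> x \<le> p i)"
    using assms(4) by linarith
  then show ?thesis
    using assms unfolding hat_def by presburger
qed

lemma hat_node:
  assumes p: "\<And>i. i \<in> {1..<N} \<Longrightarrow> p i < p (i + 1)"
    and N: "2 \<le> N" and i: "i \<in> {1..N}" and j: "j \<in> {1..N}"
  shows "hat N p i (p j) = (if i = j then 1 else 0)"
proof -
  have m: "p k < p l" if "1 \<le> k" "k < l" "l \<le> N" for k l
    using nodes_mono[of N p k l] p that by blast
  have le: "p k \<le> p l" if "1 \<le> k" "k \<le> l" "l \<le> N" for k l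
    using m[of k l] that by (cases "k = l") auto
  consider "i = j" "1 < i" | "i = j" "i = 1" | "j < i" | "i < j"
    using i by fastforce
  then show ?thesis
  proof cases
    case 1
    then have "p (i - 1) < p i"
      using m i by simp
    with 1 show ?thesis
      by (simp add: hat_left)
  next
    case 2
    then have "p i < p (i + 1)"
      using m N by simp
    with 2 N show ?thesis
      by (simp add: hat_right)
  next
    case 3
    show ?thesis
    proof (cases "j = i - 1")
      case True
      have "p j < p i"
        using m[of j i] 3 i j by simp
      with True 3 j show ?thesis
        by (simp add: hat_left)
    next
      case False
      then have "p j < p (i - 1)" "p j < p i"
        using m[of j "i - 1"] m[of j i] 3 i j by auto
      then have "hat N p i (p j) = 0"
        by (intro hat_outside) linarith+
      with 3 show ?thesis by simp
    qed
  next
    case 4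
    have ij: "p i < p j"
      using m[of i j] 4 i j by simp
    show ?thesis
    proof (cases "j = i + 1")
      case True
      with ij 4 j show ?thesis
        by (simp add: hat_right)
    next
      case False
      then have "p (i + 1) < p j"
        using m[of "i + 1" j] 4 i j by auto
      with ij have "hat N p i (p j) = 0"
        by (intro hat_outside) linarith+
      with 4 show ?thesis by simp
    qed
  qed
qed

lemma hat_affine:
  assumes p: "\<And>i. i \<in> {1..<N} \<Longrightarrow> p i < p (i + 1)"
    and i: "i \<in> {1..N}" and j: "j \<in> {1..<N}" and x: "x \<in> {p j..p (j + 1)}"
  shows "hat N p i x = ((p (j + 1) - x) * hat N p i (p j) + (x - p j) * hat N p i (p (j + 1)))
                        / (p (j + 1) - p j)"
proof -
  have m: "p k < p l" if "1 \<le> k" "k < l" "l \<le> N" for k l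
    using nodes_mono[of N p k l] p that by blast
  have le: "p k \<le> p l" if "1 \<le> k" "k \<le> l" "l \<le> N" for k l
    using m[of k l] that by (cases "k = l") auto
  have node: "hat N p i (p j) = (if i = j then 1 else 0)"
             "hat N p i (p (j + 1)) = (if i = j + 1 then 1 else 0)"
    using hat_node[of N p i j] hat_node[of N p i "j + 1"] p i j by auto
  have pj: "p j < p (j + 1)"
    using p j by blast
  consider "x = p j" | "x = p (j + 1)" | "p j < x" "x < p (j + 1)"
    using x by fastforce
  then show ?thesis
  proof cases
    case 3
    consider "i = j" | "i = j + 1" | "i < j" | "j + 1 < i"
      by linarith
    then show ?thesis
    proof cases
      case 1
      then show ?thesis
        using 3 node j by (simp add: hat_right)
    next
      case 2
      then show ?thesis
        using 3 node j by (simp add: hat_left)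
    next
      case c: 3
      have "p i < p j" "p (i + 1) \<le> p j"
        using m[of i j] le[of "i + 1" j] c i j by auto
      then have "hat N p i x = 0"
        using 3 by (intro hat_outside) linarith+
      then show ?thesis using node c by simp
    next
      case c: 4
      have "p (j + 1) < p i" "p (j + 1) \<le> p (i - 1)"
        using m[of "j + 1" i] le[of "j + 1" "i - 1"] c i j by auto
      then have "hat N p i x = 0"
        using 3 by (intro hat_outside) linarith+
      then show ?thesis using node c by simp
    qed
  qed (use pj in auto)
qed

end

theory Submission
  imports Defs "HOL-Computational_Algebra.Polynomial"
begin

text \<open>
  Following the nodes, the hat functions are transported by the mesh velocity \<open>w\<close>. Hence for almost
  every \<open>x\<close> the map \<open>t \<mapsto> \<Pi>\<^sub>h(t)\<phi>(t)(x)\<close> is continuous on a time slab, and it is differentiable with derivative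
  \<open>\<Pi>\<^sub>h(\<partial>\<^sub>t\<phi>) + e\<close>, where \<open>e = \<Pi>\<^sub>h(w \<partial>\<^sub>x\<phi>) - w \<partial>\<^sub>x(\<Pi>\<^sub>h\<phi>)\<close>, except at the finitely many times at which a
  node passes \<open>x\<close>. So the error is the mean of \<open>e\<close> over the slab. On an element \<open>K\<close> the function \<open>e\<close> is affine
  and involves only the differences between the nodal values of \<open>\<partial>\<^sub>x\<phi>\<close> and the slope of the secant. These are
  bounded by the integral of \<open>|\<partial>\<^sub>x\<^sup>2\<phi>|\<close> over \<open>K\<close>, which gives (i). Their sum is a trapezoidal
  error and therefore of order \<open>h\<close> times the integral of \<open>|\<partial>\<^sub>x\<^sup>3\<phi>|\<close>; with the bound on \<open>\<partial>\<^sub>xw\<close>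
  the mean of \<open>e\<close> over \<open>K\<close> gains a power of \<open>h\<close>, and the oscillation of a test function in \<open>H\<^sup>1\<close> gains
  another one for the rest, which gives (ii) at each time. The embedding of \<open>H\<^sup>1(0,T)\<close> into the bounded
  functions removes the time.
\<close>

section \<open>Smooth bump functions\<close>

text \<open>The weak derivatives are representatives fixed by choice, while the error formula
  evaluates \<open>\<phi>\<close> and its derivatives at nodes. Hence the work on continuous
  representatives: a weak derivative is unique up to null sets, and a function with an integrable
  weak derivative equals a primitive of it almost everywhere, so each derivative below the top order
  has well-defined nodal values.

  Regularity in time is known on the open interval only, but the first slab starts at 0 and the last
  one may end at \<open>T\<close>. So the interpolant is differentiated inside a slab only, and
  joint continuity carries the identity to its ends.

  In (ii) the right-hand side is a norm of a function of time with values in H^3, whose integrals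
  are limits of integrals of simple functions. No calculus for such functions is developed: bounded
  linear functionals send them to scalar functions, for which the results on one interval already
  exist. The resulting bound holds at every time, so averaging over a slab costs nothing; in (i) the
  Cauchy-Schwarz inequality in time costs the square root of the time step.\<close>

definition differentiable_upto :: "nat \<Rightarrow> (real \<Rightarrow> real) \<Rightarrow> bool" where
  "differentiable_upto k f \<longleftrightarrow> (\<forall>j\<le>k. \<forall>x. (deriv ^^ j) f differentiable (at x))"

lemma funpow_deriv_Suc: "(deriv ^^ Suc j) f = (deriv ^^ j) (deriv f)"
  by (simp add: funpow_swap1)

lemma differentiable_upto_0: "differentiable_upto 0 f \<longleftrightarrow> (\<forall>x. f differentiable (at x))"
  by (simp add: differentiable_upto_def)

text \<open>Peeling off the innermost derivative lets the closure properties go by induction on the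
  order with the functions kept arbitrary: derivatives of sums, products and rescalings are again
  built from such functions.\<close>

lemma differentiable_upto_Suc:
  "differentiable_upto (Suc k) f \<longleftrightarrow> (\<forall>x. f differentiable (at x)) \<and> differentiable_upto k (deriv f)"
proof -
  have "(\<forall>j\<le>Suc k. Q j) \<longleftrightarrow> Q 0 \<and> (\<forall>j\<le>k. Q (Suc j))" for Q
    by (metis Suc_le_mono le0 not0_implies_Suc)
  then show ?thesis
    unfolding differentiable_upto_def by (simp only: funpow_deriv_Suc) simp
qed

lemma differentiable_upto_const: "differentiable_upto k (\<lambda>x. c)"
proof (induction k arbitrary: c)
  case (Suc k)
  have "deriv (\<lambda>x::real. c) = (\<lambda>x. 0)" by (intro ext) simp
  with Suc show ?case by (simp add: differentiable_upto_Suc)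
qed (simp add: differentiable_upto_0)

lemma differentiable_upto_mono: "differentiable_upto k f \<Longrightarrow> j \<le> k \<Longrightarrow> differentiable_upto j f"
  by (auto simp: differentiable_upto_def)

lemma differentiable_upto_add:
  "differentiable_upto k f \<Longrightarrow> differentiable_upto k g \<Longrightarrow> differentiable_upto k (\<lambda>x. f x + g x)"
proof (induction k arbitrary: f g)
  case 0
  then show ?case by (simp add: differentiable_upto_0)
next
  case (Suc k)
  then have "f differentiable (at x)" "g differentiable (at x)" for x
    by (auto simp: differentiable_upto_Suc)
  then have "deriv (\<lambda>x. f x + g x) = (\<lambda>x. deriv f x + deriv g x)"
    by (intro ext DERIV_imp_deriv DERIV_add) (auto simp: DERIV_deriv_iff_real_differentiable)
  with Suc show ?case by (simp add: differentiable_upto_Suc)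
qed

lemma differentiable_upto_mult:
  "differentiable_upto k f \<Longrightarrow> differentiable_upto k g \<Longrightarrow> differentiable_upto k (\<lambda>x. f x * g x)"
proof (induction k arbitrary: f g)
  case 0
  then show ?case by (simp add: differentiable_upto_0)
next
  case (Suc k)
  then have fg: "f differentiable (at x)" "g differentiable (at x)" for x
    by (auto simp: differentiable_upto_Suc)
  then have "deriv (\<lambda>x. f x * g x) = (\<lambda>x. deriv f x * g x + deriv g x * f x)"
    by (intro ext DERIV_imp_deriv DERIV_mult) (auto simp: DERIV_deriv_iff_real_differentiable)
  moreover have "differentiable_upto k f" "differentiable_upto k g"
    using Suc.prems by (auto intro: differentiable_upto_mono)
  then have "differentiable_upto k (\<lambda>x. deriv f x * g x + deriv g x * f x)"
    using Suc.prems by (intro differentiable_upto_add Suc.IH) (auto simp: differentiable_upto_Suc)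
  ultimately show ?case using fg by (simp add: differentiable_upto_Suc)
qed

lemma differentiable_upto_affine:
  "differentiable_upto k f \<Longrightarrow> differentiable_upto k (\<lambda>x. f (c * x + d))"
proof (induction k arbitrary: f)
  case 0
  then have "f differentiable (at x)" for x
    by (simp add: differentiable_upto_0)
  then have "((\<lambda>x. f (c * x + d)) has_field_derivative deriv f (c * x + d) * c) (at x)" for x
    by (intro DERIV_chain2[where f = f])
       (auto simp: DERIV_deriv_iff_real_differentiable intro!: derivative_eq_intros)
  then show ?case
    unfolding differentiable_upto_0 real_differentiable_def by blast
next
  case (Suc k)
  then have "f differentiable (at x)" for x
    by (simp add: differentiable_upto_Suc)
  then have D: "((\<lambda>x. f (c * x + d)) has_field_derivative deriv f (c * x + d) * c) (at x)" for x
    by (intro DERIV_chain2[where f = f])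
       (auto simp: DERIV_deriv_iff_real_differentiable intro!: derivative_eq_intros)
  then have "deriv (\<lambda>x. f (c * x + d)) = (\<lambda>x. deriv f (c * x + d) * c)"
    by (intro ext DERIV_imp_deriv)
  moreover have "differentiable_upto k (\<lambda>x. deriv f (c * x + d) * c)"
    using Suc by (intro differentiable_upto_mult differentiable_upto_const) (auto simp: differentiable_upto_Suc)
  moreover have "(\<lambda>x. f (c * x + d)) differentiable (at x)" for x
    using D real_differentiable_def by blast
  ultimately show ?case by (simp add: differentiable_upto_Suc)
qed

section \<open>The function exp (-1/x) and its derivatives\<close>

definition exp_inv_poly :: "real poly \<Rightarrow> real \<Rightarrow> real" where
  "exp_inv_poly p x = (if x > 0 then poly p (inverse x) * exp (- inverse x) else 0)"

lemma poly_exp_tendsto_0: "((\<lambda>y. poly p y * exp (- y)) \<longlongrightarrow> (0::real)) at_top"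
proof -
  have "((\<lambda>y. \<Sum>i\<le>degree p. coeff p i * (y ^ i / exp y)) \<longlongrightarrow> (\<Sum>i\<le>degree p. coeff p i * 0)) at_top"
    by (intro tendsto_intros tendsto_power_div_exp_0)
  then show ?thesis
    by (simp add: poly_altdef sum_distrib_right exp_minus divide_inverse mult.assoc)
qed

text \<open>All derivatives of exp (-1/x), extended by 0, are of the form p(1/x) exp (-1/x): with y
  = 1/x, differentiation acts on the polynomial as p |-> y^2 (p - p'). This makes smoothness an
  induction over all polynomials at once.\<close>

lemma exp_inv_poly_deriv:
  "(exp_inv_poly p has_field_derivative exp_inv_poly ([:0, 0, 1:] * (p - pderiv p)) x) (at x)"
proof -
  consider "x < 0" | "x > 0" | "x = 0" by linarith
  then show ?thesis
  proof cases
    case 1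
    have "((\<lambda>x. 0) has_field_derivative exp_inv_poly ([:0, 0, 1:] * (p - pderiv p)) x) (at x)"
      using 1 by (auto simp: exp_inv_poly_def)
    then show ?thesis
      by (rule has_field_derivative_transform_within_open[of _ _ _ "{..<0}"])
        (use 1 in \<open>auto simp: exp_inv_poly_def\<close>)
  next
    case 2
    have "((\<lambda>x. poly p (inverse x) * exp (- inverse x))
        has_field_derivative exp_inv_poly ([:0, 0, 1:] * (p - pderiv p)) x) (at x)"
      using 2 by (auto intro!: derivative_eq_intros DERIV_chain2[OF poly_DERIV]
          simp: exp_inv_poly_def field_simps power2_eq_square)
    then show ?thesis
      by (rule has_field_derivative_transform_within_open[of _ _ _ "{0<..}"])
        (use 2 in \<open>auto simp: exp_inv_poly_def\<close>)
  next
    case 3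
    \<comment> \<open>The difference quotient at 0 is y p(y) exp (-y) with y = 1/h; dividing by
      \<open>h\<close> is the extra factor y in \<open>pCons 0 p\<close>.\<close>
    have "((\<lambda>h. poly (pCons 0 p) (inverse h) * exp (- inverse h)) \<longlongrightarrow> 0) (at_right 0)"
      using filterlim_compose[OF poly_exp_tendsto_0 filterlim_inverse_at_top_right] .
    then have r: "((\<lambda>h. (exp_inv_poly p h) / h) \<longlongrightarrow> 0) (at_right 0)"
      by (rule Lim_transform_eventually)
         (auto simp: eventually_at_filter exp_inv_poly_def field_simps)
    have l: "((\<lambda>h. (exp_inv_poly p h) / h) \<longlongrightarrow> 0) (at_left 0)"
      by (rule Lim_transform_eventually[OF tendsto_const])
         (auto simp: eventually_at_filter exp_inv_poly_def field_simps)
    have "((\<lambda>h. (exp_inv_poly p h) / h) \<longlongrightarrow> 0) (at 0)"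
      using l r by (simp add: filterlim_split_at)
    then show ?thesis
      using 3 by (simp add: DERIV_def exp_inv_poly_def[of _ 0])
  qed
qed

lemma exp_inv_poly_smooth: "differentiable_upto k (exp_inv_poly p)"
proof (induction k arbitrary: p)
  case 0
  show ?case
    unfolding differentiable_upto_0 using exp_inv_poly_deriv real_differentiable_def by blast
next
  case (Suc k)
  have "deriv (exp_inv_poly p) = exp_inv_poly ([:0, 0, 1:] * (p - pderiv p))"
    by (intro ext DERIV_imp_deriv exp_inv_poly_deriv)
  with Suc show ?case
    unfolding differentiable_upto_Suc using exp_inv_poly_deriv real_differentiable_def by metis
qed

text \<open>Raising a bump to the power \<open>1/n\<close> is the same as rescaling \<open>exp (-1/x)\<close>; so these
  functions increase to the indicator function of the interval, without any normalisation.\<close>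

definition bump :: "real \<Rightarrow> real \<Rightarrow> nat \<Rightarrow> real \<Rightarrow> real" where
  "bump c d n x = exp_inv_poly 1 (real (Suc n) * (x - c)) * exp_inv_poly 1 (real (Suc n) * (d - x))"

lemma bump_outside: "x \<le> c \<or> d \<le> x \<Longrightarrow> bump c d n x = 0"
  by (auto simp: bump_def exp_inv_poly_def mult_le_0_iff zero_less_mult_iff)

lemma bump_inside: "c < x \<Longrightarrow> x < d \<Longrightarrow> 0 < bump c d n x"
  by (auto simp: bump_def exp_inv_poly_def zero_less_mult_iff)

lemma bump_bounds: "0 \<le> bump c d n x" "bump c d n x \<le> 1"
  by (auto simp: bump_def exp_inv_poly_def zero_less_mult_iff intro!: mult_le_one mult_nonneg_nonneg)

lemma bump_tendsto: "(\<lambda>n. bump c d n x) \<longlonglongrightarrow> indicator {c<..<d} x"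
proof (cases "c < x \<and> x < d")
  case True
  have lim: "(\<lambda>n. exp (- inverse (real (Suc n) * y))) \<longlonglongrightarrow> 1" for y :: real
  proof -
    have "(\<lambda>n. exp (- (inverse (Suc n) * inverse y))) \<longlonglongrightarrow> exp (- (0 * inverse y))"
      by (intro tendsto_intros LIMSEQ_inverse_real_of_nat)
    then show ?thesis by (simp add: mult.commute)
  qed
  have "(\<lambda>n. exp (- inverse (real (Suc n) * (x - c))) * exp (- inverse (real (Suc n) * (d - x)))) \<longlonglongrightarrow> 1 * 1"
    using lim[of "x - c"] lim[of "d - x"] by (rule tendsto_mult)
  moreover have "bump c d n x = exp (- inverse (real (Suc n) * (x - c))) * exp (- inverse (real (Suc n) * (d - x)))" for n
    using True unfolding bump_def exp_inv_poly_def by (simp del: of_nat_Suc add: zero_less_mult_iff)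
  ultimately show ?thesis using True by simp
next
  case False
  then have "bump c d n x = 0" for n by (intro bump_outside) auto
  with False show ?thesis by (auto simp: indicator_def)
qed

lemma bump_smooth: "differentiable_upto k (bump c d n)"
proof -
  have "bump c d n = (\<lambda>x. exp_inv_poly 1 (real (Suc n) * x + - (real (Suc n) * c)) * exp_inv_poly 1 (- real (Suc n) * x + real (Suc n) * d))"
    unfolding bump_def by (intro ext arg_cong2[where f="(*)"] arg_cong[where f="exp_inv_poly 1"])
       (simp_all add: algebra_simps)
  then show ?thesis
    by (simp only:) (intro differentiable_upto_mult differentiable_upto_affine exp_inv_poly_smooth)
qed

section \<open>Test functions on an open interval\<close>

lemma test_functionsI:
  assumes "\<And>k. differentiable_upto k f" "c \<le> d" "{c..d} \<subseteq> S" "\<And>x. x \<notin> {c..d} \<Longrightarrow> f x = 0"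
  shows "f \<in> test_functions S"
proof -
  have s: "closure {x. f x \<noteq> 0} \<subseteq> {c..d}"
    using assms(4) by (intro closure_minimal subsetI) (blast, simp)
  then have "compact (closure {x. f x \<noteq> 0})"
    using compact_Int_closed[OF compact_Icc closed_closure, of c d "{x. f x \<noteq> 0}"] by (simp add: Int_absorb1)
  then show ?thesis
    using assms s by (auto simp: test_functions_def differentiable_upto_def)
qed

lemma bump_test_function:
  assumes "a < c" "c \<le> d" "d < b" shows "bump c d n \<in> test_functions {a<..<b}"
  by (rule test_functionsI[of _ c d]) (use assms bump_smooth bump_outside in auto)

lemma test_functions_cbox:
  assumes "f \<in> test_functions {a<..<b::real}" "a < b"
  obtains c d where "a < c" "c < d" "d < b" "\<And>x. x \<notin> {c..d} \<Longrightarrow> f x = 0"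
proof -
  let ?K = "closure {x. f x \<noteq> 0}"
  \<comment> \<open>The midpoint is added to the support so that the compact set is nonempty even
    for the zero function.\<close>
  define m where "m = (a + b) / 2"
  have m: "a < m" "m < b" using assms(2) by (auto simp: m_def field_simps)
  have K: "compact (insert m ?K)" "insert m ?K \<subseteq> {a<..<b}" "insert m ?K \<noteq> {}"
    using assms m by (auto simp: test_functions_def)
  obtain u where u: "u \<in> insert m ?K" "\<And>x. x \<in> insert m ?K \<Longrightarrow> u \<le> x"
    using compact_attains_inf[OF K(1,3)] by blast
  obtain v where v: "v \<in> insert m ?K" "\<And>x. x \<in> insert m ?K \<Longrightarrow> x \<le> v"
    using compact_attains_sup[OF K(1,3)] by blast
  have uv: "a < u" "v < b" "u \<le> v" using u v K(2) by auto
  \<comment> \<open>Going halfway from the extreme points to \<open>a\<close> and \<open>b\<close>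
    makes the enclosing interval nondegenerate, even if the support is a single point.\<close>
  have "f x = 0" if "x \<notin> {(a + u)/2..(v + b)/2}" for x
  proof (rule ccontr)
    assume "f x \<noteq> 0"
    then have "x \<in> ?K" using closure_subset by fastforce
    then have "u \<le> x" "x \<le> v" using u v by auto
    with that uv show False by (auto simp: field_simps)
  qed
  then show ?thesis
    using uv by (intro that[of "(a + u)/2" "(v + b)/2"]) (auto simp: field_simps)
qed

lemma test_functions_upto: "f \<in> test_functions S \<Longrightarrow> differentiable_upto k f"
  by (auto simp: test_functions_def differentiable_upto_def)

lemma test_functions_has_deriv:
  "f \<in> test_functions S \<Longrightarrow> (f has_field_derivative deriv f x) (at x)"
  using test_functions_upto[of f S 0]
  by (simp add: differentiable_upto_0 DERIV_deriv_iff_real_differentiable)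

text \<open>Off its closed support a function vanishes in a neighbourhood of the point, so
  differentiation does not enlarge the support.\<close>

lemma test_functions_deriv: "f \<in> test_functions S \<Longrightarrow> deriv f \<in> test_functions S"
proof -
  assume f: "f \<in> test_functions S"
  have "deriv f x = 0" if "x \<notin> closure {x. f x \<noteq> 0}" for x
  proof -
    have "(f has_field_derivative 0) (at x)"
      by (rule has_field_derivative_transform_within_open[of "\<lambda>_. 0" _ _ "- closure {x. f x \<noteq> 0}"])
         (use that closure_subset[of "{x. f x \<noteq> 0}"] in auto)
    then show ?thesis by (rule DERIV_imp_deriv)
  qed
  then have s: "closure {x. deriv f x \<noteq> 0} \<subseteq> closure {x. f x \<noteq> 0}"
    by (intro closure_minimal) auto
  have "(deriv ^^ k) (deriv f) differentiable (at x)" for k x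
    using f unfolding test_functions_def by (simp flip: funpow_deriv_Suc) (metis funpow_simps_right(2) comp_apply funpow.simps(2))
  moreover have "compact (closure {x. deriv f x \<noteq> 0})"
    using f s unfolding test_functions_def
    by (metis (no_types, lifting) Int_absorb1 closed_closure compact_Int_closed mem_Collect_eq)
  ultimately show ?thesis
    using f s by (auto simp: test_functions_def)
qed

lemma test_functions_continuous: "f \<in> test_functions S \<Longrightarrow> continuous_on A f"
  using test_functions_has_deriv DERIV_isCont continuous_at_imp_continuous_on by blast

section \<open>Weak derivatives on an interval\<close>

lemma finite_measure_lebesgue_on_interval: "finite_measure (lebesgue_on {a<..<b::real})"
  by (rule finite_measure_lebesgue_on) simp

lemma borel_measurable_lebesgue_on: "f \<in> borel_measurable borel \<Longrightarrow> f \<in> borel_measurable (lebesgue_on S)"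
  by (intro measurable_restrict_space1) (simp add: measurable_completion)

lemma borel_measurable_indicator_lebesgue_on:
  "A \<in> sets borel \<Longrightarrow> (indicator A :: real \<Rightarrow> real) \<in> borel_measurable (lebesgue_on S)"
  by (intro borel_measurable_lebesgue_on borel_measurable_indicator)

lemma integrable_times_bounded:
  fixes f g :: "'a \<Rightarrow> real"
  assumes "integrable M f" "g \<in> borel_measurable M" "\<And>x. x \<in> space M \<Longrightarrow> \<bar>g x\<bar> \<le> B"
  shows "integrable M (\<lambda>x. f x * g x)"
proof (rule Bochner_Integration.integrable_bound[of M "\<lambda>x. B * f x"])
  show "AE x in M. norm (f x * g x) \<le> norm (B * f x)"
  proof (intro AE_I2)
    fix x assume "x \<in> space M"
    then have "\<bar>g x\<bar> \<le> \<bar>B\<bar>" using assms(3) by fastforce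
    then show "norm (f x * g x) \<le> norm (B * f x)"
      by (simp add: abs_mult mult.commute[of "\<bar>f x\<bar>"] mult_right_mono)
  qed
qed (use assms in auto)

lemma integrable_times_indicator_interval:
  fixes f :: "real \<Rightarrow> real"
  assumes "integrable (lebesgue_on S) f" "A \<in> sets borel"
  shows "integrable (lebesgue_on S) (\<lambda>x. indicator A x * f x)"
proof -
  have "integrable (lebesgue_on S) (\<lambda>x. f x * indicator A x)"
    by (rule integrable_times_bounded[OF assms(1), of _ 1])
       (use assms(2) in \<open>auto intro: borel_measurable_indicator_lebesgue_on split: split_indicator\<close>)
  then show ?thesis by (simp add: mult.commute)
qed

text \<open>The bridge between the Lebesgue integral on the open interval, in which the function
  spaces are defined, and the gauge integral on closed subintervals, for which the fundamental
  theorem of calculus is available.\<close>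

lemma has_integral_lebesgue_on_interval:
  fixes g :: "real \<Rightarrow> real"
  assumes g: "integrable (lebesgue_on {a<..<b}) g" and xy: "a \<le> x" "x \<le> y" "y \<le> b"
  shows "(g has_integral (\<integral>z. indicator {x<..<y} z * g z \<partial>lebesgue_on {a<..<b})) {x..y}"
proof -
  have "((\<lambda>z. indicator {x<..<y} z * g z) has_integral
      (\<integral>z. indicator {x<..<y} z * g z \<partial>lebesgue_on {a<..<b})) {a<..<b}"
    using g by (intro has_integral_integral_lebesgue_on integrable_times_indicator_interval) auto
  moreover have "(\<lambda>z. indicator {x<..<y} z * g z) = (\<lambda>z. if z \<in> {x<..<y} then g z else 0)"
    by (auto simp: fun_eq_iff)
  ultimately have "((\<lambda>z. if z \<in> {x<..<y} then g z else 0) has_integral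
      (\<integral>z. indicator {x<..<y} z * g z \<partial>lebesgue_on {a<..<b})) {a<..<b}"
    by metis
  moreover have "{x<..<y} \<subseteq> {a<..<b}" using xy by auto
  ultimately have "(g has_integral (\<integral>z. indicator {x<..<y} z * g z \<partial>lebesgue_on {a<..<b})) {x<..<y}"
    by (simp only: has_integral_restrict)
  then show ?thesis
    by (simp add: has_integral_Icc_iff_Ioo)
qed

section \<open>The fundamental lemma of the calculus of variations\<close>

lemma AE_eq_0_if_interval_integrals_0:
  fixes u :: "real \<Rightarrow> real"
  assumes u: "integrable (lebesgue_on {a<..<b}) u" and ab: "a < b"
    and 0: "\<And>c d. a < c \<Longrightarrow> c < d \<Longrightarrow> d < b \<Longrightarrow>
        (\<integral>x. indicator {c<..<d} x * u x \<partial>lebesgue_on {a<..<b}) = 0"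
  shows "AE x in lebesgue_on {a<..<b}. u x = 0"
proof -
  let ?M = "lebesgue_on {a<..<b}"
  \<comment> \<open>Intervals compactly inside \<open>{a<..<b}\<close> exhaust the part of a ray
    that lies in it, and \<open>\<bar>u y\<bar>\<close> dominates.\<close>
  have ray: "(\<integral>y. indicator {x<..} y * u y \<partial>?M) = 0" for x
  proof (cases "x < b")
    case True
    define m where "m = max a x"
    \<comment> \<open>The denominator starts at 3, so that \<open>s n\<close> stays below half of
      the length and no truncated interval is empty.\<close>
    define s where "s n = (b - m) * inverse (real (Suc (Suc (Suc n))))" for n
    have m: "m < b" "a \<le> m" "x \<le> m" using True ab by (auto simp: m_def)
    have s: "0 < s n" "s n < (b - m) / 2" for n
    proof -
      define r where "r = inverse (real (Suc (Suc (Suc n))))"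
      have "r < inverse 2" "0 < r"
        unfolding r_def by (intro less_imp_inverse_less, auto)
      then have "(b - m) * r < (b - m) * inverse 2" "0 < (b - m) * r"
        using m by (intro mult_strict_left_mono mult_pos_pos; simp)+
      then show "0 < s n" "s n < (b - m) / 2"
        by (simp_all only: s_def r_def divide_inverse)
    qed
    have "(\<lambda>n. (b - m) * inverse (real (Suc (n + 2)))) \<longlonglongrightarrow> (b - m) * 0"
      by (intro tendsto_intros LIMSEQ_ignore_initial_segment[OF LIMSEQ_inverse_real_of_nat])
    then have s0: "s \<longlonglongrightarrow> 0" by (simp add: s_def[abs_def])
    have "(\<lambda>n. \<integral>y. indicator {m + s n<..<b - s n} y * u y \<partial>?M) \<longlonglongrightarrow> (\<integral>y. indicator {x<..} y * u y \<partial>?M)"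
    proof (rule integral_dominated_convergence[where w = "\<lambda>y. \<bar>u y\<bar>"])
      show "AE y in ?M. (\<lambda>n. indicator {m + s n<..<b - s n} y * u y) \<longlonglongrightarrow> indicator {x<..} y * u y"
      proof (intro AE_I2 tendsto_mult_right tendsto_eventually)
        fix y assume "y \<in> space ?M"
        then have y: "a < y" "y < b" by auto
        show "\<forall>\<^sub>F n in sequentially. indicator {m + s n<..<b - s n} y = (indicator {x<..} y :: real)"
        proof (cases "m < y")
          case True
          have "\<forall>\<^sub>F n in sequentially. s n < y - m" "\<forall>\<^sub>F n in sequentially. s n < b - y"
            using order_tendstoD(2)[OF s0] True y by auto
          then show ?thesis
          proof eventually_elim
            case (elim n)
            then have "y \<in> {m + s n<..<b - s n}" "y \<in> {x<..}"
              using True m by (simp_all add: field_simps)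
            then show ?case by (simp only: indicator_simps)
          qed
        next
          case False
          then have "y \<le> x" using y by (auto simp: m_def)
          have "\<not> m + s n < y" for n using s(1)[of n] False by linarith
          with \<open>y \<le> x\<close> show ?thesis by (auto simp: indicator_def)
        qed
      qed
      show "AE y in ?M. norm (indicator {m + s n<..<b - s n} y * u y) \<le> \<bar>u y\<bar>" for n
        by (intro AE_I2) (auto simp: indicator_def)
      show "(\<lambda>y. indicator {x<..} y * u y) \<in> borel_measurable ?M"
        using u by (intro borel_measurable_times borel_measurable_indicator_lebesgue_on) auto
      show "(\<lambda>y. indicator {m + s n<..<b - s n} y * u y) \<in> borel_measurable ?M" for n
        using u by (intro borel_measurable_times borel_measurable_indicator_lebesgue_on) auto
      show "integrable ?M (\<lambda>y. \<bar>u y\<bar>)" using u by auto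
    qed
    moreover have "m + s n < b - s n" for n
      using s(2)[of n] by (simp add: field_simps)
    then have "(\<integral>y. indicator {m + s n<..<b - s n} y * u y \<partial>?M) = 0" for n
      by (rule 0[rotated]) (use s(1)[of n] m in \<open>auto simp: less_diff_eq\<close>)
    ultimately show ?thesis by (simp add: LIMSEQ_const_iff)
  next
    case False
    then have "(\<integral>y. indicator {x<..} y * u y \<partial>?M) = (\<integral>y. 0 \<partial>?M)"
      by (intro Bochner_Integration.integral_cong) (auto simp: indicator_def)
    then show ?thesis by simp
  qed
  let ?v = "\<lambda>x. indicator {a<..<b} x * u x"
  have v: "integrable lebesgue ?v"
    using u by (simp add: integrable_restrict_space)
  \<comment> \<open>Rays determine a measure on the Borel sets only, so \<open>u\<close> is replaced
    by a Borel function equal to it almost everywhere.\<close>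
  obtain w where w: "w \<in> borel_measurable lborel" "AE x in lborel. ?v x = w x"
    using completion_ex_borel_measurable_real[OF borel_measurable_integrable[OF v]] by auto
  have wl: "integrable lebesgue w"
  proof (subst integrable_cong_AE)
    show "w \<in> borel_measurable lebesgue" using w(1) by (rule measurable_completion)
    show "?v \<in> borel_measurable lebesgue" using v by (rule borel_measurable_integrable)
    show "AE x in lebesgue. w x = ?v x"
      using AE_completion[OF w(2)] by eventually_elim simp
  qed (rule v)
  then have wi: "integrable lborel w"
    using w by (simp add: integrable_completion)
  have ray_w: "(\<integral>y. indicator {x<..} y * w y \<partial>lborel) = 0" for x
  proof -
    have "(\<integral>y. indicator {x<..} y * w y \<partial>lborel) = (\<integral>y. indicator {x<..} y * w y \<partial>lebesgue)"
      using w by (subst integral_completion) auto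
    also have "\<dots> = (\<integral>y. indicator {x<..} y * ?v y \<partial>lebesgue)"
    proof (intro integral_cong_AE)
      have "(indicator {x<..} :: real \<Rightarrow> real) \<in> borel_measurable lebesgue"
        using borel_measurable_indicator_lebesgue_on[of "{x<..}" UNIV] by (simp add: lebesgue_on_UNIV_eq)
      then show "(\<lambda>y. indicator {x<..} y * w y) \<in> borel_measurable lebesgue"
        "(\<lambda>y. indicator {x<..} y * ?v y) \<in> borel_measurable lebesgue"
        using borel_measurable_integrable[OF v] borel_measurable_integrable[OF wl]
        by (auto simp only: intro: borel_measurable_times)
      show "AE y in lebesgue. indicator {x<..} y * w y = indicator {x<..} y * ?v y"
        using AE_completion[OF w(2)] by eventually_elim simp
    qed
    also have "\<dots> = (\<integral>y. indicator {x<..} y * u y \<partial>?M)"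
      by (subst integral_restrict_space) (simp_all add: mult_ac)
    finally show ?thesis using ray by simp
  qed
  \<comment> \<open>The positive and the negative part of \<open>w\<close> are densities of two
    finite measures that agree on rays, hence on all Borel sets. Uniqueness of densities equates the
    two parts, which leaves only 0.\<close>
  let ?P = "\<lambda>x. max 0 (w x)" and ?N = "\<lambda>x. max 0 (- w x)"
  have PN: "integrable lborel ?P" "integrable lborel ?N"
    using wi by auto
  have e: "emeasure (density lborel (\<lambda>x. ennreal (f x))) {x<..} = ennreal (\<integral>y. indicator {x<..} y * f y \<partial>lborel)"
    if "integrable lborel f" "\<And>x. 0 \<le> f x" for f :: "real \<Rightarrow> real" and x
  proof -
    have "emeasure (density lborel (\<lambda>x. ennreal (f x))) {x<..} = (\<integral>\<^sup>+y. ennreal (indicator {x<..} y * f y) \<partial>lborel)"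
      using that by (subst emeasure_density) (auto intro!: nn_integral_cong greaterThan_borel simp: indicator_def)
    also have "\<dots> = ennreal (\<integral>y. indicator {x<..} y * f y \<partial>lborel)"
    proof (rule nn_integral_eq_integral)
      show "integrable lborel (\<lambda>y. indicator {x<..} y * f y)"
        using integrable_real_mult_indicator[OF _ that(1), of "{x<..}"] by (simp add: mult.commute)
    qed (use that(2) in simp)
    finally show ?thesis .
  qed
  have eq: "(\<integral>y. indicator {x<..} y * ?P y \<partial>lborel) = (\<integral>y. indicator {x<..} y * ?N y \<partial>lborel)" for x
  proof -
    have i: "integrable lborel (\<lambda>y. indicator {x<..} y * f y)" if "integrable lborel f" for f :: "real \<Rightarrow> real"
      using integrable_real_mult_indicator[OF _ that, of "{x<..}"] by (simp add: mult.commute)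
    have "(\<integral>y. indicator {x<..} y * ?P y \<partial>lborel) - (\<integral>y. indicator {x<..} y * ?N y \<partial>lborel)
        = (\<integral>y. indicator {x<..} y * ?P y - indicator {x<..} y * ?N y \<partial>lborel)"
      by (intro Bochner_Integration.integral_diff[symmetric] i PN)
    also have "\<dots> = (\<integral>y. indicator {x<..} y * w y \<partial>lborel)"
      by (intro Bochner_Integration.integral_cong) (auto simp: indicator_def)
    finally show ?thesis using ray_w by simp
  qed
  have "density lborel (\<lambda>x. ennreal (?P x)) = density lborel (\<lambda>x. ennreal (?N x))"
  proof (rule measure_eqI_lessThan)
    show "emeasure (density lborel (\<lambda>x. ennreal (?P x))) {x<..} = emeasure (density lborel (\<lambda>x. ennreal (?N x))) {x<..}" for x
      unfolding e[OF PN(1) max.cobounded1] e[OF PN(2) max.cobounded1] eq ..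
    show "emeasure (density lborel (\<lambda>x. ennreal (?P x))) {x<..} < \<infinity>" for x
      unfolding e[OF PN(1) max.cobounded1] by simp
  qed simp_all
  then have "AE x in lborel. ennreal (?P x) = ennreal (?N x)"
    using w by (intro sigma_finite_measure.density_unique[OF sigma_finite_lborel]) auto
  then have "AE x in lborel. w x = 0"
    by eventually_elim (auto simp: max_def split: if_splits)
  with w(2) have "AE x in lborel. ?v x = 0" by eventually_elim auto
  then have "AE x in lebesgue. ?v x = 0" by (rule AE_completion)
  then have "AE x in lebesgue. x \<in> {a<..<b} \<longrightarrow> u x = 0"
    by eventually_elim (auto simp: indicator_def)
  then show ?thesis
    by (subst AE_restrict_space_iff) auto
qed

text \<open>The bumps are test functions between 0 and 1 that converge to the indicator function of
  \<open>{c<..<d}\<close>, so dominated convergence turns the hypothesis into vanishing integrals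
  over intervals.\<close>

lemma AE_eq_0_if_test_integrals_0:
  fixes u :: "real \<Rightarrow> real"
  assumes u: "integrable (lebesgue_on {a<..<b}) u" and ab: "a < b"
    and 0: "\<And>\<theta>. \<theta> \<in> test_functions {a<..<b} \<Longrightarrow> (\<integral>x. u x * \<theta> x \<partial>lebesgue_on {a<..<b}) = 0"
  shows "AE x in lebesgue_on {a<..<b}. u x = 0"
proof (rule AE_eq_0_if_interval_integrals_0[OF u ab])
  fix c d assume cd: "a < c" "c < d" "d < b"
  let ?M = "lebesgue_on {a<..<b}"
  have bm: "bump c d n \<in> borel_measurable ?M" for n
    by (intro borel_measurable_lebesgue_on borel_measurable_continuous_onI)
       (rule test_functions_continuous[OF bump_test_function[of a c d b]], use cd in auto)
  have "(\<lambda>n. \<integral>x. u x * bump c d n x \<partial>?M) \<longlonglongrightarrow> (\<integral>x. u x * indicator {c<..<d} x \<partial>?M)"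
  proof (rule integral_dominated_convergence[where w = "\<lambda>y. \<bar>u y\<bar>"])
    show "AE x in ?M. norm (u x * bump c d n x) \<le> \<bar>u x\<bar>" for n
      by (intro AE_I2) (auto simp: abs_mult bump_bounds intro!: mult_left_le)
    show "AE x in ?M. (\<lambda>n. u x * bump c d n x) \<longlonglongrightarrow> u x * indicator {c<..<d} x"
      by (intro AE_I2 tendsto_mult tendsto_const bump_tendsto)
    show "(\<lambda>x. u x * indicator {c<..<d} x) \<in> borel_measurable ?M"
      using u by (intro borel_measurable_times borel_measurable_indicator_lebesgue_on) auto
    show "(\<lambda>x. u x * bump c d n x) \<in> borel_measurable ?M" for n
      using u bm by (intro borel_measurable_times) auto
    show "integrable ?M (\<lambda>y. \<bar>u y\<bar>)" using u by auto
  qed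
  moreover have "(\<integral>x. u x * bump c d n x \<partial>?M) = 0" for n
    using cd by (intro 0 bump_test_function) auto
  ultimately show "(\<integral>x. indicator {c<..<d} x * u x \<partial>?M) = 0"
    by (simp add: LIMSEQ_const_iff mult.commute)
qed

lemma integrable_test_function:
  assumes "\<theta> \<in> test_functions {a<..<b::real}" "a < b"
  obtains B where "\<And>x. \<bar>\<theta> x\<bar> \<le> B" "\<theta> \<in> borel_measurable (lebesgue_on {a<..<b})"
    "integrable (lebesgue_on {a<..<b}) \<theta>"
proof -
  obtain c d where cd: "a < c" "c < d" "d < b" "\<And>x. x \<notin> {c..d} \<Longrightarrow> \<theta> x = 0"
    using test_functions_cbox[OF assms] by blast
  have "compact (\<theta> ` {c..d})"
    by (intro compact_continuous_image test_functions_continuous[OF assms(1)]) simp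
  then obtain B where B: "\<forall>x\<in>{c..d}. norm (\<theta> x) \<le> B"
    unfolding bounded_iff using compact_imp_bounded bounded_iff by (metis imageI)
  then have b: "\<bar>\<theta> x\<bar> \<le> max 0 B" for x
    using cd(4)[of x] by (cases "x \<in> {c..d}") (auto simp: le_max_iff_disj)
  moreover have m: "\<theta> \<in> borel_measurable (lebesgue_on {a<..<b})"
    by (intro borel_measurable_lebesgue_on borel_measurable_continuous_onI test_functions_continuous[OF assms(1)])
  moreover have "integrable (lebesgue_on {a<..<b}) \<theta>"
  proof -
    interpret finite_measure "lebesgue_on {a<..<b}" by (rule finite_measure_lebesgue_on_interval)
    show ?thesis using b m by (intro integrable_const_bound[of _ "max 0 B"]) auto
  qed
  ultimately show ?thesis using that by blast
qed

section \<open>Integration by parts and the lemma of du Bois-Reymond\<close>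

lemma integral_deriv_test_function:
  assumes \<theta>: "\<theta> \<in> test_functions {a<..<b::real}" and y: "a \<le> y" "y \<le> b" and ab: "a < b"
  shows "(\<integral>x. indicator {y<..<b} x * deriv \<theta> x \<partial>lebesgue_on {a<..<b}) = - \<theta> y"
proof -
  have i: "integrable (lebesgue_on {a<..<b}) (deriv \<theta>)"
    by (rule integrable_test_function[OF test_functions_deriv[OF \<theta>] ab])
  obtain c d where cd: "a < c" "c < d" "d < b" "\<And>x. x \<notin> {c..d} \<Longrightarrow> \<theta> x = 0"
    using test_functions_cbox[OF \<theta> ab] by blast
  have "(deriv \<theta> has_integral (\<theta> b - \<theta> y)) {y..b}"
    using test_functions_has_deriv[OF \<theta>] y
    by (intro fundamental_theorem_of_calculus)
       (auto simp flip: has_real_derivative_iff_has_vector_derivative intro: has_field_derivative_at_within)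
  with has_integral_lebesgue_on_interval[OF i y order.refl] show ?thesis
    using cd(4)[of b] cd(3) by (simp add: has_integral_unique)
qed

text \<open>As \<open>g\<close> is merely integrable, \<open>G\<close> need not be differentiable
  everywhere and the product rule is avoided: \<open>G x\<close> is written as \<open>G a\<close>
  plus the integral of \<open>g\<close> over y < x, and Fubini leaves the integral of the derivative
  of \<open>\<theta>\<close> over (y, b), which is \<open>- \<theta> y\<close>.\<close>

lemma integral_by_parts_test_function:
  fixes g G \<theta> :: "real \<Rightarrow> real"
  assumes g: "integrable (lebesgue_on {a<..<b}) g" and ab: "a < b"
    and G: "\<And>x y. a \<le> x \<Longrightarrow> x \<le> y \<Longrightarrow> y \<le> b \<Longrightarrow> (g has_integral (G y - G x)) {x..y}"
    and \<theta>: "\<theta> \<in> test_functions {a<..<b}"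
  shows "(\<integral>x. G x * deriv \<theta> x \<partial>lebesgue_on {a<..<b}) = - (\<integral>x. g x * \<theta> x \<partial>lebesgue_on {a<..<b})"
proof -
  let ?M = "lebesgue_on {a<..<b}"
  interpret M: finite_measure ?M by (rule finite_measure_lebesgue_on_interval)
  interpret P: pair_sigma_finite ?M ?M ..
  have \<theta>': "deriv \<theta> \<in> test_functions {a<..<b}" by (rule test_functions_deriv[OF \<theta>])
  obtain B where B: "\<And>x. \<bar>deriv \<theta> x\<bar> \<le> B" "deriv \<theta> \<in> borel_measurable ?M" "integrable ?M (deriv \<theta>)"
    using integrable_test_function[OF \<theta>' ab] by blast
  have Gx: "G x = G a + (\<integral>y. indicator {..<x} y * g y \<partial>?M)" if "x \<in> {a<..<b}" for x
  proof -
    have "(g has_integral (\<integral>z. indicator {a<..<x} z * g z \<partial>?M)) {a..x}"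
      by (rule has_integral_lebesgue_on_interval[OF g]) (use that in auto)
    moreover have "(\<integral>z. indicator {a<..<x} z * g z \<partial>?M) = (\<integral>z. indicator {..<x} z * g z \<partial>?M)"
      by (intro Bochner_Integration.integral_cong) (auto simp: indicator_def)
    ultimately show ?thesis
      using G[of a x] that by (auto dest: has_integral_unique)
  qed
  let ?F = "\<lambda>x y. indicator {..<x} y * g y * deriv \<theta> x"
  have meas: "(\<lambda>(x, y). ?F x y) \<in> borel_measurable (?M \<Otimes>\<^sub>M ?M)"
  proof -
    have [measurable]: "(\<lambda>x. x) \<in> borel_measurable ?M" by (intro borel_measurable_lebesgue_on) simp
    have [measurable]: "g \<in> borel_measurable ?M" using g by auto
    note B(2)[measurable]
    have "(\<lambda>p. (if snd p < fst p then 1 else 0) * g (snd p) * deriv \<theta> (fst p)) \<in> borel_measurable (?M \<Otimes>\<^sub>M ?M)"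
      by measurable
    moreover have "(\<lambda>(x, y). ?F x y) = (\<lambda>p. (if snd p < fst p then 1 else 0) * g (snd p) * deriv \<theta> (fst p))"
      by (auto simp: fun_eq_iff indicator_def)
    ultimately show ?thesis by metis
  qed
  have bnd: "integrable (?M \<Otimes>\<^sub>M ?M) (\<lambda>(x, y). B * g y)"
  proof (rule P.Fubini_integrable)
    show "(\<lambda>(x, y). B * g y) \<in> borel_measurable (?M \<Otimes>\<^sub>M ?M)"
      using g by (auto simp: case_prod_beta intro!: borel_measurable_times measurable_compose[OF measurable_snd])
  qed (use g in auto)
  have B': "\<bar>deriv \<theta> x\<bar> \<le> \<bar>B\<bar>" for x
    using B(1)[of x] by linarith
  have int: "integrable (?M \<Otimes>\<^sub>M ?M) (case_prod ?F)"
    by (rule Bochner_Integration.integrable_bound[OF bnd meas])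
       (auto intro!: AE_I2 mult_left_mono B' simp: abs_mult indicator_def mult.commute[of "\<bar>B\<bar>"])
  have "(\<integral>x. G x * deriv \<theta> x \<partial>?M) = (\<integral>x. G a * deriv \<theta> x + (\<integral>y. ?F x y \<partial>?M) \<partial>?M)"
    by (intro Bochner_Integration.integral_cong) (auto simp: Gx distrib_right)
  also have "\<dots> = G a * (\<integral>x. deriv \<theta> x \<partial>?M) + (\<integral>x. \<integral>y. ?F x y \<partial>?M \<partial>?M)"
    using P.integrable_fst[OF int] B by (subst Bochner_Integration.integral_add) auto
  also have "(\<integral>x. deriv \<theta> x \<partial>?M) = 0"
  proof -
    have "(\<integral>x. deriv \<theta> x \<partial>?M) = (\<integral>x. indicator {a<..<b} x * deriv \<theta> x \<partial>?M)"
      by (intro Bochner_Integration.integral_cong) auto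
    also have "\<dots> = - \<theta> a"
      using integral_deriv_test_function[OF \<theta>, of a] ab by simp
    also have "\<theta> a = 0" using test_functions_cbox[OF \<theta> ab] by (metis atLeastAtMost_iff not_le)
    finally show ?thesis by simp
  qed
  also have "(\<integral>x. \<integral>y. ?F x y \<partial>?M \<partial>?M) = (\<integral>y. \<integral>x. ?F x y \<partial>?M \<partial>?M)"
    using P.Fubini_integral[OF int] by simp
  also have "\<dots> = (\<integral>y. - (g y * \<theta> y) \<partial>?M)"
  proof (intro Bochner_Integration.integral_cong refl)
    fix y assume "y \<in> space ?M"
    then have y: "a \<le> y" "y \<le> b" by auto
    have "(\<integral>x. ?F x y \<partial>?M) = (\<integral>x. g y * (indicator {y<..<b} x * deriv \<theta> x) \<partial>?M)"
      by (intro Bochner_Integration.integral_cong) (auto simp: indicator_def)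
    also have "\<dots> = - (g y * \<theta> y)"
      using integral_deriv_test_function[OF \<theta> y ab] by simp
    finally show "(\<integral>x. ?F x y \<partial>?M) = - (g y * \<theta> y)" .
  qed
  finally show ?thesis by simp
qed

text \<open>A test function of mean zero is the derivative of a test function. Subtracting the right
  multiple of a fixed bump \<open>\<beta>\<close> makes the mean of any test function zero; carried
  over to \<open>u\<close> this says that \<open>u - c\<close> is orthogonal to all test functions,
  where \<open>c\<close> is the mean of \<open>u\<close> with weight \<open>\<beta>\<close>.\<close>

lemma du_Bois_Reymond:
  fixes u :: "real \<Rightarrow> real"
  assumes u: "integrable (lebesgue_on {a<..<b}) u" and ab: "a < b"
    and 0: "\<And>\<theta>. \<theta> \<in> test_functions {a<..<b} \<Longrightarrow> (\<integral>x. u x * deriv \<theta> x \<partial>lebesgue_on {a<..<b}) = 0"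
  obtains c where "AE x in lebesgue_on {a<..<b}. u x = c"
proof -
  let ?M = "lebesgue_on {a<..<b}"
  interpret M: finite_measure ?M by (rule finite_measure_lebesgue_on_interval)
  define c0 d0 where "c0 = a + (b - a) / 3" and "d0 = b - (b - a) / 3"
  have cd0: "a < c0" "c0 < d0" "d0 < b" using ab by (auto simp: c0_def d0_def field_simps)
  define \<beta> where "\<beta> = bump c0 d0 0"
  have \<beta>: "\<beta> \<in> test_functions {a<..<b}" unfolding \<beta>_def using cd0 by (intro bump_test_function) auto
  define J where "J \<eta> = (\<integral>x. \<eta> x \<partial>?M)" for \<eta> :: "real \<Rightarrow> real"
  have i: "integrable ?M \<eta>" if "\<eta> \<in> test_functions {a<..<b}" for \<eta>
    by (rule integrable_test_function[OF that ab])
  have ui: "integrable ?M (\<lambda>x. u x * \<eta> x)" if "\<eta> \<in> test_functions {a<..<b}" for \<eta>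
    using integrable_test_function[OF that ab] integrable_times_bounded[OF u] by metis
  have J\<beta>: "J \<beta> > 0"
  proof -
    have "J \<beta> \<noteq> 0"
    proof
      assume "J \<beta> = 0"
      then have "AE x in ?M. \<beta> x = 0"
        unfolding J_def by (subst (asm) integral_nonneg_eq_0_iff_AE) (use i[OF \<beta>] in \<open>auto simp: \<beta>_def bump_bounds\<close>)
      then have "AE x in ?M. x \<notin> {c0<..<d0}"
        by eventually_elim (use bump_inside[of c0 _ d0 0] in \<open>force simp: \<beta>_def\<close>)
      then have "AE x in lebesgue. x \<notin> {c0<..<d0}"
        using cd0 by (subst (asm) AE_restrict_space_iff) (auto elim: eventually_mono)
      then have "emeasure lebesgue {c0<..<d0} = 0"
        by (subst (asm) AE_iff_measurable[of "{c0<..<d0}"]) auto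
      then show False using cd0 by simp
    qed
    moreover have "J \<beta> \<ge> 0" unfolding J_def by (intro integral_nonneg_AE) (auto simp: \<beta>_def bump_bounds)
    ultimately show ?thesis by simp
  qed
  define c where "c = (\<integral>x. u x * \<beta> x \<partial>?M) / J \<beta>"
  have "AE x in ?M. u x - c = 0"
  proof (rule AE_eq_0_if_test_integrals_0[OF _ ab])
    show "integrable ?M (\<lambda>x. u x - c)" using u by simp
    fix \<eta> assume \<eta>: "\<eta> \<in> test_functions {a<..<b}"
    define \<zeta> where "\<zeta> x = \<eta> x - J \<eta> / J \<beta> * \<beta> x" for x
    have \<zeta>s: "differentiable_upto k \<zeta>" for k
    proof -
      have "differentiable_upto k (\<lambda>x. \<eta> x + - (J \<eta> / J \<beta>) * \<beta> x)"
        by (intro differentiable_upto_add differentiable_upto_mult differentiable_upto_const test_functions_upto[OF \<eta>] test_functions_upto[OF \<beta>])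
      then show ?thesis by (simp add: \<zeta>_def[abs_def])
    qed
    have contz: "isCont \<zeta> x" for x
      using \<zeta>s[of 0] differentiable_imp_continuous_within by (auto simp: differentiable_upto_0)
    obtain c1 d1 where cd1: "a < c1" "c1 < d1" "d1 < b" "\<And>x. x \<notin> {c1..d1} \<Longrightarrow> \<eta> x = 0"
      using test_functions_cbox[OF \<eta> ab] by blast
    define p q where "p = min c0 c1" and "q = max d0 d1"
    have pq: "a < p" "p < q" "q < b" using cd0 cd1 by (auto simp: p_def q_def)
    have \<zeta>0: "\<zeta> x = 0" if "x \<notin> {p..q}" for x
      using that cd1(4)[of x] bump_outside[of x c0 d0 0] unfolding \<zeta>_def \<beta>_def p_def q_def by (cases "x < p") force+
    obtain F where F: "\<And>x::real. (F has_field_derivative \<zeta> x) (at x)"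
      using einterval_antiderivative[of "-\<infinity>" "\<infinity>" \<zeta>] contz unfolding has_real_derivative_iff_has_vector_derivative by auto
    define \<theta> where "\<theta> x = F x - F a" for x
    have \<theta>': "(\<theta> has_field_derivative \<zeta> x) (at x)" for x
      unfolding \<theta>_def[abs_def] using DERIV_diff[OF F[of x] DERIV_const] by simp
    have d\<theta>: "deriv \<theta> = \<zeta>" by (intro ext DERIV_imp_deriv \<theta>')
    have \<zeta>i: "integrable ?M \<zeta>" unfolding \<zeta>_def[abs_def] using i[OF \<eta>] i[OF \<beta>] by auto
    \<comment> \<open>The mean zero makes the primitive that starts with the value 0 at
      \<open>a\<close> vanish at \<open>b\<close> as well, so it has compact support on both
      sides.\<close>
    have "J \<zeta> = 0"
      using J\<beta> i[OF \<eta>] i[OF \<beta>] by (simp add: J_def \<zeta>_def[abs_def])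
    moreover have "(\<zeta> has_integral J \<zeta>) {a<..<b}"
      unfolding J_def using \<zeta>i by (intro has_integral_integral_lebesgue_on) auto
    moreover have "(\<zeta> has_integral (\<theta> b - \<theta> a)) {a..b}"
      using \<theta>' ab by (intro fundamental_theorem_of_calculus)
       (auto simp flip: has_real_derivative_iff_has_vector_derivative intro: has_field_derivative_at_within)
    ultimately have \<theta>ab: "\<theta> b = 0" "\<theta> a = 0"
      by (auto simp: has_integral_Icc_iff_Ioo \<theta>_def dest: has_integral_unique)
    have "\<theta> x = 0" if "x \<notin> {p..q}" for x
    proof (cases "x < p")
      case True
      have "\<theta> x = \<theta> a"
      proof (rule DERIV_zero_connected_constant[of "{..<p}" "{}"])
        show "continuous_on {..<p} \<theta>" using \<theta>' DERIV_isCont continuous_at_imp_continuous_on by blast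
        show "\<forall>x\<in>{..<p} - {}. DERIV \<theta> x :> 0" using \<theta>' \<zeta>0 by (metis Diff_empty atLeastAtMost_iff lessThan_iff not_le)
      qed (use True pq in auto)
      then show ?thesis using \<theta>ab by simp
    next
      case False
      then have "q < x" using that by auto
      have "\<theta> x = \<theta> b"
      proof (rule DERIV_zero_connected_constant[of "{q<..}" "{}"])
        show "continuous_on {q<..} \<theta>" using \<theta>' DERIV_isCont continuous_at_imp_continuous_on by blast
        show "\<forall>x\<in>{q<..} - {}. DERIV \<theta> x :> 0" using \<theta>' \<zeta>0 by (metis Diff_empty atLeastAtMost_iff greaterThan_iff not_le)
      qed (use \<open>q < x\<close> pq in auto)
      then show ?thesis using \<theta>ab by simp
    qed
    moreover have "differentiable_upto k \<theta>" for k
    proof (cases k)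
      case 0
      show ?thesis unfolding 0 differentiable_upto_0 using \<theta>' real_differentiable_def by blast
    next
      case (Suc j)
      show ?thesis unfolding Suc differentiable_upto_Suc d\<theta> using \<theta>' \<zeta>s real_differentiable_def by blast
    qed
    ultimately have "\<theta> \<in> test_functions {a<..<b}"
      using pq by (intro test_functionsI[of _ p q]) auto
    from 0[OF this] have "0 = (\<integral>x. u x * \<zeta> x \<partial>?M)" by (simp add: d\<theta>)
    also have "\<dots> = (\<integral>x. u x * \<eta> x - J \<eta> / J \<beta> * (u x * \<beta> x) \<partial>?M)"
      by (intro Bochner_Integration.integral_cong) (auto simp: \<zeta>_def algebra_simps)
    also have "\<dots> = (\<integral>x. u x * \<eta> x \<partial>?M) - J \<eta> * c"
      using ui[OF \<eta>] ui[OF \<beta>] by (simp add: c_def)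
    also have "\<dots> = (\<integral>x. (u x - c) * \<eta> x \<partial>?M)"
      using ui[OF \<eta>] i[OF \<eta>] by (simp add: J_def left_diff_distrib)
    finally show "(\<integral>x. (u x - c) * \<eta> x \<partial>?M) = 0" by simp
  qed
  then have "AE x in ?M. u x = c" by eventually_elim simp
  then show ?thesis by (rule that)
qed

text \<open>Completeness of Lebesgue measure: a change on a null set preserves measurability. This
  is what allows free passage between chosen representatives.\<close>

lemma borel_measurable_lebesgue_on_AE:
  fixes f g :: "real \<Rightarrow> real"
  assumes f: "f \<in> borel_measurable (lebesgue_on S)" and eq: "AE x in lebesgue_on S. f x = g x"
    and S: "S \<in> sets lebesgue"
  shows "g \<in> borel_measurable (lebesgue_on S)"
proof -
  have fS: "(\<lambda>x. indicator S x *\<^sub>R f x) \<in> borel_measurable lebesgue"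
    using f S by (simp add: borel_measurable_restrict_space_iff)
  have "AE x in lebesgue. x \<in> S \<longrightarrow> f x = g x"
    using eq S by (simp add: AE_restrict_space_iff)
  then have ae: "AE x in lebesgue. indicator S x *\<^sub>R f x = indicator S x *\<^sub>R g x"
    by eventually_elim (auto simp: indicator_def)
  have "(\<lambda>x. indicator S x *\<^sub>R g x) \<in> borel_measurable lebesgue"
  proof (rule borel_measurableI)
    fix U :: "real set" assume "open U"
    show "(\<lambda>x. indicator S x *\<^sub>R g x) -` U \<inter> space lebesgue \<in> sets lebesgue"
    proof (rule completion.in_sets_AE)
      show "AE x in lebesgue. x \<in> (\<lambda>x. indicator S x *\<^sub>R f x) -` U \<inter> space lebesgue \<longleftrightarrow>
          x \<in> (\<lambda>x. indicator S x *\<^sub>R g x) -` U \<inter> space lebesgue"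
        using ae by eventually_elim (simp only: vimage_eq Int_iff)
      show "(\<lambda>x. indicator S x *\<^sub>R f x) -` U \<inter> space lebesgue \<in> sets lebesgue"
        using fS \<open>open U\<close> by (intro measurable_sets) auto
    qed simp
  qed
  then show ?thesis
    using S by (simp add: borel_measurable_restrict_space_iff)
qed

section \<open>Square-integrable functions and the Cauchy-Schwarz inequality\<close>

lemma L2_space_mult_integrable:
  assumes "u \<in> L2_space S" "v \<in> L2_space S"
  shows "integrable (lebesgue_on S) (\<lambda>x. u x * v x)"
proof (rule Bochner_Integration.integrable_bound[of _ "\<lambda>x. (u x)\<^sup>2 + (v x)\<^sup>2"])
  show "AE x in lebesgue_on S. norm (u x * v x) \<le> norm ((u x)\<^sup>2 + (v x)\<^sup>2)"
  proof (intro AE_I2)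
    fix x
    have "2 * \<bar>u x * v x\<bar> \<le> (u x)\<^sup>2 + (v x)\<^sup>2"
      using sum_squares_bound[of "\<bar>u x\<bar>" "\<bar>v x\<bar>"] by (simp add: abs_mult)
    then have "\<bar>u x * v x\<bar> \<le> (u x)\<^sup>2 + (v x)\<^sup>2" by simp
    then show "norm (u x * v x) \<le> norm ((u x)\<^sup>2 + (v x)\<^sup>2)" by simp
  qed
qed (use assms in \<open>auto simp: L2_space_def intro: borel_measurable_times\<close>)

lemma L2_space_lincomb:
  assumes "u \<in> L2_space S" "v \<in> L2_space S"
  shows "(\<lambda>x. c * u x + d * v x) \<in> L2_space S"
proof -
  have "integrable (lebesgue_on S) (\<lambda>x. c\<^sup>2 * (u x * u x) + 2 * c * d * (u x * v x) + d\<^sup>2 * (v x * v x))"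
    using assms by (intro Bochner_Integration.integrable_add integrable_mult_right L2_space_mult_integrable) auto
  moreover have "(\<lambda>x. c\<^sup>2 * (u x * u x) + 2 * c * d * (u x * v x) + d\<^sup>2 * (v x * v x)) = (\<lambda>x. (c * u x + d * v x)\<^sup>2)"
    by (auto simp: fun_eq_iff power2_eq_square algebra_simps)
  ultimately show ?thesis
    using assms by (auto simp: L2_space_def intro!: borel_measurable_add borel_measurable_times)
qed

lemma L2_space_bounded:
  assumes "u \<in> borel_measurable (lebesgue_on {a<..<b::real})" "\<And>x. x \<in> {a<..<b} \<Longrightarrow> \<bar>u x\<bar> \<le> B"
  shows "u \<in> L2_space {a<..<b}"
proof -
  interpret finite_measure "lebesgue_on {a<..<b}" by (rule finite_measure_lebesgue_on_interval)
  have "(u x)\<^sup>2 \<le> B\<^sup>2" if "x \<in> {a<..<b}" for x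
    using power_mono[OF assms(2)[OF that] abs_ge_zero, of 2] by simp
  then have "integrable (lebesgue_on {a<..<b}) (\<lambda>x. (u x)\<^sup>2)"
    using assms(1) by (intro integrable_const_bound[of _ "B\<^sup>2"]) auto
  then show ?thesis using assms(1) by (simp add: L2_space_def)
qed

lemma L2_space_integrable: "u \<in> L2_space {a<..<b} \<Longrightarrow> integrable (lebesgue_on {a<..<b}) u"
  using L2_space_mult_integrable[of u "{a<..<b}" "\<lambda>_. 1"] L2_space_bounded[of "\<lambda>_. 1" a b 1] by simp

lemma L2_norm_nonneg: "0 \<le> L2_norm S u"
  by (simp add: L2_norm_def L2_inner_def)

lemma L2_norm_power2: "(L2_norm S u)\<^sup>2 = (\<integral>x. (u x)\<^sup>2 \<partial>lebesgue_on S)"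
  by (simp add: L2_norm_def L2_inner_def power2_eq_square)

lemma Cauchy_Schwarz_L2:
  assumes "u \<in> L2_space S" "v \<in> L2_space S"
  shows "\<bar>L2_inner S u v\<bar> \<le> L2_norm S u * L2_norm S v"
proof -
  let ?A = "(L2_norm S u)\<^sup>2" and ?B = "L2_inner S u v" and ?C = "(L2_norm S v)\<^sup>2"
  have q: "0 \<le> ?A * s\<^sup>2 + 2 * s * t * ?B + ?C * t\<^sup>2" for s t
  proof -
    have "0 \<le> (\<integral>x. (s * u x + t * v x)\<^sup>2 \<partial>lebesgue_on S)" by simp
    also have "\<dots> = (\<integral>x. s\<^sup>2 * (u x * u x) + 2 * s * t * (u x * v x) + t\<^sup>2 * (v x * v x) \<partial>lebesgue_on S)"
      by (intro Bochner_Integration.integral_cong) (auto simp: power2_eq_square algebra_simps)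
    also have "\<dots> = s\<^sup>2 * (\<integral>x. u x * u x \<partial>lebesgue_on S) + 2 * s * t * ?B + t\<^sup>2 * (\<integral>x. v x * v x \<partial>lebesgue_on S)"
      using L2_space_mult_integrable[OF assms(1,1)] L2_space_mult_integrable[OF assms(1,2)]
        L2_space_mult_integrable[OF assms(2,2)]
      by (subst Bochner_Integration.integral_add, simp, simp, subst Bochner_Integration.integral_add)
         (auto simp: L2_inner_def)
    finally show ?thesis
      unfolding L2_norm_power2 by (simp add: power2_eq_square[of "u _"] power2_eq_square[of "v _"] algebra_simps)
  qed
  have "?B\<^sup>2 \<le> ?A * ?C"
  proof (cases "?A = 0")
    case True
    have "?B = 0"
    proof (rule ccontr)
      assume B: "?B \<noteq> 0"
      \<comment> \<open>For \<open>?A = 0\<close> the form is affine in \<open>s\<close>; this value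
        of \<open>s\<close>, with \<open>t = 1\<close>, makes it equal to -1.\<close>
      have "0 \<le> 2 * (- (?C + 1) / (2 * ?B)) * ?B + ?C"
        using q[of "- (?C + 1) / (2 * ?B)" 1] True by simp
      then show False using B by (simp add: field_simps)
    qed
    then show ?thesis using True by simp
  next
    case False
    then have A: "?A > 0" by simp
    have "0 \<le> ?A * (?A * ?C - ?B\<^sup>2)"
      using q[of "- ?B" "?A"] by (simp add: power2_eq_square algebra_simps)
    then show ?thesis using A by (simp add: zero_le_mult_iff)
  qed
  then have "\<bar>?B\<bar>\<^sup>2 \<le> (L2_norm S u * L2_norm S v)\<^sup>2" by (simp add: power_mult_distrib)
  then show ?thesis
    by (rule power2_le_imp_le) (simp add: L2_norm_nonneg)
qed

lemma L2_norm_cong_AE: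
  assumes "AE x in lebesgue_on S. u x = v x" "u \<in> borel_measurable (lebesgue_on S)" "S \<in> sets lebesgue"
  shows "L2_norm S u = L2_norm S v"
proof -
  have "v \<in> borel_measurable (lebesgue_on S)"
    using borel_measurable_lebesgue_on_AE[OF assms(2,1,3)] .
  then have "L2_inner S u u = L2_inner S v v"
    unfolding L2_inner_def using assms by (intro integral_cong_AE) (auto elim: eventually_mono)
  then show ?thesis by (simp add: L2_norm_def)
qed

lemma L2_space_cong_AE:
  assumes "AE x in lebesgue_on S. u x = v x" "u \<in> L2_space S" "S \<in> sets lebesgue"
  shows "v \<in> L2_space S"
proof -
  have v: "v \<in> borel_measurable (lebesgue_on S)"
    using borel_measurable_lebesgue_on_AE[OF _ assms(1,3)] assms(2) by (auto simp: L2_space_def)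
  moreover have "integrable (lebesgue_on S) (\<lambda>x. (v x)\<^sup>2)"
  proof (subst integrable_cong_AE)
    show "AE x in lebesgue_on S. (v x)\<^sup>2 = (u x)\<^sup>2" using assms(1) by eventually_elim simp
  qed (use v assms(2) in \<open>auto simp: L2_space_def\<close>)
  ultimately show ?thesis by (simp add: L2_space_def)
qed

lemma integral_abs_le_L2_norm:
  assumes "u \<in> L2_space {a<..<b}" "a < b"
  shows "(\<integral>x. \<bar>u x\<bar> \<partial>lebesgue_on {a<..<b}) \<le> sqrt (b - a) * L2_norm {a<..<b} u"
proof -
  let ?S = "{a<..<b}"
  have u: "(\<lambda>x. \<bar>u x\<bar>) \<in> L2_space ?S" using assms(1) by (auto simp: L2_space_def)
  have one: "(\<lambda>x. 1) \<in> L2_space ?S" by (rule L2_space_bounded[of _ _ _ 1]) auto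
  have "(L2_norm ?S (\<lambda>x. 1))\<^sup>2 = b - a"
    using assms(2) by (simp add: L2_norm_power2 measure_restrict_space)
  then have n: "L2_norm ?S (\<lambda>x. 1) = sqrt (b - a)"
    using L2_norm_nonneg[of ?S "\<lambda>x. 1"] by (metis real_sqrt_unique)
  have "L2_norm ?S (\<lambda>x. \<bar>u x\<bar>) = L2_norm ?S u"
    by (simp add: L2_norm_def L2_inner_def)
  moreover have "(\<integral>x. \<bar>u x\<bar> \<partial>lebesgue_on ?S) = L2_inner ?S (\<lambda>x. \<bar>u x\<bar>) (\<lambda>x. 1)"
    by (simp add: L2_inner_def)
  ultimately show ?thesis
    using Cauchy_Schwarz_L2[OF u one] n by (simp add: mult.commute)
qed

subsection \<open>Uniqueness and linearity\<close>

lemma test_functions_funpow_deriv: "\<theta> \<in> test_functions S \<Longrightarrow> (deriv ^^ k) \<theta> \<in> test_functions S"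
  by (induction k) (auto intro: test_functions_deriv)

lemma locally_integrableD: "locally_integrable S v \<Longrightarrow> compact K \<Longrightarrow> K \<subseteq> S \<Longrightarrow> set_integrable lebesgue K v"
  by (simp add: locally_integrable_def)

lemma integrable_times_test_function:
  assumes v: "locally_integrable {a<..<b::real} v" and \<theta>: "\<theta> \<in> test_functions {a<..<b}" and ab: "a < b"
  shows "integrable (lebesgue_on {a<..<b}) (\<lambda>x. v x * \<theta> x)"
proof -
  obtain c d where cd: "a < c" "c < d" "d < b" "\<And>x. x \<notin> {c..d} \<Longrightarrow> \<theta> x = 0"
    using test_functions_cbox[OF \<theta> ab] by blast
  obtain B where B: "\<And>x. \<bar>\<theta> x\<bar> \<le> B" "\<theta> \<in> borel_measurable (lebesgue_on {a<..<b})"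
    using integrable_test_function[OF \<theta> ab] by blast
  have "set_integrable lebesgue {c..d} v"
    using cd by (intro locally_integrableD[OF v]) auto
  then have "integrable lebesgue (\<lambda>x. indicator {c..d} x *\<^sub>R v x)" by (simp add: set_integrable_def)
  moreover have "\<theta> \<in> borel_measurable lebesgue"
    by (intro measurable_completion) (simp add: borel_measurable_continuous_onI test_functions_continuous[OF \<theta>])
  ultimately have "integrable lebesgue (\<lambda>x. (indicator {c..d} x *\<^sub>R v x) * \<theta> x)"
    by (rule integrable_times_bounded) (rule B(1))
  moreover have "(\<lambda>x. (indicator {c..d} x *\<^sub>R v x) * \<theta> x) = (\<lambda>x. indicator {a<..<b} x *\<^sub>R (v x * \<theta> x))"
  proof
    fix x
    show "(indicator {c..d} x *\<^sub>R v x) * \<theta> x = indicator {a<..<b} x *\<^sub>R (v x * \<theta> x)"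
      using cd(1-3) cd(4)[of x] by (cases "x \<in> {c..d}") auto
  qed
  ultimately show ?thesis by (simp add: integrable_restrict_space)
qed

lemma locally_integrable_lincomb:
  assumes "locally_integrable S u" "locally_integrable S v"
  shows "locally_integrable S (\<lambda>x. c * u x + d * v x)"
  using assms unfolding locally_integrable_def by (auto intro!: set_integral_add set_integrable_mult_right)

lemma integrable_imp_locally_integrable:
  assumes "integrable (lebesgue_on S) v" "S \<in> sets lebesgue"
  shows "locally_integrable S v"
  unfolding locally_integrable_def
proof (intro allI impI)
  fix K assume K: "compact K \<and> K \<subseteq> S"
  have "set_integrable lebesgue S v"
    using assms by (simp add: set_integrable_def integrable_restrict_space)
  moreover have "K \<in> sets lebesgue" using K by (simp add: borel_compact)
  ultimately show "set_integrable lebesgue K v"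
    using K by (auto intro: set_integrable_subset)
qed

text \<open>Exhaustion: on \<open>{a + s n<..<b - s n}\<close> the function is integrable, and test
  functions of the smaller interval are test functions of the larger one. Countably many null sets
  remain.\<close>

lemma AE_eq_0_if_locally_integrable:
  assumes u: "locally_integrable {a<..<b} u" and ab: "a < b"
    and 0: "\<And>\<theta>. \<theta> \<in> test_functions {a<..<b} \<Longrightarrow> (\<integral>x. u x * \<theta> x \<partial>lebesgue_on {a<..<b}) = 0"
  shows "AE x in lebesgue_on {a<..<b}. u x = 0"
proof -
  define s where "s n = (b - a) * inverse (real (Suc (n + 2)))" for n
  have s: "0 < s n" "a + s n < b - s n" for n
  proof -
    have "real (Suc (n + 2)) > 2" by simp
    then have "2 * inverse (real (Suc (n + 2))) < 1" by (simp add: field_simps)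
    then have "(b - a) * (2 * inverse (real (Suc (n + 2)))) < (b - a) * 1"
      using ab by (intro mult_strict_left_mono) auto
    then show "a + s n < b - s n" by (simp add: s_def)
    show "0 < s n" using ab by (simp add: s_def)
  qed
  have part: "AE x in lebesgue_on {a + s n<..<b - s n}. u x = 0" for n
  proof (rule AE_eq_0_if_test_integrals_0[OF _ s(2)])
    have "set_integrable lebesgue {a + s n..b - s n} u"
      using s(1)[of n] by (intro locally_integrableD[OF u]) auto
    then have "set_integrable lebesgue {a + s n<..<b - s n} u"
      by (rule set_integrable_subset) auto
    then show "integrable (lebesgue_on {a + s n<..<b - s n}) u"
      by (simp add: set_integrable_def integrable_restrict_space)
    fix \<theta> assume \<theta>: "\<theta> \<in> test_functions {a + s n<..<b - s n}"
    then have "\<theta> \<in> test_functions {a<..<b}"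
      using s(1)[of n] unfolding test_functions_def by force
    then have "0 = (\<integral>x. u x * \<theta> x \<partial>lebesgue_on {a<..<b})" using 0 by simp
    also have "\<dots> = (\<integral>x. indicator {a<..<b} x *\<^sub>R (u x * \<theta> x) \<partial>lebesgue)"
      by (simp add: integral_restrict_space)
    also have "\<dots> = (\<integral>x. indicator {a + s n<..<b - s n} x *\<^sub>R (u x * \<theta> x) \<partial>lebesgue)"
    proof (intro Bochner_Integration.integral_cong refl)
      fix x
      have "\<theta> x = 0" if "x \<notin> {a + s n<..<b - s n}"
        using \<theta> that closure_subset[of "{x. \<theta> x \<noteq> 0}"] unfolding test_functions_def by blast
      then show "indicator {a<..<b} x *\<^sub>R (u x * \<theta> x) = indicator {a + s n<..<b - s n} x *\<^sub>R (u x * \<theta> x)"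
        using s(1)[of n] by (cases "x \<in> {a + s n<..<b - s n}") auto
    qed
    also have "\<dots> = (\<integral>x. u x * \<theta> x \<partial>lebesgue_on {a + s n<..<b - s n})"
      by (simp add: integral_restrict_space)
    finally show "(\<integral>x. u x * \<theta> x \<partial>lebesgue_on {a + s n<..<b - s n}) = 0" by simp
  qed
  then have "AE x in lebesgue. x \<in> {a + s n<..<b - s n} \<longrightarrow> u x = 0" for n
    using part[of n] by (subst (asm) AE_restrict_space_iff) auto
  then have ae: "AE x in lebesgue. \<forall>n. x \<in> {a + s n<..<b - s n} \<longrightarrow> u x = 0"
    by (simp only: AE_all_countable) blast
  have "s \<longlonglongrightarrow> (b - a) * 0"
    unfolding s_def by (intro tendsto_intros LIMSEQ_ignore_initial_segment[OF LIMSEQ_inverse_real_of_nat])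
  then have s0: "s \<longlonglongrightarrow> 0" by simp
  have "AE x in lebesgue. x \<in> {a<..<b} \<longrightarrow> u x = 0"
    using ae
  proof eventually_elim
    case (elim x)
    show ?case
    proof
      assume "x \<in> {a<..<b}"
      then have "\<forall>\<^sub>F n in sequentially. s n < x - a" "\<forall>\<^sub>F n in sequentially. s n < b - x"
        using order_tendstoD(2)[OF s0] by auto
      then have "\<forall>\<^sub>F n in sequentially. x \<in> {a + s n<..<b - s n}"
        by eventually_elim (auto simp: less_diff_eq)
      then obtain n where "x \<in> {a + s n<..<b - s n}"
        using eventually_happens[of _ sequentially] by auto
      then show "u x = 0" using elim by blast
    qed
  qed
  then show ?thesis by (subst AE_restrict_space_iff) auto
qed

lemma has_weak_deriv_lincomb:
  assumes u: "has_weak_deriv {a<..<b} k u gu" and v: "has_weak_deriv {a<..<b} k v gv" and ab: "a < b"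
  shows "has_weak_deriv {a<..<b} k (\<lambda>x. c * u x + d * v x) (\<lambda>x. c * gu x + d * gv x)"
  unfolding has_weak_deriv_def
proof (intro conjI ballI)
  show "locally_integrable {a<..<b} (\<lambda>x. c * u x + d * v x)"
    "locally_integrable {a<..<b} (\<lambda>x. c * gu x + d * gv x)"
    using u v by (auto simp: has_weak_deriv_def intro: locally_integrable_lincomb)
  fix \<theta> assume \<theta>: "\<theta> \<in> test_functions {a<..<b}"
  let ?M = "lebesgue_on {a<..<b}"
  have comb: "(\<integral>x. (c * p x + d * q x) * \<eta> x \<partial>?M) = c * (\<integral>x. p x * \<eta> x \<partial>?M) + d * (\<integral>x. q x * \<eta> x \<partial>?M)"
    if "locally_integrable {a<..<b} p" "locally_integrable {a<..<b} q" "\<eta> \<in> test_functions {a<..<b}" for p q \<eta>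
  proof -
    have "(\<integral>x. (c * p x + d * q x) * \<eta> x \<partial>?M) = (\<integral>x. c * (p x * \<eta> x) + d * (q x * \<eta> x) \<partial>?M)"
      by (intro Bochner_Integration.integral_cong) (auto simp: algebra_simps)
    also have "\<dots> = c * (\<integral>x. p x * \<eta> x \<partial>?M) + d * (\<integral>x. q x * \<eta> x \<partial>?M)"
      using integrable_times_test_function[OF that(1,3) ab] integrable_times_test_function[OF that(2,3) ab] by simp
    finally show ?thesis .
  qed
  show "(\<integral>x. (c * u x + d * v x) * (deriv ^^ k) \<theta> x \<partial>?M) = (- 1) ^ k * (\<integral>x. (c * gu x + d * gv x) * \<theta> x \<partial>?M)"
  proof -
    have l: "locally_integrable {a<..<b} u" "locally_integrable {a<..<b} v"
      "locally_integrable {a<..<b} gu" "locally_integrable {a<..<b} gv"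
      using u v by (auto simp: has_weak_deriv_def)
    have "(\<integral>x. u x * (deriv ^^ k) \<theta> x \<partial>?M) = (- 1) ^ k * (\<integral>x. gu x * \<theta> x \<partial>?M)"
      "(\<integral>x. v x * (deriv ^^ k) \<theta> x \<partial>?M) = (- 1) ^ k * (\<integral>x. gv x * \<theta> x \<partial>?M)"
      using u v \<theta> unfolding has_weak_deriv_def by blast+
    then show ?thesis
      unfolding comb[OF l(1,2) test_functions_funpow_deriv[OF \<theta>, of k]] comb[OF l(3,4) \<theta>]
      by (simp only: distrib_left mult.left_commute)
  qed
qed

lemma has_weak_deriv_unique:
  assumes g: "has_weak_deriv {a<..<b} k v g" and g': "has_weak_deriv {a<..<b} k v g'" and ab: "a < b"
  shows "AE x in lebesgue_on {a<..<b}. g x = g' x"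
proof -
  have "has_weak_deriv {a<..<b} k (\<lambda>x. 1 * v x + (-1) * v x) (\<lambda>x. 1 * g x + (-1) * g' x)"
    by (rule has_weak_deriv_lincomb[OF g g' ab])
  then have d: "has_weak_deriv {a<..<b} k (\<lambda>x. 0) (\<lambda>x. g x - g' x)" by simp
  have "AE x in lebesgue_on {a<..<b}. g x - g' x = 0"
  proof (rule AE_eq_0_if_locally_integrable[OF _ ab])
    show "locally_integrable {a<..<b} (\<lambda>x. g x - g' x)" using d by (simp add: has_weak_deriv_def)
    fix \<theta> assume "\<theta> \<in> test_functions {a<..<b}"
    with d show "(\<integral>x. (g x - g' x) * \<theta> x \<partial>lebesgue_on {a<..<b}) = 0"
      by (auto simp: has_weak_deriv_def)
  qed
  then show ?thesis by eventually_elim simp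
qed

text \<open>In \<open>sobolev\<close> every derivative is related to the function alone. Testing
  with the derivative of \<open>\<theta>\<close> links consecutive derivatives to each other, so
  that results on first derivatives apply at every order.\<close>

lemma has_weak_deriv_Suc:
  assumes "has_weak_deriv {a<..<b} k v g" "has_weak_deriv {a<..<b} (Suc k) v g'"
  shows "has_weak_deriv {a<..<b} 1 g g'"
  unfolding has_weak_deriv_def
proof (intro conjI ballI)
  fix \<theta> assume \<theta>: "\<theta> \<in> test_functions {a<..<b}"
  let ?M = "lebesgue_on {a<..<b}"
  have "(\<integral>x. v x * (deriv ^^ k) (deriv \<theta>) x \<partial>?M) = (- 1) ^ k * (\<integral>x. g x * deriv \<theta> x \<partial>?M)"
    using assms(1) test_functions_deriv[OF \<theta>] by (simp add: has_weak_deriv_def)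
  moreover have "(\<integral>x. v x * (deriv ^^ k) (deriv \<theta>) x \<partial>?M) = (- 1) ^ Suc k * (\<integral>x. g' x * \<theta> x \<partial>?M)"
    using assms(2) \<theta> unfolding has_weak_deriv_def funpow_deriv_Suc by blast
  ultimately have "(- 1) ^ k * (\<integral>x. g x * deriv \<theta> x \<partial>?M) = (- 1) ^ k * (- (\<integral>x. g' x * \<theta> x \<partial>?M))"
    by simp
  then show "(\<integral>x. g x * (deriv ^^ 1) \<theta> x \<partial>?M) = (- 1) ^ 1 * (\<integral>x. g' x * \<theta> x \<partial>?M)"
    by (subst (asm) mult_left_cancel) simp_all
qed (use assms in \<open>auto simp: has_weak_deriv_def\<close>)

lemma L2_space_locally_integrable: "v \<in> L2_space {a<..<b} \<Longrightarrow> locally_integrable {a<..<b} v"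
  by (intro integrable_imp_locally_integrable L2_space_integrable) auto

text \<open>The choice in \<open>weak_deriv\<close> asks for no integrability; uniqueness up to null
  sets carries square integrability over from the representative that \<open>sobolev\<close>
  provides to the one that was chosen.\<close>

lemma has_weak_deriv_weak_deriv:
  assumes v: "v \<in> sobolev {a<..<b} m" and k: "k \<le> m" and ab: "a < b"
  shows "has_weak_deriv {a<..<b} k v (weak_deriv {a<..<b} k v)" "weak_deriv {a<..<b} k v \<in> L2_space {a<..<b}"
proof -
  have "has_weak_deriv {a<..<b} k v (weak_deriv {a<..<b} k v) \<and> weak_deriv {a<..<b} k v \<in> L2_space {a<..<b}"
  proof (cases "k = 0")
    case True
    with v L2_space_locally_integrable[of v a b] show ?thesis
      by (auto simp: weak_deriv_def has_weak_deriv_def sobolev_def)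
  next
    case False
    then obtain g where g: "g \<in> L2_space {a<..<b}" "has_weak_deriv {a<..<b} k v g"
    proof -
      have "k \<in> {1..m}" using False k by auto
      with v have "\<exists>g\<in>L2_space {a<..<b}. has_weak_deriv {a<..<b} k v g" by (simp add: sobolev_def)
      then show ?thesis using that by blast
    qed
    then have *: "has_weak_deriv {a<..<b} k v (weak_deriv {a<..<b} k v)"
      using False someI[of "has_weak_deriv {a<..<b} k v", OF g(2)] by (simp add: weak_deriv_def)
    have "AE x in lebesgue_on {a<..<b}. g x = weak_deriv {a<..<b} k v x"
      by (rule has_weak_deriv_unique[OF g(2) * ab])
    then show ?thesis using L2_space_cong_AE[OF _ g(1)] * by auto
  qed
  then show "has_weak_deriv {a<..<b} k v (weak_deriv {a<..<b} k v)" "weak_deriv {a<..<b} k v \<in> L2_space {a<..<b}"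
    by auto
qed

lemma sobolev_mono: "v \<in> sobolev S m \<Longrightarrow> k \<le> m \<Longrightarrow> v \<in> sobolev S k"
  by (auto simp: sobolev_def)

lemma weak_deriv_eq_AE:
  assumes "has_weak_deriv {a<..<b} k v g" "0 < k" "a < b"
  shows "AE x in lebesgue_on {a<..<b}. weak_deriv {a<..<b} k v x = g x"
proof (rule has_weak_deriv_unique[OF _ assms(1,3)])
  show "has_weak_deriv {a<..<b} k v (weak_deriv {a<..<b} k v)"
    using assms(2) someI[of "has_weak_deriv {a<..<b} k v", OF assms(1)] by (simp add: weak_deriv_def)
qed

lemma sobolev_lincomb:
  assumes u: "u \<in> sobolev {a<..<b} m" and v: "v \<in> sobolev {a<..<b} m" and ab: "a < b"
  shows "(\<lambda>x. c * u x + d * v x) \<in> sobolev {a<..<b} m"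
proof -
  have "(\<lambda>x. c * u x + d * v x) \<in> L2_space {a<..<b}"
    using u v by (auto simp: sobolev_def intro: L2_space_lincomb)
  moreover have "\<exists>g\<in>L2_space {a<..<b}. has_weak_deriv {a<..<b} k (\<lambda>x. c * u x + d * v x) g" if "k \<in> {1..m}" for k
  proof
    show "has_weak_deriv {a<..<b} k (\<lambda>x. c * u x + d * v x)
        (\<lambda>x. c * weak_deriv {a<..<b} k u x + d * weak_deriv {a<..<b} k v x)"
      using that by (intro has_weak_deriv_lincomb has_weak_deriv_weak_deriv[OF u _ ab] has_weak_deriv_weak_deriv[OF v _ ab] ab) auto
    show "(\<lambda>x. c * weak_deriv {a<..<b} k u x + d * weak_deriv {a<..<b} k v x) \<in> L2_space {a<..<b}"
      using that by (intro L2_space_lincomb has_weak_deriv_weak_deriv[OF u _ ab] has_weak_deriv_weak_deriv[OF v _ ab]) auto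
  qed
  ultimately show ?thesis by (simp add: sobolev_def)
qed

lemma weak_deriv_lincomb:
  assumes u: "u \<in> sobolev {a<..<b} m" and v: "v \<in> sobolev {a<..<b} m" and k: "k \<le> m" and ab: "a < b"
  shows "AE x in lebesgue_on {a<..<b}. weak_deriv {a<..<b} k (\<lambda>x. c * u x + d * v x) x
      = c * weak_deriv {a<..<b} k u x + d * weak_deriv {a<..<b} k v x"
proof (rule has_weak_deriv_unique[OF _ _ ab])
  show "has_weak_deriv {a<..<b} k (\<lambda>x. c * u x + d * v x) (weak_deriv {a<..<b} k (\<lambda>x. c * u x + d * v x))"
    by (rule has_weak_deriv_weak_deriv(1)[OF sobolev_lincomb[OF u v ab] k ab])
  show "has_weak_deriv {a<..<b} k (\<lambda>x. c * u x + d * v x)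
      (\<lambda>x. c * weak_deriv {a<..<b} k u x + d * weak_deriv {a<..<b} k v x)"
    by (intro has_weak_deriv_lincomb has_weak_deriv_weak_deriv[OF u k ab] has_weak_deriv_weak_deriv[OF v k ab] ab)
qed

lemma L2_norm_le_sobolev_norm: "k \<le> m \<Longrightarrow> L2_norm S (weak_deriv S k v) \<le> sobolev_norm S m v"
proof -
  assume "k \<le> m"
  then have "(L2_norm S (weak_deriv S k v))\<^sup>2 \<le> (\<Sum>k\<le>m. (L2_norm S (weak_deriv S k v))\<^sup>2)"
    by (intro member_le_sum) auto
  then show ?thesis
    unfolding sobolev_norm_def by (rule real_le_rsqrt)
qed

section \<open>Continuous representatives\<close>

text \<open>For integrable \<open>g\<close> this is absolute continuity of \<open>G\<close> with
  derivative \<open>g\<close>. Quantifying over all subintervals makes it applicable on mesh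
  elements directly.\<close>

definition primitive_on :: "real \<Rightarrow> real \<Rightarrow> (real \<Rightarrow> real) \<Rightarrow> (real \<Rightarrow> real) \<Rightarrow> bool" where
  "primitive_on a b g G \<longleftrightarrow> (\<forall>x y. a \<le> x \<longrightarrow> x \<le> y \<longrightarrow> y \<le> b \<longrightarrow> (g has_integral (G y - G x)) {x..y})"

lemma primitive_onD:
  "primitive_on a b g G \<Longrightarrow> a \<le> x \<Longrightarrow> x \<le> y \<Longrightarrow> y \<le> b \<Longrightarrow> (g has_integral (G y - G x)) {x..y}"
  by (simp add: primitive_on_def)

lemma integrable_lebesgue_on_interval_imp_integrable_on:
  fixes g :: "real \<Rightarrow> real"
  assumes "integrable (lebesgue_on {a<..<b}) g" "a \<le> x" "x \<le> y" "y \<le> b"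
  shows "g integrable_on {x..y}"
  using has_integral_lebesgue_on_interval[OF assms] by (auto simp: integrable_on_def)

lemma primitive_on_exists:
  assumes g: "integrable (lebesgue_on {a<..<b}) g" and ab: "a < b"
  shows "primitive_on a b g (\<lambda>x. c + integral {a..x} g)" "continuous_on {a..b} (\<lambda>x. c + integral {a..x} g)"
proof -
  have i: "g integrable_on {x..y}" if "a \<le> x" "x \<le> y" "y \<le> b" for x y
    using integrable_lebesgue_on_interval_imp_integrable_on[OF g that] .
  show "primitive_on a b g (\<lambda>x. c + integral {a..x} g)"
    unfolding primitive_on_def
  proof (intro allI impI)
    fix x y assume xy: "a \<le> x" "x \<le> y" "y \<le> b"
    have "integral {a..x} g + integral {x..y} g = integral {a..y} g"
      using xy i[of a y] by (intro Henstock_Kurzweil_Integration.integral_combine) auto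
    then have "c + integral {a..y} g - (c + integral {a..x} g) = integral {x..y} g" by linarith
    then show "(g has_integral (c + integral {a..y} g - (c + integral {a..x} g))) {x..y}"
      using integrable_integral[OF i[OF xy]] by simp
  qed
  show "continuous_on {a..b} (\<lambda>x. c + integral {a..x} g)"
    using i[of a b] ab by (intro continuous_intros indefinite_integral_continuous_1) auto
qed

lemma continuous_on_integrable_lebesgue_on:
  fixes G :: "real \<Rightarrow> real"
  assumes "continuous_on {a..b} G"
  shows "integrable (lebesgue_on {a<..<b}) G" "G \<in> borel_measurable (lebesgue_on {a<..<b})"
proof -
  have "G absolutely_integrable_on {a..b}"
    using absolutely_integrable_continuous_real[OF assms] .
  then have "set_integrable lebesgue {a<..<b} G"
    by (rule set_integrable_subset) auto
  then show "integrable (lebesgue_on {a<..<b}) G"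
    by (simp add: set_integrable_def integrable_restrict_space)
  then show "G \<in> borel_measurable (lebesgue_on {a<..<b})" by auto
qed

lemma has_weak_deriv_primitive:
  assumes g: "integrable (lebesgue_on {a<..<b}) g" and ab: "a < b"
    and G: "primitive_on a b g G" "continuous_on {a..b} G"
  shows "has_weak_deriv {a<..<b} 1 G g"
proof -
  have "locally_integrable {a<..<b} G"
    using continuous_on_integrable_lebesgue_on[OF G(2)] by (intro integrable_imp_locally_integrable) auto
  moreover have "locally_integrable {a<..<b} g"
    using g by (intro integrable_imp_locally_integrable) auto
  ultimately show ?thesis
    using integral_by_parts_test_function[OF g ab primitive_onD[OF G(1)]]
    unfolding has_weak_deriv_def by simp
qed

text \<open>The indefinite integral of \<open>g\<close> has the same weak derivative as
  \<open>v\<close>, so by du Bois-Reymond the two differ by a constant almost everywhere.\<close>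

lemma weak_deriv_primitive:
  assumes v: "integrable (lebesgue_on {a<..<b}) v" and g: "integrable (lebesgue_on {a<..<b}) g"
    and vg: "has_weak_deriv {a<..<b} 1 v g" and ab: "a < b"
  obtains G where "continuous_on {a..b} G" "AE x in lebesgue_on {a<..<b}. v x = G x" "primitive_on a b g G"
proof -
  let ?M = "lebesgue_on {a<..<b}"
  define H where "H x = 0 + integral {a..x} g" for x
  have H: "primitive_on a b g H" "continuous_on {a..b} H"
    using primitive_on_exists[OF g ab, of 0] unfolding H_def[abs_def] .
  have Hi: "integrable ?M H" using continuous_on_integrable_lebesgue_on(1)[OF H(2)] .
  have "has_weak_deriv {a<..<b} 1 (\<lambda>x. 1 * v x + (-1) * H x) (\<lambda>x. 1 * g x + (-1) * g x)"
    by (rule has_weak_deriv_lincomb[OF vg has_weak_deriv_primitive[OF g ab H] ab])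
  then have 0: "has_weak_deriv {a<..<b} 1 (\<lambda>x. v x - H x) (\<lambda>x. 0)" by simp
  obtain c where c: "AE x in ?M. v x - H x = c"
  proof (rule du_Bois_Reymond[OF _ ab])
    show "integrable ?M (\<lambda>x. v x - H x)" using v Hi by auto
    fix \<theta> assume "\<theta> \<in> test_functions {a<..<b}"
    then show "(\<integral>x. (v x - H x) * deriv \<theta> x \<partial>?M) = 0"
      using 0 by (simp add: has_weak_deriv_def)
  qed
  have "AE x in ?M. v x = c + integral {a..x} g"
    using c by eventually_elim (simp add: H_def)
  then show ?thesis
    using primitive_on_exists[OF g ab, of c] that by blast
qed

text \<open>The set on which two continuous functions differ is open, and a nonempty open set is not
  a null set.\<close>

lemma continuous_AE_eq_imp_eq_open:
  fixes F G :: "real \<Rightarrow> real"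
  assumes F: "continuous_on {a<..<b} F" and G: "continuous_on {a<..<b} G"
    and eq: "AE x in lebesgue_on {a<..<b}. F x = G x" and y: "y \<in> {a<..<b}"
  shows "F y = G y"
proof (rule ccontr)
  assume ne: "F y \<noteq> G y"
  define U where "U = {z \<in> {a<..<b}. F z - G z \<noteq> 0}"
  have "continuous_on {a<..<b} (\<lambda>z. F z - G z)"
    using F G by (intro continuous_intros)
  then have "open ({a<..<b} \<inter> (\<lambda>z. F z - G z) -` (- {0}))"
    by (intro continuous_open_preimage) auto
  moreover have "U = {a<..<b} \<inter> (\<lambda>z. F z - G z) -` (- {0})" by (auto simp: U_def)
  ultimately have U: "open U" by simp
  have "AE z in lebesgue. z \<in> {a<..<b} \<longrightarrow> F z = G z"
    using eq by (subst (asm) AE_restrict_space_iff) auto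
  then have "AE z in lebesgue. z \<notin> U" by eventually_elim (auto simp: U_def)
  moreover have "U \<in> sets lebesgue" using U by (simp add: borel_open)
  ultimately have "emeasure lebesgue U = 0"
    by (subst (asm) AE_iff_measurable[of U]) auto
  then have "negligible U" using \<open>U \<in> sets lebesgue\<close> by (simp add: negligible_iff_emeasure0)
  moreover have "U \<noteq> {}" using y ne by (auto simp: U_def)
  ultimately show False using open_not_negligible[OF U] by blast
qed

lemma continuous_AE_eq_imp_eq:
  fixes F G :: "real \<Rightarrow> real"
  assumes F: "continuous_on {a..b} F" and G: "continuous_on {a..b} G" and ab: "a < b"
    and eq: "AE x in lebesgue_on {a<..<b}. F x = G x" and x: "x \<in> {a..b}"
  shows "F x = G x"
proof -
  have "F x - G x = 0"
  proof (rule continuous_constant_on_closure[of "{a<..<b}" "\<lambda>z. F z - G z"])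
    show "continuous_on (closure {a<..<b}) (\<lambda>z. F z - G z)"
      using F G ab by (auto intro!: continuous_intros)
    show "F y - G y = 0" if "y \<in> {a<..<b}" for y
    proof -
      have "F y = G y"
        by (rule continuous_AE_eq_imp_eq_open[OF continuous_on_subset[OF F] continuous_on_subset[OF G] eq that]) auto
      then show ?thesis by simp
    qed
  qed (use ab x in auto)
  then show ?thesis by simp
qed

text \<open>The continuous representative of a weak derivative, on the closed interval so that the
  end nodes have values too. By uniqueness of continuous representatives the choice is determined on
  \<open>{a..b}\<close>.\<close>

definition crep :: "real \<Rightarrow> real \<Rightarrow> nat \<Rightarrow> (real \<Rightarrow> real) \<Rightarrow> real \<Rightarrow> real" where
  "crep a b k v = (SOME G. continuous_on {a..b} G \<and>
      (AE x in lebesgue_on {a<..<b}. weak_deriv {a<..<b} k v x = G x))"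

lemma crep_props:
  assumes v: "v \<in> sobolev {a<..<b} m" and k: "k < m" and ab: "a < b"
  shows "continuous_on {a..b} (crep a b k v)"
    "AE x in lebesgue_on {a<..<b}. weak_deriv {a<..<b} k v x = crep a b k v x"
    "primitive_on a b (weak_deriv {a<..<b} (Suc k) v) (crep a b k v)"
proof -
  let ?P = "\<lambda>G. continuous_on {a..b} G \<and> (AE x in lebesgue_on {a<..<b}. weak_deriv {a<..<b} k v x = G x)"
  have d: "has_weak_deriv {a<..<b} 1 (weak_deriv {a<..<b} k v) (weak_deriv {a<..<b} (Suc k) v)"
    using k by (intro has_weak_deriv_Suc[of _ _ k v] has_weak_deriv_weak_deriv(1)[OF v _ ab]) auto
  have i: "integrable (lebesgue_on {a<..<b}) (weak_deriv {a<..<b} k v)"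
    "integrable (lebesgue_on {a<..<b}) (weak_deriv {a<..<b} (Suc k) v)"
    using k by (auto intro!: L2_space_integrable has_weak_deriv_weak_deriv(2)[OF v _ ab])
  obtain G where G: "continuous_on {a..b} G" "AE x in lebesgue_on {a<..<b}. weak_deriv {a<..<b} k v x = G x"
      "primitive_on a b (weak_deriv {a<..<b} (Suc k) v) G"
    using weak_deriv_primitive[OF i d ab] by blast
  then have P: "?P (crep a b k v)" unfolding crep_def by (intro someI[of ?P G]) auto
  then show "continuous_on {a..b} (crep a b k v)"
    "AE x in lebesgue_on {a<..<b}. weak_deriv {a<..<b} k v x = crep a b k v x" by auto
  have "AE x in lebesgue_on {a<..<b}. G x = crep a b k v x"
    using G(2) conjunct2[OF P] by eventually_elim simp
  then have "G x = crep a b k v x" if "x \<in> {a..b}" for x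
    using continuous_AE_eq_imp_eq[OF G(1) conjunct1[OF P] ab _ that] by blast
  then show "primitive_on a b (weak_deriv {a<..<b} (Suc k) v) (crep a b k v)"
    using G(3) unfolding primitive_on_def by auto
qed

lemma crep_eqI:
  assumes v: "v \<in> sobolev {a<..<b} m" and k: "k < m" and ab: "a < b"
    and G: "continuous_on {a..b} G" "AE x in lebesgue_on {a<..<b}. weak_deriv {a<..<b} k v x = G x"
    and x: "x \<in> {a..b}"
  shows "crep a b k v x = G x"
proof (rule continuous_AE_eq_imp_eq[OF crep_props(1)[OF v k ab] G(1) ab _ x])
  show "AE x in lebesgue_on {a<..<b}. crep a b k v x = G x"
    using crep_props(2)[OF v k ab] G(2) by eventually_elim simp
qed

lemma crep_0:
  assumes "v \<in> sobolev {a<..<b} m" "0 < m" "a < b" "continuous_on {a..b} v" "x \<in> {a..b}"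
  shows "crep a b 0 v x = v x"
  using assms by (intro crep_eqI[of v a b m]) (auto simp: weak_deriv_def)

lemma crep_lincomb:
  assumes u: "u \<in> sobolev {a<..<b} m" and v: "v \<in> sobolev {a<..<b} m" and k: "k < m" and ab: "a < b"
    and x: "x \<in> {a..b}"
  shows "crep a b k (\<lambda>x. c * u x + d * v x) x = c * crep a b k u x + d * crep a b k v x"
proof (rule crep_eqI[OF sobolev_lincomb[OF u v ab] k ab _ _ x])
  show "continuous_on {a..b} (\<lambda>x. c * crep a b k u x + d * crep a b k v x)"
    by (intro continuous_intros crep_props(1)[OF u k ab] crep_props(1)[OF v k ab])
  show "AE x in lebesgue_on {a<..<b}. weak_deriv {a<..<b} k (\<lambda>x. c * u x + d * v x) x
      = c * crep a b k u x + d * crep a b k v x"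
    using weak_deriv_lincomb[OF u v less_imp_le[OF k] ab, of c d] crep_props(2)[OF u k ab] crep_props(2)[OF v k ab]
    by eventually_elim simp
qed

text \<open>The integrand may be changed on a null set, so the representative chosen by
  \<open>weak_deriv\<close> can be replaced by the continuous one. With a continuous integrand the
  fundamental theorem yields classical derivatives.\<close>

lemma crep_primitive_crep:
  assumes v: "v \<in> sobolev {a<..<b} m" and k: "Suc k < m" and ab: "a < b"
  shows "primitive_on a b (crep a b (Suc k) v) (crep a b k v)"
  unfolding primitive_on_def
proof (intro allI impI)
  fix x y assume xy: "a \<le> x" "x \<le> y" "y \<le> b"
  let ?M = "lebesgue_on {a<..<b}" and ?w = "weak_deriv {a<..<b} (Suc k) v"
  have w: "integrable ?M ?w"
    using k by (intro L2_space_integrable has_weak_deriv_weak_deriv(2)[OF v _ ab]) auto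
  have c: "integrable ?M (crep a b (Suc k) v)"
    by (rule continuous_on_integrable_lebesgue_on[OF crep_props(1)[OF v k ab]])
  have "(\<integral>z. indicator {x<..<y} z * crep a b (Suc k) v z \<partial>?M) = (\<integral>z. indicator {x<..<y} z * ?w z \<partial>?M)"
  proof (rule integral_cong_AE)
    show "AE z in ?M. indicator {x<..<y} z * crep a b (Suc k) v z = indicator {x<..<y} z * ?w z"
      using crep_props(2)[OF v k ab] by eventually_elim simp
  qed (use w c in \<open>auto intro!: borel_measurable_integrable integrable_times_indicator_interval\<close>)
  moreover have "(?w has_integral (crep a b k v y - crep a b k v x)) {x..y}"
    using k xy by (intro primitive_onD[OF crep_props(3)[OF v _ ab]]) auto
  ultimately show "(crep a b (Suc k) v has_integral (crep a b k v y - crep a b k v x)) {x..y}"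
    using has_integral_lebesgue_on_interval[OF c xy] has_integral_lebesgue_on_interval[OF w xy]
    by (metis has_integral_unique)
qed

lemma primitive_on_deriv:
  assumes G: "primitive_on a b g G" and g: "continuous_on {a..b} g" and x: "x \<in> {a..b}" and ab: "a < b"
  shows "(G has_real_derivative g x) (at x within {a..b})"
proof -
  have "((\<lambda>x. integral {a..x} g) has_real_derivative g x) (at x within {a..b})"
    using g x by (rule integral_has_real_derivative)
  then have "((\<lambda>x. G a + integral {a..x} g) has_real_derivative g x) (at x within {a..b})"
    by (auto intro!: derivative_eq_intros)
  moreover have "G a + integral {a..y} g = G y" if "y \<in> {a..b}" for y
    using primitive_onD[OF G, of a y] that by (simp add: integral_unique)
  ultimately show ?thesis
    using x by (subst has_field_derivative_cong_ev[where g = "\<lambda>x. G a + integral {a..x} g"])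
      (auto simp: eventually_at_filter)
qed

lemma primitive_on_abs_le:
  assumes G: "primitive_on a b g G" and g: "integrable (lebesgue_on {a<..<b}) g"
    and xy: "a \<le> x" "x \<le> y" "y \<le> b"
  shows "\<bar>G y - G x\<bar> \<le> integral {x..y} (\<lambda>z. \<bar>g z\<bar>)"
proof -
  have "g integrable_on {x..y}" "(\<lambda>z. \<bar>g z\<bar>) integrable_on {x..y}"
    using g xy by (auto intro: integrable_lebesgue_on_interval_imp_integrable_on)
  then have "norm (integral {x..y} g) \<le> integral {x..y} (\<lambda>z. \<bar>g z\<bar>)"
    by (intro integral_norm_bound_integral) auto
  then show ?thesis
    using primitive_onD[OF G xy] by (simp add: integral_unique)
qed

lemma integral_subinterval_le:
  fixes g :: "real \<Rightarrow> real"
  assumes g: "integrable (lebesgue_on {a<..<b}) g" "\<And>z. 0 \<le> g z"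
    and "a \<le> p" "p \<le> x" "x \<le> y" "y \<le> q" "q \<le> b"
  shows "integral {x..y} g \<le> integral {p..q} g"
  using assms by (intro integral_subset_le integrable_lebesgue_on_interval_imp_integrable_on[OF g(1)]) auto

lemma integral_Icc_eq_lebesgue_on:
  fixes g :: "real \<Rightarrow> real"
  assumes "integrable (lebesgue_on {a<..<b}) g" "a < b"
  shows "integral {a..b} g = (\<integral>x. g x \<partial>lebesgue_on {a<..<b})"
proof -
  have "integral {a..b} g = (\<integral>z. indicator {a<..<b} z * g z \<partial>lebesgue_on {a<..<b})"
    using has_integral_lebesgue_on_interval[OF assms(1), of a b] assms(2) by (simp add: integral_unique)
  also have "\<dots> = (\<integral>x. g x \<partial>lebesgue_on {a<..<b})"
    by (intro Bochner_Integration.integral_cong) auto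
  finally show ?thesis .
qed

section \<open>The embedding of H^1 into the continuous functions\<close>

definition embed_const :: "real \<Rightarrow> real \<Rightarrow> real" where
  "embed_const a b = sqrt (b - a) / (b - a) + sqrt (b - a)"

lemma embed_const_nonneg: "a < b \<Longrightarrow> 0 \<le> embed_const a b"
  by (simp add: embed_const_def)

text \<open>The value at \<open>x\<close> is at most the value at any \<open>y\<close> plus the
  integral of the modulus of the next derivative. Averaging over \<open>y\<close> and using
  Cauchy-Schwarz on both parts gives the two summands of \<open>embed_const\<close>, the first from
  the average and the second from the oscillation.\<close>

lemma crep_le_sobolev_norm:
  assumes v: "v \<in> sobolev {a<..<b} m" and k: "k < m" and ab: "a < b" and x: "x \<in> {a..b}"
  shows "\<bar>crep a b k v x\<bar> \<le> embed_const a b * sobolev_norm {a<..<b} m v"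
proof -
  let ?M = "lebesgue_on {a<..<b}" and ?G = "crep a b k v"
    and ?w = "weak_deriv {a<..<b} k v" and ?w' = "weak_deriv {a<..<b} (Suc k) v"
  interpret finite_measure ?M by (rule finite_measure_lebesgue_on_interval)
  have w: "?w \<in> L2_space {a<..<b}" and w': "?w' \<in> L2_space {a<..<b}"
    using k by (auto intro: has_weak_deriv_weak_deriv(2)[OF v _ ab])
  have i': "integrable ?M (\<lambda>z. \<bar>?w' z\<bar>)" using L2_space_integrable[OF w'] by auto
  let ?I = "\<integral>z. \<bar>?w' z\<bar> \<partial>?M"
  have osc: "\<bar>?G x - ?G y\<bar> \<le> ?I" if y: "y \<in> {a..b}" for y
  proof -
    have "\<bar>?G q - ?G p\<bar> \<le> ?I" if "a \<le> p" "p \<le> q" "q \<le> b" for p q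
    proof -
      have "\<bar>?G q - ?G p\<bar> \<le> integral {p..q} (\<lambda>z. \<bar>?w' z\<bar>)"
        using primitive_on_abs_le[OF crep_props(3)[OF v k ab] L2_space_integrable[OF w'] that] .
      also have "\<dots> \<le> integral {a..b} (\<lambda>z. \<bar>?w' z\<bar>)"
        using that by (intro integral_subinterval_le[OF i']) auto
      also have "\<dots> = ?I" by (rule integral_Icc_eq_lebesgue_on[OF i' ab])
      finally show ?thesis .
    qed
    from this[of x y] this[of y x] show ?thesis
      using x y by (cases "x \<le> y") (auto simp: abs_minus_commute)
  qed
  have Gi: "integrable ?M ?G" by (rule continuous_on_integrable_lebesgue_on[OF crep_props(1)[OF v k ab]])
  have "(b - a) * \<bar>?G x\<bar> = (\<integral>y. \<bar>?G x\<bar> \<partial>?M)"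
    using ab by (simp add: measure_restrict_space)
  also have "\<dots> \<le> (\<integral>y. \<bar>?G y\<bar> + ?I \<partial>?M)"
  proof (intro integral_mono)
    fix y assume "y \<in> space ?M"
    then show "\<bar>?G x\<bar> \<le> \<bar>?G y\<bar> + ?I" using osc[of y] by auto
  qed (use Gi in auto)
  also have "\<dots> = (\<integral>y. \<bar>?G y\<bar> \<partial>?M) + (b - a) * ?I"
    using Gi ab by (simp add: measure_restrict_space)
  also have "(\<integral>y. \<bar>?G y\<bar> \<partial>?M) = (\<integral>y. \<bar>?w y\<bar> \<partial>?M)"
  proof (rule integral_cong_AE)
    show "AE y in ?M. \<bar>?G y\<bar> = \<bar>?w y\<bar>"
      using crep_props(2)[OF v k ab] by eventually_elim simp
  qed (use Gi w in \<open>auto simp: L2_space_def\<close>)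
  also have "(\<integral>y. \<bar>?w y\<bar> \<partial>?M) + (b - a) * ?I
      \<le> sqrt (b - a) * sobolev_norm {a<..<b} m v + (b - a) * (sqrt (b - a) * sobolev_norm {a<..<b} m v)"
  proof (intro add_mono mult_left_mono)
    show "(\<integral>y. \<bar>?w y\<bar> \<partial>?M) \<le> sqrt (b - a) * sobolev_norm {a<..<b} m v"
      using k ab by (intro order_trans[OF integral_abs_le_L2_norm[OF w ab]] mult_left_mono L2_norm_le_sobolev_norm) auto
    show "?I \<le> sqrt (b - a) * sobolev_norm {a<..<b} m v"
      using k ab by (intro order_trans[OF integral_abs_le_L2_norm[OF w' ab]] mult_left_mono L2_norm_le_sobolev_norm) auto
  qed (use ab in auto)
  also have "\<dots> = (b - a) * (embed_const a b * sobolev_norm {a<..<b} m v)"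
    using ab by (simp add: embed_const_def field_simps)
  finally show ?thesis using ab by simp
qed

text \<open>With \<open>m\<close> the mean of \<open>\<bar>g z\<bar>\<close>, the integral of the
  square of \<open>\<bar>g z\<bar> - m\<close> is nonnegative; multiplied by the length this is the
  claim.\<close>

lemma Cauchy_Schwarz_integral_interval:
  fixes g :: "real \<Rightarrow> real"
  assumes g: "g \<in> L2_space {a<..<b}" and xy: "a \<le> x" "x < y" "y \<le> b"
  shows "(integral {x..y} (\<lambda>z. \<bar>g z\<bar>))\<^sup>2 \<le> (y - x) * integral {x..y} (\<lambda>z. (g z)\<^sup>2)"
proof -
  define I where "I = integral {x..y} (\<lambda>z. \<bar>g z\<bar>)"
  define m where "m = I / (y - x)"
  have i1: "(\<lambda>z. \<bar>g z\<bar>) integrable_on {x..y}"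
    using L2_space_integrable[OF g] xy by (intro integrable_lebesgue_on_interval_imp_integrable_on) auto
  have i2: "(\<lambda>z. (g z)\<^sup>2) integrable_on {x..y}"
    using g xy by (intro integrable_lebesgue_on_interval_imp_integrable_on[of a b]) (auto simp: L2_space_def)
  have h1: "((\<lambda>z. \<bar>g z\<bar>) has_integral I) {x..y}"
    unfolding I_def by (rule integrable_integral[OF i1])
  have h2: "((\<lambda>z. (g z)\<^sup>2) has_integral integral {x..y} (\<lambda>z. (g z)\<^sup>2)) {x..y}"
    by (rule integrable_integral[OF i2])
  have "((\<lambda>z. (g z)\<^sup>2 - 2 * m * \<bar>g z\<bar> + m\<^sup>2) has_integral
      (integral {x..y} (\<lambda>z. (g z)\<^sup>2) - 2 * m * I + (y - x) * m\<^sup>2)) {x..y}"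
    using has_integral_const_real[of "m\<^sup>2" x y] xy
    by (intro has_integral_add has_integral_diff h2 has_integral_mult_right h1) auto
  moreover have "0 \<le> (g z)\<^sup>2 - 2 * m * \<bar>g z\<bar> + m\<^sup>2" for z
    using zero_le_power2[of "\<bar>g z\<bar> - m"] by (simp add: power2_diff algebra_simps)
  ultimately have "0 \<le> integral {x..y} (\<lambda>z. (g z)\<^sup>2) - 2 * m * I + (y - x) * m\<^sup>2"
    by (rule has_integral_nonneg)
  moreover have mI: "(y - x) * m = I" using xy by (simp add: m_def)
  then have "(y - x) * m\<^sup>2 = m * I" by (metis mult.left_commute power2_eq_square mult.assoc)
  ultimately have "0 \<le> (y - x) * (integral {x..y} (\<lambda>z. (g z)\<^sup>2) - m * I)"
    using xy by (intro mult_nonneg_nonneg) (auto simp: mult.commute)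
  also have "\<dots> = (y - x) * integral {x..y} (\<lambda>z. (g z)\<^sup>2) - I\<^sup>2"
    using mI by (simp add: right_diff_distrib power2_eq_square mult.assoc[symmetric])
  finally show ?thesis by (simp add: I_def)
qed

section \<open>Bounded functionals on Sobolev spaces\<close>

text \<open>Measurability, integrals and weak derivatives of functions of time are all defined
  through limits in the Sobolev norm. A bounded linear functional turns these into limits of real
  numbers, and the theory on one interval takes over. \<open>B\<close> bounds the norm of the
  functional.\<close>

locale sobolev_functional =
  fixes a b :: real and m :: nat and lf :: "(real \<Rightarrow> real) \<Rightarrow> real" and B :: real
  assumes ab: "a < b" and B0: "0 \<le> B"
    and lincomb: "\<And>u v c d. u \<in> sobolev {a<..<b} m \<Longrightarrow> v \<in> sobolev {a<..<b} m \<Longrightarrow>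
        lf (\<lambda>x. c * u x + d * v x) = c * lf u + d * lf v"
    and bound: "\<And>v. v \<in> sobolev {a<..<b} m \<Longrightarrow> \<bar>lf v\<bar> \<le> B * sobolev_norm {a<..<b} m v"
begin

lemma zero_in_sobolev: "(\<lambda>x. 0) \<in> sobolev {a<..<b} m"
proof -
  have "(\<lambda>x. 0) \<in> L2_space {a<..<b}" by (simp add: L2_space_def)
  moreover have "has_weak_deriv {a<..<b} k (\<lambda>x. 0) (\<lambda>x. 0)" for k
    by (simp add: has_weak_deriv_def locally_integrable_def set_integrable_def)
  ultimately show ?thesis by (auto simp: sobolev_def)
qed

lemma scale: "u \<in> sobolev {a<..<b} m \<Longrightarrow> lf (\<lambda>x. c * u x) = c * lf u"
  using lincomb[of u u c 0] by simp

lemma diff: "u \<in> sobolev {a<..<b} m \<Longrightarrow> v \<in> sobolev {a<..<b} m \<Longrightarrow> lf (\<lambda>x. u x - v x) = lf u - lf v"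
  using lincomb[of u v 1 "-1"] by simp

lemma sobolev_diff:
  "u \<in> sobolev {a<..<b} m \<Longrightarrow> v \<in> sobolev {a<..<b} m \<Longrightarrow> (\<lambda>x. u x - v x) \<in> sobolev {a<..<b} m"
  using sobolev_lincomb[OF _ _ ab, of u m v 1 "-1"] by simp

lemma diff_bound: "u \<in> sobolev {a<..<b} m \<Longrightarrow> v \<in> sobolev {a<..<b} m \<Longrightarrow>
    \<bar>lf u - lf v\<bar> \<le> B * sobolev_norm {a<..<b} m (\<lambda>x. u x - v x)"
  using bound[OF sobolev_diff, of u v] diff[of u v] by simp

lemma sum_weighted:
  assumes "finite F" "F \<subseteq> sobolev {a<..<b} m"
  shows "(\<lambda>x. \<Sum>y\<in>F. c y * y x) \<in> sobolev {a<..<b} m \<and> lf (\<lambda>x. \<Sum>y\<in>F. c y * y x) = (\<Sum>y\<in>F. c y * lf y)"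
  using assms
proof (induction F)
  case empty
  show ?case using zero_in_sobolev scale[OF zero_in_sobolev, of 0] by simp
next
  case (insert y F)
  then have y: "y \<in> sobolev {a<..<b} m" and F: "(\<lambda>x. \<Sum>y\<in>F. c y * y x) \<in> sobolev {a<..<b} m"
    "lf (\<lambda>x. \<Sum>y\<in>F. c y * y x) = (\<Sum>y\<in>F. c y * lf y)" by auto
  show ?case
    using sobolev_lincomb[OF y F(1) ab, of "c y" 1] lincomb[OF y F(1), of "c y" 1] F(2) insert(1,2)
    by simp
qed

section \<open>Functions of time seen through a functional\<close>

context
  fixes t0 t1 :: real
begin

abbreviation "I \<equiv> {t0<..<t1}"

lemma simple_valued_integral:
  assumes s: "simple_valued I {a<..<b} m s"
  shows "integrable (lebesgue_on I) (\<lambda>t. lf (s t))"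
    "(\<integral>t. lf (s t) \<partial>lebesgue_on I) = lf (\<lambda>x. \<Sum>y\<in>s ` I. measure lebesgue {t \<in> I. s t = y} * y x)"
proof -
  interpret fm: finite_measure "lebesgue_on I" by (rule finite_measure_lebesgue_on_interval)
  have fin: "finite (s ` I)" and sub: "s ` I \<subseteq> sobolev {a<..<b} m"
    and meas: "\<And>y. {t \<in> I. s t = y} \<in> sets lebesgue"
    using s by (auto simp: simple_valued_def)
  have eq: "lf (s t) = (\<Sum>y\<in>s ` I. indicator {t \<in> I. s t = y} t * lf y)" if "t \<in> I" for t
  proof -
    have "(\<Sum>y\<in>s ` I. indicator {t \<in> I. s t = y} t * lf y) = (\<Sum>y\<in>s ` I. if y = s t then lf y else 0)"
      using that by (intro sum.cong) (auto simp: indicator_def)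
    then show ?thesis using that fin by simp
  qed
  have m: "{t \<in> I. s t = y} \<in> sets (lebesgue_on I)" for y
    using meas[of y] by (auto simp: sets_restrict_space_iff)
  have i: "integrable (lebesgue_on I) (\<lambda>t. indicator {t \<in> I. s t = y} t * lf y)" for y
    using m[of y] by (intro integrable_mult_left) (simp add: fm.emeasure_finite less_top[symmetric])
  have "integrable (lebesgue_on I) (\<lambda>t. \<Sum>y\<in>s ` I. indicator {t \<in> I. s t = y} t * lf y)"
    by (intro Bochner_Integration.integrable_sum i)
  then show "integrable (lebesgue_on I) (\<lambda>t. lf (s t))"
    by (subst Bochner_Integration.integrable_cong[OF refl eq]) auto
  have "(\<integral>t. lf (s t) \<partial>lebesgue_on I) = (\<integral>t. (\<Sum>y\<in>s ` I. indicator {t \<in> I. s t = y} t * lf y) \<partial>lebesgue_on I)"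
    by (intro Bochner_Integration.integral_cong) (auto simp: eq)
  also have "\<dots> = (\<Sum>y\<in>s ` I. (\<integral>t. indicator {t \<in> I. s t = y} t * lf y \<partial>lebesgue_on I))"
    by (intro Bochner_Integration.integral_sum i)
  also have "\<dots> = (\<Sum>y\<in>s ` I. measure lebesgue {t \<in> I. s t = y} * lf y)"
  proof (intro sum.cong refl)
    fix y
    have "measure (lebesgue_on I) {t \<in> I. s t = y} = measure lebesgue {t \<in> I. s t = y}"
      by (intro measure_restrict_space) auto
    then show "(\<integral>t. indicator {t \<in> I. s t = y} t * lf y \<partial>lebesgue_on I) = measure lebesgue {t \<in> I. s t = y} * lf y"
      using m[of y] by (simp add: fm.emeasure_finite less_top[symmetric] Int_absorb2 subset_eq Collect_conj_eq)
  qed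
  also have "\<dots> = lf (\<lambda>x. \<Sum>y\<in>s ` I. measure lebesgue {t \<in> I. s t = y} * y x)"
    using sum_weighted[OF fin sub] by simp
  finally show "(\<integral>t. lf (s t) \<partial>lebesgue_on I) = lf (\<lambda>x. \<Sum>y\<in>s ` I. measure lebesgue {t \<in> I. s t = y} * y x)" .
qed

text \<open>The images of the approximating simple functions are measurable and converge almost
  everywhere; completeness of the measure takes care of the exceptional times.\<close>

lemma strongly_measurable_functional:
  assumes v: "AE t in lebesgue_on I. v t \<in> sobolev {a<..<b} m" and "strongly_measurable I {a<..<b} m v"
  shows "(\<lambda>t. lf (v t)) \<in> borel_measurable (lebesgue_on I)"
proof -
  obtain s where s: "\<And>i. simple_valued I {a<..<b} m (s i)"
    and lim: "AE t in lebesgue_on I. (\<lambda>i::nat. sobolev_norm {a<..<b} m (\<lambda>x. s i t x - v t x)) \<longlonglongrightarrow> 0"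
    using assms(2) by (auto simp: strongly_measurable_def)
  have "(\<lambda>t. lim (\<lambda>i. lf (s i t))) \<in> borel_measurable (lebesgue_on I)"
    using simple_valued_integral(1)[OF s] by (intro borel_measurable_lim_metric) auto
  moreover have "AE t in lebesgue_on I. lim (\<lambda>i. lf (s i t)) = lf (v t)"
    using v lim AE_space
  proof eventually_elim
    case (elim t)
    have st: "s i t \<in> sobolev {a<..<b} m" for i
      using s[of i] elim(3) by (auto simp: simple_valued_def)
    have "(\<lambda>i. lf (s i t) - lf (v t)) \<longlonglongrightarrow> 0"
    proof (rule Lim_null_comparison)
      show "\<forall>\<^sub>F i in sequentially. norm (lf (s i t) - lf (v t)) \<le> B * sobolev_norm {a<..<b} m (\<lambda>x. s i t x - v t x)"
        using diff_bound[OF st elim(1)] by simp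
      show "(\<lambda>i. B * sobolev_norm {a<..<b} m (\<lambda>x. s i t x - v t x)) \<longlonglongrightarrow> 0"
        using tendsto_mult_right_zero[OF elim(2)] .
    qed
    then have "(\<lambda>i. lf (s i t)) \<longlonglongrightarrow> lf (v t)" by (rule LIM_zero_cancel)
    then show ?case by (rule limI)
  qed
  ultimately show ?thesis
    by (rule borel_measurable_lebesgue_on_AE) simp
qed

text \<open>The definition has two limits. The first makes the integrals of
  \<open>lf (s i t)\<close> converge to the integral of \<open>lf (v t)\<close>, the second makes
  the same numbers converge to \<open>lf V\<close>.\<close>

lemma has_sobolev_integral_functional:
  assumes "has_sobolev_integral I {a<..<b} m v V"
  shows "integrable (lebesgue_on I) (\<lambda>t. lf (v t))" "(\<integral>t. lf (v t) \<partial>lebesgue_on I) = lf V"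
proof -
  let ?M = "lebesgue_on I"
  let ?N = "\<lambda>s i t. sobolev_norm {a<..<b} m (\<lambda>x. s i t x - v t x)"
  have V: "V \<in> sobolev {a<..<b} m" and v: "AE t in ?M. v t \<in> sobolev {a<..<b} m"
    and sm: "strongly_measurable I {a<..<b} m v"
    using assms by (auto simp: has_sobolev_integral_def)
  obtain s where s: "\<And>i::nat. simple_valued I {a<..<b} m (s i)"
    and si: "\<And>i. integrable ?M (?N s i)" and s0: "(\<lambda>i. \<integral>t. ?N s i t \<partial>?M) \<longlonglongrightarrow> 0"
    and sV: "(\<lambda>i. sobolev_norm {a<..<b} m
                 (\<lambda>x. (\<Sum>y\<in>s i ` I. measure lebesgue {t\<in>I. s i t = y} * y x) - V x)) \<longlonglongrightarrow> 0"
    using assms unfolding has_sobolev_integral_def by blast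
  have f: "(\<lambda>t. lf (v t)) \<in> borel_measurable ?M"
    by (rule strongly_measurable_functional[OF v sm])
  have fi: "integrable ?M (\<lambda>t. lf (s i t))" for i by (rule simple_valued_integral(1)[OF s])
  have d: "AE t in ?M. \<bar>lf (s i t) - lf (v t)\<bar> \<le> B * ?N s i t" for i
    using v AE_space
  proof eventually_elim
    case (elim t)
    then have "s i t \<in> sobolev {a<..<b} m" using s[of i] by (auto simp: simple_valued_def)
    with elim show ?case by (intro diff_bound) auto
  qed
  have di: "integrable ?M (\<lambda>t. lf (s i t) - lf (v t))" for i
  proof (rule Bochner_Integration.integrable_bound)
    show "integrable ?M (\<lambda>t. B * ?N s i t)" using si by simp
    show "AE t in ?M. norm (lf (s i t) - lf (v t)) \<le> norm (B * ?N s i t)"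
      using d[of i] by eventually_elim auto
  qed (use f fi in \<open>auto intro!: borel_measurable_diff borel_measurable_integrable\<close>)
  have "integrable ?M (\<lambda>t. lf (s 0 t) - (lf (s 0 t) - lf (v t)))"
    by (intro Bochner_Integration.integrable_diff fi di)
  then show int: "integrable ?M (\<lambda>t. lf (v t))" by simp
  have "(\<lambda>i. (\<integral>t. lf (s i t) \<partial>?M) - (\<integral>t. lf (v t) \<partial>?M)) \<longlonglongrightarrow> 0"
  proof (rule Lim_null_comparison)
    show "\<forall>\<^sub>F i in sequentially. norm ((\<integral>t. lf (s i t) \<partial>?M) - (\<integral>t. lf (v t) \<partial>?M)) \<le> B * (\<integral>t. ?N s i t \<partial>?M)"
    proof (intro always_eventually allI)
      fix i
      have "norm ((\<integral>t. lf (s i t) \<partial>?M) - (\<integral>t. lf (v t) \<partial>?M)) = norm (\<integral>t. lf (s i t) - lf (v t) \<partial>?M)"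
        using fi int by simp
      also have "\<dots> \<le> (\<integral>t. norm (lf (s i t) - lf (v t)) \<partial>?M)" by (rule integral_norm_bound)
      also have "\<dots> \<le> (\<integral>t. B * ?N s i t \<partial>?M)"
      proof (rule integral_mono_AE)
        show "AE t in ?M. norm (lf (s i t) - lf (v t)) \<le> B * ?N s i t" using d[of i] by simp
      qed (use di si in auto)
      also have "\<dots> = B * (\<integral>t. ?N s i t \<partial>?M)" by simp
      finally show "norm ((\<integral>t. lf (s i t) \<partial>?M) - (\<integral>t. lf (v t) \<partial>?M)) \<le> B * (\<integral>t. ?N s i t \<partial>?M)" .
    qed
    show "(\<lambda>i. B * (\<integral>t. ?N s i t \<partial>?M)) \<longlonglongrightarrow> 0" using tendsto_mult_right_zero[OF s0] .
  qed
  then have 1: "(\<lambda>i. \<integral>t. lf (s i t) \<partial>?M) \<longlonglongrightarrow> (\<integral>t. lf (v t) \<partial>?M)" by (rule LIM_zero_cancel)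
  let ?S = "\<lambda>i x. \<Sum>y\<in>s i ` I. measure lebesgue {t\<in>I. s i t = y} * y x"
  have S: "?S i \<in> sobolev {a<..<b} m" for i
    using s[of i] sum_weighted by (auto simp: simple_valued_def)
  have "(\<lambda>i. lf (?S i) - lf V) \<longlonglongrightarrow> 0"
  proof (rule Lim_null_comparison)
    show "\<forall>\<^sub>F i in sequentially. norm (lf (?S i) - lf V) \<le> B * sobolev_norm {a<..<b} m (\<lambda>x. ?S i x - V x)"
      using diff_bound[OF S V] by simp
    show "(\<lambda>i. B * sobolev_norm {a<..<b} m (\<lambda>x. ?S i x - V x)) \<longlonglongrightarrow> 0"
      using tendsto_mult_right_zero[OF sV] .
  qed
  then have "(\<lambda>i. lf (?S i)) \<longlonglongrightarrow> lf V" by (rule LIM_zero_cancel)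
  with 1 show "(\<integral>t. lf (v t) \<partial>?M) = lf V"
    unfolding simple_valued_integral(2)[OF s] by (rule LIMSEQ_unique)
qed

lemma L2_sobolev_functional:
  assumes v: "v \<in> L2_sobolev I {a<..<b} m"
  shows "(\<lambda>t. lf (v t)) \<in> L2_space I" "(L2_norm I (\<lambda>t. lf (v t))) \<le> B * L2_sobolev_norm I {a<..<b} m v"
proof -
  let ?M = "lebesgue_on I"
  have f: "(\<lambda>t. lf (v t)) \<in> borel_measurable ?M"
    using v by (intro strongly_measurable_functional) (auto simp: L2_sobolev_def)
  have i: "integrable ?M (\<lambda>t. B\<^sup>2 * (sobolev_norm {a<..<b} m (v t))\<^sup>2)"
    using v by (auto simp: L2_sobolev_def)
  have "AE t in ?M. v t \<in> sobolev {a<..<b} m"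
    using v by (auto simp: L2_sobolev_def)
  then have le: "AE t in ?M. (lf (v t))\<^sup>2 \<le> B\<^sup>2 * (sobolev_norm {a<..<b} m (v t))\<^sup>2"
  proof eventually_elim
    case (elim t)
    then show ?case using power_mono[OF bound abs_ge_zero, of "v t" 2] by (simp add: power_mult_distrib)
  qed
  have sq: "integrable ?M (\<lambda>t. (lf (v t))\<^sup>2)"
  proof (rule Bochner_Integration.integrable_bound[OF i])
    show "AE t in ?M. norm ((lf (v t))\<^sup>2) \<le> norm (B\<^sup>2 * (sobolev_norm {a<..<b} m (v t))\<^sup>2)"
      using le by eventually_elim simp
  qed (use f in auto)
  then show "(\<lambda>t. lf (v t)) \<in> L2_space I" using f by (simp add: L2_space_def)
  have "(L2_norm I (\<lambda>t. lf (v t)))\<^sup>2 = (\<integral>t. (lf (v t))\<^sup>2 \<partial>?M)" by (rule L2_norm_power2)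
  also have "\<dots> \<le> (\<integral>t. B\<^sup>2 * (sobolev_norm {a<..<b} m (v t))\<^sup>2 \<partial>?M)"
    by (rule integral_mono_AE[OF sq i le])
  also have "\<dots> = (B * L2_sobolev_norm I {a<..<b} m v)\<^sup>2"
    by (simp add: L2_sobolev_norm_def power_mult_distrib)
  finally show "L2_norm I (\<lambda>t. lf (v t)) \<le> B * L2_sobolev_norm I {a<..<b} m v"
    by (rule power2_le_imp_le) (use B0 in \<open>simp add: L2_sobolev_norm_def\<close>)
qed

text \<open>The two vector-valued integrals in the definition have the common value
  \<open>V\<close>, so the two scalar integrals agree because both equal
  \<open>lf V\<close>.\<close>

lemma has_weak_time_deriv_functional:
  assumes w: "has_weak_time_deriv I {a<..<b} m 1 v w" 
  shows "has_weak_deriv I 1 (\<lambda>t. lf (v t)) (\<lambda>t. lf (w t))"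
proof -
  let ?M = "lebesgue_on I"
  have vw: "v \<in> L2_sobolev I {a<..<b} m" "w \<in> L2_sobolev I {a<..<b} m"
    using w by (auto simp: has_weak_time_deriv_def)
  then have ae: "AE t in ?M. v t \<in> sobolev {a<..<b} m" "AE t in ?M. w t \<in> sobolev {a<..<b} m"
    by (auto simp: L2_sobolev_def)
  have m: "(\<lambda>t. lf (v t)) \<in> borel_measurable ?M" "(\<lambda>t. lf (w t)) \<in> borel_measurable ?M"
    using L2_sobolev_functional(1)[OF vw(1)] L2_sobolev_functional(1)[OF vw(2)] by (auto simp: L2_space_def)
  have "(\<integral>t. lf (v t) * deriv \<theta> t \<partial>?M) = - (\<integral>t. lf (w t) * \<theta> t \<partial>?M)" if \<theta>: "\<theta> \<in> test_functions I" for \<theta>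
  proof -
    obtain V where V: "has_sobolev_integral I {a<..<b} m (\<lambda>t x. deriv \<theta> t * v t x) V"
      "has_sobolev_integral I {a<..<b} m (\<lambda>t x. - \<theta> t * w t x) V"
      using w \<theta> unfolding has_weak_time_deriv_def by auto
    have th: "\<theta> \<in> borel_measurable ?M" "deriv \<theta> \<in> borel_measurable ?M"
      using test_functions_continuous[OF \<theta>] test_functions_continuous[OF test_functions_deriv[OF \<theta>]]
      by (auto intro!: borel_measurable_lebesgue_on borel_measurable_continuous_onI)
    have "(\<integral>t. lf (v t) * deriv \<theta> t \<partial>?M) = (\<integral>t. lf (\<lambda>x. deriv \<theta> t * v t x) \<partial>?M)"
    proof (rule integral_cong_AE)
      show "AE t in ?M. lf (v t) * deriv \<theta> t = lf (\<lambda>x. deriv \<theta> t * v t x)"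
        using ae(1) by eventually_elim (simp add: scale)
    qed (use has_sobolev_integral_functional(1)[OF V(1)] m th in auto)
    also have "\<dots> = lf V" by (rule has_sobolev_integral_functional(2)[OF V(1)])
    also have "\<dots> = (\<integral>t. lf (\<lambda>x. - \<theta> t * w t x) \<partial>?M)"
      by (rule has_sobolev_integral_functional(2)[OF V(2), symmetric])
    also have "\<dots> = (\<integral>t. - (lf (w t) * \<theta> t) \<partial>?M)"
    proof (rule integral_cong_AE)
      show "AE t in ?M. lf (\<lambda>x. - \<theta> t * w t x) = - (lf (w t) * \<theta> t)"
        using ae(2)
      proof eventually_elim
        case (elim t)
        then show ?case using scale[of "w t" "- \<theta> t"] by simp
      qed
    qed (use has_sobolev_integral_functional(1)[OF V(2)] m th in auto)
    finally show ?thesis by simp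
  qed
  moreover have "locally_integrable I (\<lambda>t. lf (v t))" "locally_integrable I (\<lambda>t. lf (w t))"
    using L2_sobolev_functional(1) vw by (auto intro: L2_space_locally_integrable)
  ultimately show ?thesis by (simp add: has_weak_deriv_def)
qed

text \<open>The scalar image lies in H^1 of the time interval and, by \<open>cont\<close>, is
  continuous. So it is its own continuous representative, and the embedding bounds it at every time
  rather than at almost every time.\<close>

lemma functional_le_H_sobolev_norm:
  assumes v: "v \<in> H_sobolev 1 I {a<..<b} m" and vt: "\<And>t. t \<in> I \<Longrightarrow> v t \<in> sobolev {a<..<b} m"
    and cont: "\<And>t. t \<in> I \<Longrightarrow> ((\<lambda>s. sobolev_norm {a<..<b} m (\<lambda>x. v s x - v t x)) \<longlongrightarrow> 0) (at t within I)"
    and t: "t \<in> I"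
  shows "\<bar>lf (v t)\<bar> \<le> embed_const t0 t1 * (B * H_sobolev_norm 1 I {a<..<b} m v)"
proof -
  have t01: "t0 < t1" using t by auto
  let ?w = "weak_time_deriv I {a<..<b} m 1 v"
  let ?f = "\<lambda>t. lf (v t)" and ?g = "\<lambda>t. lf (?w t)"
  obtain w where w: "has_weak_time_deriv I {a<..<b} m 1 v w"
    using v by (auto simp: H_sobolev_def)
  then have w: "has_weak_time_deriv I {a<..<b} m 1 v ?w"
    unfolding weak_time_deriv_def using someI[of "has_weak_time_deriv I {a<..<b} m 1 v" w] by simp
  then have L2: "v \<in> L2_sobolev I {a<..<b} m" "?w \<in> L2_sobolev I {a<..<b} m"
    by (auto simp: has_weak_time_deriv_def)
  have d: "has_weak_deriv I 1 ?f ?g" by (rule has_weak_time_deriv_functional[OF w])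
  have f: "?f \<in> sobolev I 1"
    using L2_sobolev_functional(1)[OF L2(1)] L2_sobolev_functional(1)[OF L2(2)] d
    by (auto simp: sobolev_def)
  have fc: "continuous_on I ?f"
    unfolding continuous_on_def
  proof
    fix t assume t: "t \<in> I"
    have "((\<lambda>s. lf (v s) - lf (v t)) \<longlongrightarrow> 0) (at t within I)"
    proof (rule Lim_null_comparison)
      show "\<forall>\<^sub>F s in at t within I. norm (lf (v s) - lf (v t)) \<le> B * sobolev_norm {a<..<b} m (\<lambda>x. v s x - v t x)"
        unfolding eventually_at_filter
        by (intro always_eventually allI impI) (use diff_bound[OF vt vt[OF t]] in auto)
      show "((\<lambda>s. B * sobolev_norm {a<..<b} m (\<lambda>x. v s x - v t x)) \<longlongrightarrow> 0) (at t within I)"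
        using tendsto_mult_right_zero[OF cont[OF t]] .
    qed
    then show "(?f \<longlongrightarrow> ?f t) (at t within I)" by (rule LIM_zero_cancel)
  qed
  have "?f t = crep t0 t1 0 ?f t"
  proof (rule continuous_AE_eq_imp_eq_open[OF fc _ _ t])
    show "continuous_on I (crep t0 t1 0 ?f)"
      using crep_props(1)[OF f _ t01] by (auto intro: continuous_on_subset)
    show "AE t in lebesgue_on I. ?f t = crep t0 t1 0 ?f t"
      using crep_props(2)[OF f _ t01, of 0] by (simp add: weak_deriv_def)
  qed
  then have "\<bar>?f t\<bar> \<le> embed_const t0 t1 * sobolev_norm I 1 ?f"
    using crep_le_sobolev_norm[OF f _ t01, of 0 t] t by auto
  also have "\<dots> \<le> embed_const t0 t1 * (B * H_sobolev_norm 1 I {a<..<b} m v)"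
  proof (rule mult_left_mono[OF _ embed_const_nonneg[OF t01]])
    have "L2_norm I (weak_deriv I 1 ?f) = L2_norm I ?g"
      using L2_sobolev_functional(1)[OF L2(2)] weak_deriv_eq_AE[OF d _ t01]
      by (intro L2_norm_cong_AE[symmetric]) (auto simp: L2_space_def elim: eventually_mono)
    then have "(sobolev_norm I 1 ?f)\<^sup>2 = (L2_norm I ?f)\<^sup>2 + (L2_norm I ?g)\<^sup>2"
      by (simp add: sobolev_norm_def weak_deriv_def[of _ 0])
    also have "\<dots> \<le> (B * L2_sobolev_norm I {a<..<b} m v)\<^sup>2 + (B * L2_sobolev_norm I {a<..<b} m ?w)\<^sup>2"
      by (intro add_mono power_mono L2_sobolev_functional(2) L2 L2_norm_nonneg)
    also have "\<dots> = (B * H_sobolev_norm 1 I {a<..<b} m v)\<^sup>2"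
      by (simp add: H_sobolev_norm_def power_mult_distrib weak_time_deriv_def[of _ _ _ 0] distrib_left)
    finally show "sobolev_norm I 1 ?f \<le> B * H_sobolev_norm 1 I {a<..<b} m v"
      by (rule power2_le_imp_le) (use B0 in \<open>simp add: H_sobolev_norm_def\<close>)
  qed
  finally show ?thesis .
qed

end

end

lemma sobolev_functional_pairing:
  assumes q: "q \<in> L2_space {a<..<b}" and k: "k \<le> m" and ab: "a < b"
  shows "sobolev_functional a b m (\<lambda>v. L2_inner {a<..<b} (weak_deriv {a<..<b} k v) q) (L2_norm {a<..<b} q)"
proof
  fix u v c d assume u: "u \<in> sobolev {a<..<b} m" and v: "v \<in> sobolev {a<..<b} m"
  let ?M = "lebesgue_on {a<..<b}" and ?D = "weak_deriv {a<..<b} k"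
  have uv: "?D u \<in> L2_space {a<..<b}" "?D v \<in> L2_space {a<..<b}"
    using has_weak_deriv_weak_deriv(2)[OF _ k ab] u v by auto
  have c: "?D (\<lambda>x. c * u x + d * v x) \<in> L2_space {a<..<b}"
    using has_weak_deriv_weak_deriv(2)[OF sobolev_lincomb[OF u v ab] k ab] .
  have "L2_inner {a<..<b} (?D (\<lambda>x. c * u x + d * v x)) q = (\<integral>x. c * (?D u x * q x) + d * (?D v x * q x) \<partial>?M)"
    unfolding L2_inner_def
  proof (rule integral_cong_AE)
    show "AE x in ?M. ?D (\<lambda>x. c * u x + d * v x) x * q x = c * (?D u x * q x) + d * (?D v x * q x)"
      using weak_deriv_lincomb[OF u v k ab, of c d] by eventually_elim (simp add: distrib_right)
  qed (use uv c q in \<open>auto simp: L2_space_def\<close>)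
  also have "\<dots> = c * L2_inner {a<..<b} (?D u) q + d * L2_inner {a<..<b} (?D v) q"
    using L2_space_mult_integrable[OF uv(1) q] L2_space_mult_integrable[OF uv(2) q]
    by (simp add: L2_inner_def)
  finally show "L2_inner {a<..<b} (?D (\<lambda>x. c * u x + d * v x)) q
      = c * L2_inner {a<..<b} (?D u) q + d * L2_inner {a<..<b} (?D v) q" .
next
  fix v assume v: "v \<in> sobolev {a<..<b} m"
  have "\<bar>L2_inner {a<..<b} (weak_deriv {a<..<b} k v) q\<bar> \<le> L2_norm {a<..<b} (weak_deriv {a<..<b} k v) * L2_norm {a<..<b} q"
    by (rule Cauchy_Schwarz_L2[OF has_weak_deriv_weak_deriv(2)[OF v k ab] q])
  also have "\<dots> \<le> sobolev_norm {a<..<b} m v * L2_norm {a<..<b} q"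
    by (intro mult_right_mono L2_norm_le_sobolev_norm k L2_norm_nonneg)
  finally show "\<bar>L2_inner {a<..<b} (weak_deriv {a<..<b} k v) q\<bar> \<le> L2_norm {a<..<b} q * sobolev_norm {a<..<b} m v"
    by (simp add: mult.commute)
qed (use ab L2_norm_nonneg in auto)

text \<open>Testing with the \<open>k\<close>-th derivative at time \<open>t\<close> itself reduces the embedding in time to the
  scalar case.\<close>

lemma L2_norm_le_H_sobolev_norm:
  assumes v: "v \<in> H_sobolev 1 {t0<..<t1} {a<..<b} m" and vt: "\<And>t. t \<in> {t0<..<t1} \<Longrightarrow> v t \<in> sobolev {a<..<b} m"
    and cont: "\<And>t. t \<in> {t0<..<t1} \<Longrightarrow>
      ((\<lambda>s. sobolev_norm {a<..<b} m (\<lambda>x. v s x - v t x)) \<longlongrightarrow> 0) (at t within {t0<..<t1})"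
    and t: "t \<in> {t0<..<t1}" and k: "k \<le> m" and ab: "a < b"
  shows "L2_norm {a<..<b} (weak_deriv {a<..<b} k (v t)) \<le> embed_const t0 t1 * H_sobolev_norm 1 {t0<..<t1} {a<..<b} m v"
proof -
  let ?q = "weak_deriv {a<..<b} k (v t)" and ?H = "H_sobolev_norm 1 {t0<..<t1} {a<..<b} m v"
  have q: "?q \<in> L2_space {a<..<b}" by (rule has_weak_deriv_weak_deriv(2)[OF vt[OF t] k ab])
  interpret sobolev_functional a b m "\<lambda>v. L2_inner {a<..<b} (weak_deriv {a<..<b} k v) ?q" "L2_norm {a<..<b} ?q"
    by (rule sobolev_functional_pairing[OF q k ab])
  have "L2_inner {a<..<b} ?q ?q = (L2_norm {a<..<b} ?q)\<^sup>2"
    by (simp add: L2_norm_def L2_inner_def)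
  moreover have "\<bar>L2_inner {a<..<b} ?q ?q\<bar> \<le> embed_const t0 t1 * (L2_norm {a<..<b} ?q * ?H)"
    by (rule functional_le_H_sobolev_norm[OF v vt cont t])
  \<comment> \<open>The norm of \<open>?q\<close> occurs twice on the left, from the pairing of
    \<open>?q\<close> with itself, and once on the right, as the bound of the functional; cancelling
    one factor leaves the claim.\<close>
  ultimately have "L2_norm {a<..<b} ?q * L2_norm {a<..<b} ?q \<le> L2_norm {a<..<b} ?q * (embed_const t0 t1 * ?H)"
    by (simp add: power2_eq_square mult_ac)
  moreover have "0 \<le> embed_const t0 t1 * ?H"
    using t by (intro mult_nonneg_nonneg embed_const_nonneg) (auto simp: H_sobolev_norm_def)
  ultimately show ?thesis
    using L2_norm_nonneg[of "{a<..<b}" ?q] by (cases "L2_norm {a<..<b} ?q = 0") (auto simp: mult_le_cancel_left)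
qed

section \<open>Pointwise regularity of functions in \<open>Z\<^sup>3\<close>\<close>

text \<open>Continuity in \<open>x\<close> at each time becomes joint continuity as soon as the
  change in time is small uniformly in \<open>x\<close>. The spatial embedding supplies exactly
  this, with \<open>N\<close> a multiple of a Sobolev norm of the increment.\<close>

lemma continuous_on_Times_if_uniform:
  fixes F :: "real \<Rightarrow> real \<Rightarrow> real"
  assumes F: "\<And>t. t \<in> I \<Longrightarrow> continuous_on A (F t)"
    and N: "\<And>t. t \<in> I \<Longrightarrow> (N t \<longlongrightarrow> 0) (at t within I)"
    and le: "\<And>s t x. s \<in> I \<Longrightarrow> t \<in> I \<Longrightarrow> x \<in> A \<Longrightarrow> \<bar>F s x - F t x\<bar> \<le> N t s"
  shows "continuous_on (I \<times> A) (\<lambda>(t, x). F t x)"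
  unfolding continuous_on_iff
proof (intro ballI allI impI)
  fix z0 and e :: real assume z0: "z0 \<in> I \<times> A" and e: "0 < e"
  obtain t x where tx: "t \<in> I" "x \<in> A" and z0: "z0 = (t, x)" using z0 by blast
  obtain d1 where d1: "d1 > 0" "\<And>y. y \<in> A \<Longrightarrow> dist y x < d1 \<Longrightarrow> dist (F t y) (F t x) < e / 2"
    using F[OF tx(1)] tx(2) e unfolding continuous_on_iff by (metis half_gt_zero)
  have "\<forall>\<^sub>F s in at t within I. N t s < e / 2"
    using N[OF tx(1)] e by (intro order_tendstoD(2)) auto
  then obtain d2 where d2: "d2 > 0" "\<And>s. s \<in> I \<Longrightarrow> s \<noteq> t \<Longrightarrow> dist s t < d2 \<Longrightarrow> N t s < e / 2"
    unfolding eventually_at by blast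
  show "\<exists>d>0. \<forall>x'\<in>I \<times> A. dist x' z0 < d \<longrightarrow>
      dist (case x' of (t, x) \<Rightarrow> F t x) (case z0 of (t, x) \<Rightarrow> F t x) < e"
  proof (intro exI[of _ "min d1 d2"] conjI ballI impI)
    show "0 < min d1 d2" using d1(1) d2(1) by simp
    fix z assume z: "z \<in> I \<times> A" "dist z z0 < min d1 d2"
    obtain s y where sy: "z = (s, y)" by (metis surj_pair)
    have s: "s \<in> I" "dist s t < d2" and y: "y \<in> A" "dist y x < d1"
      using z dist_fst_le[of z "(t, x)"] dist_snd_le[of z "(t, x)"] by (auto simp: sy z0)
    have "dist (F s y) (F t y) < e / 2"
      using d2(2)[OF s(1) _ s(2)] le[OF s(1) tx(1) y(1)] e by (cases "s = t") (auto simp: dist_real_def)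
    moreover have "dist (F t y) (F t x) < e / 2" by (rule d1(2)[OF y])
    ultimately have "dist (F s y) (F t x) < e"
      using dist_triangle[of "F s y" "F t x" "F t y"] by linarith
    then show "dist (case z of (t, x) \<Rightarrow> F t x) (case z0 of (t, x) \<Rightarrow> F t x) < e" by (simp add: sy z0)
  qed
qed

lemma continuous_on_compose_Times:
  assumes F: "continuous_on (S \<times> A) (\<lambda>(t, x). F t x)" and "continuous_on U q" "continuous_on U p"
    and "\<And>u. u \<in> U \<Longrightarrow> q u \<in> S" "\<And>u. u \<in> U \<Longrightarrow> p u \<in> A"
  shows "continuous_on U (\<lambda>u. F (q u) (p u))"
proof -
  have "continuous_on U (\<lambda>u. (q u, p u))" using assms(2,3) by (rule continuous_on_Pair)
  then have "continuous_on U (\<lambda>u. case (q u, p u) of (t, x) \<Rightarrow> F t x)"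
    by (rule continuous_on_compose2[OF F]) (use assms(4,5) in auto)
  then show ?thesis by simp
qed

lemma has_integral_abs_le:
  fixes f :: "real \<Rightarrow> real"
  assumes "(f has_integral i) {x..y}" "x \<le> y" "0 \<le> B" "\<And>z. z \<in> {x..y} \<Longrightarrow> \<bar>f z\<bar> \<le> B"
  shows "\<bar>i\<bar> \<le> B * (y - x)"
  using has_integral_bound_real[OF assms(3) _ assms(1), of "{}"] assms(2,4) by simp

text \<open>Continuity is assumed on the closed time interval, membership in Z^3 on the open one. At
  times 0 and \<open>T\<close>, which slabs may touch, only the former is available.\<close>

locale regular_function =
  fixes a b T :: real and \<phi> :: "real \<Rightarrow> real \<Rightarrow> real"
  assumes ab: "a < b"
    and cont: "continuous_on ({0..T} \<times> {a..b}) (\<lambda>(t, x). \<phi> t x)"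
    and Z: "\<phi> \<in> Z_space 3 {0<..<T} {a<..<b}"
begin

abbreviation "\<Omega> \<equiv> {a<..<b}"
abbreviation "J \<equiv> {0<..<T}"

lemma sobolev_3: "t \<in> J \<Longrightarrow> \<phi> t \<in> sobolev \<Omega> 3"
  and continuous_sobolev_3: "t \<in> J \<Longrightarrow> ((\<lambda>s. sobolev_norm \<Omega> 3 (\<lambda>x. \<phi> s x - \<phi> t x)) \<longlongrightarrow> 0) (at t within J)"
proof -
  obtain D where D: "C_derivs 0 J \<Omega> 3 \<phi> D"
    using Z unfolding Z_space_def by force
  show *: "t \<in> J \<Longrightarrow> \<phi> t \<in> sobolev \<Omega> 3"
    using D by (auto simp: C_derivs_def)
  assume t: "t \<in> J"
  have "((\<lambda>s. sobolev_norm \<Omega> 3 (\<lambda>x. D 0 s x - D 0 t x)) \<longlongrightarrow> 0) (at t within J)"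
    using D t by (auto simp: C_derivs_def)
  then show "((\<lambda>s. sobolev_norm \<Omega> 3 (\<lambda>x. \<phi> s x - \<phi> t x)) \<longlongrightarrow> 0) (at t within J)"
    by (rule Lim_transform_eventually)
       (use D t in \<open>auto simp: C_derivs_def eventually_at_filter\<close>)
qed

text \<open>The family for \<open>j = 1\<close> in \<open>Z_space\<close>, fixed once:
  \<open>D1 1\<close> is the time derivative with values in H^2, and its norm stays bounded up to
  the ends of the time interval.\<close>

definition D1 :: "nat \<Rightarrow> real \<Rightarrow> real \<Rightarrow> real" where
  "D1 = (SOME D. C_derivs 1 J \<Omega> 2 \<phi> D \<and> (\<forall>i\<le>1. bdd_above ((\<lambda>t. sobolev_norm \<Omega> 2 (D i t)) ` J)))"

lemma D1: "C_derivs 1 J \<Omega> 2 \<phi> D1" "i \<le> 1 \<Longrightarrow> bdd_above ((\<lambda>t. sobolev_norm \<Omega> 2 (D1 i t)) ` J)"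
proof -
  have "\<exists>D. C_derivs 1 J \<Omega> (3 - 1) \<phi> D \<and>
      ((1::nat) \<le> 1 \<longrightarrow> (\<forall>i\<le>1. bdd_above ((\<lambda>t. sobolev_norm \<Omega> (3 - 1) (D i t)) ` J)))"
    by (rule Z[unfolded Z_space_def mem_Collect_eq, rule_format]) simp
  then have "\<exists>D. C_derivs 1 J \<Omega> 2 \<phi> D \<and> (\<forall>i\<le>1. bdd_above ((\<lambda>t. sobolev_norm \<Omega> 2 (D i t)) ` J))"
    by simp
  then have *: "C_derivs 1 J \<Omega> 2 \<phi> D1 \<and> (\<forall>i\<le>1. bdd_above ((\<lambda>t. sobolev_norm \<Omega> 2 (D1 i t)) ` J))"
    unfolding D1_def by (rule someI_ex)
  show "C_derivs 1 J \<Omega> 2 \<phi> D1" using * by blast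
  show "i \<le> 1 \<Longrightarrow> bdd_above ((\<lambda>t. sobolev_norm \<Omega> 2 (D1 i t)) ` J)"
    by (rule conjunct2[OF *, rule_format])
qed

lemma D1_0: "t \<in> J \<Longrightarrow> D1 0 t = \<phi> t"
  and D1_sobolev: "t \<in> J \<Longrightarrow> D1 (Suc 0) t \<in> sobolev \<Omega> 2"
  using D1(1) by (auto simp: C_derivs_def)

definition dt :: "real \<Rightarrow> real \<Rightarrow> real" where "dt t = crep a b 0 (D1 1 t)"
definition dx :: "real \<Rightarrow> real \<Rightarrow> real" where "dx t = crep a b 1 (\<phi> t)"
abbreviation "emb \<equiv> embed_const a b"

lemma continuous_space: "t \<in> {0..T} \<Longrightarrow> continuous_on {a..b} (\<phi> t)"
  by (rule continuous_on_compose_Times[OF cont]) auto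

lemma continuous_path:
  assumes "continuous_on S p" "S \<subseteq> {0..T}" "\<And>t. t \<in> S \<Longrightarrow> p t \<in> {a..b}"
  shows "continuous_on S (\<lambda>t. \<phi> t (p t))"
  by (rule continuous_on_compose_Times[OF cont _ assms(1)]) (use assms in auto)

lemma crep_phi: "t \<in> J \<Longrightarrow> x \<in> {a..b} \<Longrightarrow> crep a b 0 (\<phi> t) x = \<phi> t x"
  by (rule crep_0[OF sobolev_3 _ ab continuous_space]) auto

lemma dt_dx_continuous:
  "continuous_on (J \<times> {a..b}) (\<lambda>(t, x). dt t x)" "continuous_on (J \<times> {a..b}) (\<lambda>(t, x). dx t x)"
proof -
  have d: "\<bar>crep a b k u x - crep a b k v x\<bar> \<le> emb * sobolev_norm \<Omega> m (\<lambda>x. u x - v x)"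
    if "u \<in> sobolev \<Omega> m" "v \<in> sobolev \<Omega> m" "k < m" "x \<in> {a..b}" for u v k m x
    using crep_le_sobolev_norm[OF sobolev_lincomb[OF that(1,2) ab, of 1 "-1"] that(3) ab that(4)]
      crep_lincomb[OF that(1-3) ab that(4), of 1 "-1"] by simp
  show "continuous_on (J \<times> {a..b}) (\<lambda>(t, x). dt t x)"
    unfolding dt_def
  proof (rule continuous_on_Times_if_uniform)
    fix t assume t: "t \<in> J"
    show "continuous_on {a..b} (crep a b 0 (D1 1 t))"
      using D1_sobolev[OF t] by (intro crep_props(1)[of _ _ _ 2] ab) auto
    have "((\<lambda>s. sobolev_norm \<Omega> 2 (\<lambda>x. D1 1 s x - D1 1 t x)) \<longlongrightarrow> 0) (at t within J)"
      using D1(1) t by (auto simp: C_derivs_def)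
    then show "((\<lambda>s. emb * sobolev_norm \<Omega> 2 (\<lambda>x. D1 1 s x - D1 1 t x)) \<longlongrightarrow> 0) (at t within J)"
      by (rule tendsto_mult_right_zero)
    fix s x assume "s \<in> J" "x \<in> {a..b}"
    then show "\<bar>crep a b 0 (D1 1 s) x - crep a b 0 (D1 1 t) x\<bar> \<le> emb * sobolev_norm \<Omega> 2 (\<lambda>x. D1 1 s x - D1 1 t x)"
      using D1_sobolev t by (intro d) auto
  qed
  show "continuous_on (J \<times> {a..b}) (\<lambda>(t, x). dx t x)"
    unfolding dx_def
  proof (rule continuous_on_Times_if_uniform)
    fix t assume t: "t \<in> J"
    show "continuous_on {a..b} (crep a b 1 (\<phi> t))"
      using sobolev_3[OF t] by (intro crep_props(1)[of _ _ _ 3] ab) auto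
    show "((\<lambda>s. emb * sobolev_norm \<Omega> 3 (\<lambda>x. \<phi> s x - \<phi> t x)) \<longlongrightarrow> 0) (at t within J)"
      by (rule tendsto_mult_right_zero[OF continuous_sobolev_3[OF t]])
    fix s x assume "s \<in> J" "x \<in> {a..b}"
    then show "\<bar>crep a b 1 (\<phi> s) x - crep a b 1 (\<phi> t) x\<bar> \<le> emb * sobolev_norm \<Omega> 3 (\<lambda>x. \<phi> s x - \<phi> t x)"
      using sobolev_3 t by (intro d) auto
  qed
qed

lemma dt_dx_continuous_path:
  assumes "continuous_on S p" "S \<subseteq> J" "\<And>t. t \<in> S \<Longrightarrow> p t \<in> {a..b}"
  shows "continuous_on S (\<lambda>t. dt t (p t))" "continuous_on S (\<lambda>t. dx t (p t))"
  by (rule continuous_on_compose_Times[OF dt_dx_continuous(1) _ assms(1)];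
      use assms in auto)
     (rule continuous_on_compose_Times[OF dt_dx_continuous(2) _ assms(1)]; use assms in auto)

text \<open>Continuity of \<open>dt\<close> is known on the open interval \<open>J\<close> only, and
  a slab may touch its ends. Boundedness is what makes the interpolant of \<open>dt\<close>
  integrable over a slab.\<close>

lemma dt_bounded: obtains B where "\<And>t x. t \<in> J \<Longrightarrow> x \<in> {a..b} \<Longrightarrow> \<bar>dt t x\<bar> \<le> B"
proof -
  obtain B where B: "\<And>t. t \<in> J \<Longrightarrow> sobolev_norm \<Omega> 2 (D1 1 t) \<le> B"
  proof -
    have "bdd_above ((\<lambda>t. sobolev_norm \<Omega> 2 (D1 1 t)) ` J)" by (rule D1(2)) simp
    then show ?thesis using that unfolding bdd_above_def by blast
  qed
  have "\<bar>dt t x\<bar> \<le> emb * B" if "t \<in> J" "x \<in> {a..b}" for t x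
  proof -
    have "\<bar>dt t x\<bar> \<le> emb * sobolev_norm \<Omega> 2 (D1 1 t)"
      unfolding dt_def using that D1_sobolev by (intro crep_le_sobolev_norm ab) auto
    also have "\<dots> \<le> emb * B" using B[OF that(1)] embed_const_nonneg[OF ab] by (rule mult_left_mono)
    finally show ?thesis .
  qed
  then show ?thesis by (rule that)
qed

lemma sobolev_norm_2_bounded: obtains B where "\<And>t. t \<in> J \<Longrightarrow> sobolev_norm \<Omega> 2 (\<phi> t) \<le> B"
proof -
  obtain B where "\<And>t. t \<in> J \<Longrightarrow> sobolev_norm \<Omega> 2 (D1 0 t) \<le> B"
  proof -
    have "bdd_above ((\<lambda>t. sobolev_norm \<Omega> 2 (D1 0 t)) ` J)" by (rule D1(2)) simp
    then show ?thesis using that unfolding bdd_above_def by blast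
  qed
  then show ?thesis using that D1_0 by metis
qed

lemma has_deriv_space:
  assumes t: "t \<in> J" and x: "x \<in> \<Omega>"
  shows "(\<phi> t has_real_derivative dx t x) (at x)"
proof -
  have "primitive_on a b (crep a b 1 (\<phi> t)) (crep a b 0 (\<phi> t))"
    using crep_primitive_crep[OF sobolev_3[OF t] _ ab, of 0] by simp
  then have "(crep a b 0 (\<phi> t) has_real_derivative dx t x) (at x within {a..b})"
    unfolding dx_def using x crep_props(1)[OF sobolev_3[OF t] _ ab] by (intro primitive_on_deriv ab) auto
  moreover have "at x within {a..b} = at x"
    using x by (intro at_within_interior) auto
  ultimately have "(crep a b 0 (\<phi> t) has_real_derivative dx t x) (at x)" by simp
  then show ?thesis
    by (rule has_field_derivative_transform_within_open[of _ _ _ \<Omega>]) (use x crep_phi[OF t] in auto)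
qed

text \<open>The embedding makes the convergence of the difference quotient in H^2 uniform in
  \<open>x\<close>. This uniformity is used where the evaluation point moves together with
  \<open>s\<close>.\<close>

lemma difference_quotient_le:
  assumes t: "t \<in> J" and s: "s \<in> J" and x: "x \<in> {a..b}"
  shows "\<bar>(\<phi> s x - \<phi> t x) / (s - t) - dt t x\<bar> \<le>
    emb * sobolev_norm \<Omega> 2 (\<lambda>x. (D1 0 s x - D1 0 t x) / (s - t) - D1 1 t x)"
proof -
  let ?c = "1 / (s - t)"
  have S: "D1 0 s \<in> sobolev \<Omega> 2" "D1 0 t \<in> sobolev \<Omega> 2" "D1 1 t \<in> sobolev \<Omega> 2"
    using D1_0[OF s] D1_0[OF t] sobolev_mono[OF sobolev_3] s t D1_sobolev by auto
  let ?q = "\<lambda>x. ?c * D1 0 s x + (- ?c) * D1 0 t x"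
  have q: "?q \<in> sobolev \<Omega> 2" by (rule sobolev_lincomb[OF S(1,2) ab])
  have "crep a b 0 (\<lambda>x. 1 * ?q x + (-1) * D1 1 t x) x
      = 1 * crep a b 0 ?q x + (-1) * crep a b 0 (D1 1 t) x"
    by (rule crep_lincomb[OF q S(3) _ ab x]) simp
  moreover have "crep a b 0 ?q x = ?c * crep a b 0 (D1 0 s) x + (- ?c) * crep a b 0 (D1 0 t) x"
    by (rule crep_lincomb[OF S(1,2) _ ab x]) simp
  moreover have "(\<lambda>x. 1 * ?q x + (-1) * D1 1 t x) = (\<lambda>x. (D1 0 s x - D1 0 t x) / (s - t) - D1 1 t x)"
    by (auto simp: fun_eq_iff diff_divide_distrib)
  moreover have "\<bar>crep a b 0 (\<lambda>x. 1 * ?q x + (-1) * D1 1 t x) x\<bar> \<le>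
      emb * sobolev_norm \<Omega> 2 (\<lambda>x. 1 * ?q x + (-1) * D1 1 t x)"
    by (rule crep_le_sobolev_norm[OF sobolev_lincomb[OF q S(3) ab] _ ab x]) simp
  ultimately show ?thesis
    using D1_0[OF s] D1_0[OF t] crep_phi[OF s x] crep_phi[OF t x]
    by (simp add: dt_def diff_divide_distrib)
qed

text \<open>A chain rule obtained by splitting the increment at the moved point: at fixed
  \<open>p s\<close> the difference quotient in time converges uniformly, and at fixed time
  \<open>t\<close> the derivative in space applies. End nodes are at rest, which spares a derivative
  in space at the boundary.\<close>

lemma has_deriv_path:
  assumes t: "t \<in> J" and p: "\<And>s. p s = p t + w * (s - t)"
    and pt: "p t \<in> \<Omega> \<or> w = 0 \<and> p t \<in> {a..b}"
  shows "((\<lambda>s. \<phi> s (p s)) has_real_derivative dt t (p t) + w * dx t (p t)) (at t)"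
proof -
  let ?N = "\<lambda>s. emb * sobolev_norm \<Omega> 2 (\<lambda>x. (D1 0 s x - D1 0 t x) / (s - t) - D1 1 t x)"
  have p': "(p has_real_derivative w) (at t)"
    by (subst ext[OF p]) (auto intro!: derivative_eq_intros)
  have J: "\<forall>\<^sub>F s in at t. s \<in> J"
    using t by (intro eventually_at_in_open') auto
  have pc: "(p \<longlongrightarrow> p t) (at t)" using DERIV_isCont[OF p'] by (simp add: isCont_def)
  have in_ab: "\<forall>\<^sub>F s in at t. p s \<in> {a..b}"
    using pt
  proof
    assume "p t \<in> \<Omega>"
    then have "\<forall>\<^sub>F s in at t. p s \<in> \<Omega>" using pc by (intro topological_tendstoD) auto
    then show ?thesis by eventually_elim auto
  next
    assume "w = 0 \<and> p t \<in> {a..b}"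
    then show ?thesis using p by (intro always_eventually allI) (metis mult_zero_left add.right_neutral)
  qed
  have ptab: "p t \<in> {a..b}" using pt by auto
  have "((\<lambda>s. sobolev_norm \<Omega> 2 (\<lambda>x. (D1 0 s x - D1 0 t x) / (s - t) - D1 1 t x)) \<longlongrightarrow> 0) (at t within J)"
    using D1(1) t by (auto simp: C_derivs_def)
  then have "(?N \<longlongrightarrow> 0) (at t within J)" by (rule tendsto_mult_right_zero)
  then have N: "(?N \<longlongrightarrow> 0) (at t)" using t by (subst (asm) at_within_open) auto
  have "((\<lambda>s. (\<phi> s (p s) - \<phi> t (p s)) / (s - t) - dt t (p s)) \<longlongrightarrow> 0) (at t)"
  proof (rule Lim_null_comparison[OF _ N])
    show "\<forall>\<^sub>F s in at t. norm ((\<phi> s (p s) - \<phi> t (p s)) / (s - t) - dt t (p s)) \<le> ?N s"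
      using J in_ab by eventually_elim (simp only: real_norm_def, rule difference_quotient_le[OF t])
  qed
  moreover have "((\<lambda>s. dt t (p s)) \<longlongrightarrow> dt t (p t)) (at t)"
  proof -
    have "continuous_on {a..b} (dt t)"
      by (rule continuous_on_compose_Times[OF dt_dx_continuous(1)]) (use t in auto)
    then have "continuous (at (p t) within {a..b}) (dt t)" using ptab by (simp add: continuous_on_eq_continuous_within)
    then show ?thesis using in_ab pc by (rule continuous_within_tendsto_compose)
  qed
  ultimately have "((\<lambda>s. ((\<phi> s (p s) - \<phi> t (p s)) / (s - t) - dt t (p s)) + dt t (p s)) \<longlongrightarrow> 0 + dt t (p t)) (at t)"
    by (rule tendsto_add)
  then have 1: "((\<lambda>s. (\<phi> s (p s) - \<phi> t (p s)) / (s - t)) \<longlongrightarrow> dt t (p t)) (at t)" by simp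
  have "((\<lambda>s. \<phi> t (p s)) has_real_derivative dx t (p t) * w) (at t)"
    using pt
  proof
    assume "p t \<in> \<Omega>"
    then show ?thesis by (intro DERIV_chain2[OF has_deriv_space[OF t] p'])
  next
    assume w: "w = 0 \<and> p t \<in> {a..b}"
    then have "(\<lambda>s. \<phi> t (p s)) = (\<lambda>s. \<phi> t (p t))" using p by (metis mult_zero_left add.right_neutral)
    then show ?thesis using w by simp
  qed
  then have 2: "((\<lambda>s. (\<phi> t (p s) - \<phi> t (p t)) / (s - t)) \<longlongrightarrow> dx t (p t) * w) (at t)"
    by (simp add: has_field_derivative_iff)
  have "((\<lambda>s. (\<phi> s (p s) - \<phi> t (p t)) / (s - t)) \<longlongrightarrow> dt t (p t) + dx t (p t) * w) (at t)"
    using tendsto_add[OF 1 2] by (simp flip: add_divide_distrib)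
  then show ?thesis by (simp add: has_field_derivative_iff mult.commute)
qed

text \<open>The case of a path at rest, which includes the end points \<open>a\<close> and
  \<open>b\<close>.\<close>

lemma time_deriv_eq: "t \<in> J \<Longrightarrow> x \<in> {a..b} \<Longrightarrow> time_deriv \<phi> t x = dt t x"
  using has_deriv_path[of t "\<lambda>_. x" 0] by (auto simp: time_deriv_def intro: DERIV_imp_deriv)

end

subsection \<open>Secants and tangents\<close>

text \<open>The slope of the secant is the mean of the derivative over the element, so the
  difference is the mean of an oscillation of the derivative, and this is bounded by the integral of
  the modulus of the second derivative.\<close>

lemma tangent_minus_secant_le:
  assumes v: "v \<in> sobolev {a<..<b} m" and m: "2 \<le> m" and ab: "a < b" and xy: "a \<le> x" "x < y" "y \<le> b"
    and z: "z \<in> {x..y}"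
  shows "\<bar>crep a b 1 v z - (crep a b 0 v y - crep a b 0 v x) / (y - x)\<bar>
    \<le> integral {x..y} (\<lambda>s. \<bar>weak_deriv {a<..<b} 2 v s\<bar>)" (is "_ \<le> ?R")
proof -
  let ?V = "crep a b 1 v"
  have w: "integrable (lebesgue_on {a<..<b}) (weak_deriv {a<..<b} 2 v)"
    using m by (intro L2_space_integrable has_weak_deriv_weak_deriv(2)[OF v _ ab])
  have P1: "primitive_on a b (weak_deriv {a<..<b} 2 v) ?V"
    using crep_props(3)[OF v _ ab, of 1] m by (simp add: numeral_2_eq_2)
  have osc: "\<bar>?V z - ?V s\<bar> \<le> ?R" if s: "s \<in> {x..y}" for s
  proof -
    have "\<bar>?V q - ?V p\<bar> \<le> ?R" if "x \<le> p" "p \<le> q" "q \<le> y" for p q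
    proof -
      have "\<bar>?V q - ?V p\<bar> \<le> integral {p..q} (\<lambda>s. \<bar>weak_deriv {a<..<b} 2 v s\<bar>)"
        using that xy by (intro primitive_on_abs_le[OF P1 w]) auto
      also have "\<dots> \<le> ?R"
        using that xy w by (intro integral_subinterval_le[of a b]) auto
      finally show ?thesis .
    qed
    from this[of s z] this[of z s] s z show ?thesis
      by (cases "s \<le> z") (auto simp: abs_minus_commute)
  qed
  have "primitive_on a b ?V (crep a b 0 v)"
    using crep_primitive_crep[OF v _ ab, of 0] m by simp
  then have "(?V has_integral (crep a b 0 v y - crep a b 0 v x)) {x..y}"
    by (rule primitive_onD) (use xy in auto)
  then have "((\<lambda>s. ?V z - ?V s) has_integral ((y - x) * ?V z - (crep a b 0 v y - crep a b 0 v x))) {x..y}"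
    using has_integral_const_real[of "?V z" x y] xy by (intro has_integral_diff) auto
  then have "\<bar>(y - x) * ?V z - (crep a b 0 v y - crep a b 0 v x)\<bar> \<le> ?R * (y - x)"
    by (rule has_integral_abs_le) (use osc osc[OF z] xy in auto)
  then have "\<bar>(y - x) * ?V z - (crep a b 0 v y - crep a b 0 v x)\<bar> / (y - x) \<le> ?R"
    using xy by (simp add: pos_divide_le_eq)
  moreover have "\<bar>(y - x) * ?V z - (crep a b 0 v y - crep a b 0 v x)\<bar> / (y - x)
      = \<bar>?V z - (crep a b 0 v y - crep a b 0 v x) / (y - x)\<bar>"
  proof -
    have "\<bar>(y - x) * ?V z - (crep a b 0 v y - crep a b 0 v x)\<bar> / (y - x)
        = \<bar>((y - x) * ?V z - (crep a b 0 v y - crep a b 0 v x)) / (y - x)\<bar>"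
      using xy by (simp add: abs_divide)
    also have "((y - x) * ?V z - (crep a b 0 v y - crep a b 0 v x)) / (y - x)
        = ?V z - (crep a b 0 v y - crep a b 0 v x) / (y - x)"
      using xy by (subst diff_divide_distrib) simp
    finally show ?thesis .
  qed
  ultimately show ?thesis by simp
qed

text \<open>The trapezoidal rule for the derivative \<open>V1\<close>, scaled by half the length, is
  exact on the Taylor polynomial of degree 1 at \<open>x\<close>. Only the remainder
  \<open>r\<close> contributes: once at \<open>y\<close> and twice through its mean, hence the
  factor 3.\<close>

lemma endpoint_tangents_minus_secant_le:
  assumes v: "v \<in> sobolev {a<..<b} 3" and ab: "a < b" and xy: "a \<le> x" "x < y" "y \<le> b"
  shows "\<bar>crep a b 1 v x + crep a b 1 v y - 2 * ((crep a b 0 v y - crep a b 0 v x) / (y - x))\<bar>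
    \<le> 3 * ((y - x) * integral {x..y} (\<lambda>s. \<bar>weak_deriv {a<..<b} 3 v s\<bar>))" (is "_ \<le> 3 * (_ * ?R)")
proof -
  define V1 V2 L where "V1 = crep a b 1 v" and "V2 = crep a b 2 v" and "L = y - x"
  have L: "L > 0" using xy by (simp add: L_def)
  have w: "integrable (lebesgue_on {a<..<b}) (weak_deriv {a<..<b} 3 v)"
    by (intro L2_space_integrable has_weak_deriv_weak_deriv(2)[OF v _ ab]) simp
  have P2: "primitive_on a b (weak_deriv {a<..<b} 3 v) V2"
    using crep_props(3)[OF v _ ab, of 2] by (simp add: numeral_3_eq_3 numeral_2_eq_2 V2_def)
  have P1: "primitive_on a b V2 V1"
    using crep_primitive_crep[OF v _ ab, of 1] by (simp add: numeral_2_eq_2 V2_def V1_def)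
  have P0: "primitive_on a b V1 (crep a b 0 v)"
    using crep_primitive_crep[OF v _ ab, of 0] by (simp add: V1_def)
  have R0: "0 \<le> ?R"
    using w xy by (intro integral_nonneg integrable_lebesgue_on_interval_imp_integrable_on[of a b]) auto
  have V2: "\<bar>V2 s - V2 x\<bar> \<le> ?R" if "s \<in> {x..y}" for s
  proof -
    have "\<bar>V2 s - V2 x\<bar> \<le> integral {x..s} (\<lambda>s. \<bar>weak_deriv {a<..<b} 3 v s\<bar>)"
      using that xy by (intro primitive_on_abs_le[OF P2 w]) auto
    also have "\<dots> \<le> ?R"
      using that xy w by (intro integral_subinterval_le[of a b]) auto
    finally show ?thesis .
  qed
  define r where "r s = V1 s - V1 x - V2 x * (s - x)" for s
  have r: "\<bar>r s\<bar> \<le> L * ?R" if s: "s \<in> {x..y}" for s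
  proof -
    have "((\<lambda>z. V2 z - V2 x) has_integral (V1 s - V1 x) - (s - x) * V2 x) {x..s}"
      using has_integral_const_real[of "V2 x" x s] s xy
      by (intro has_integral_diff primitive_onD[OF P1]) auto
    then have "\<bar>(V1 s - V1 x) - (s - x) * V2 x\<bar> \<le> ?R * (s - x)"
      by (rule has_integral_abs_le) (use V2 R0 s in auto)
    also have "\<dots> \<le> ?R * L" using s R0 by (intro mult_left_mono) (auto simp: L_def)
    finally show ?thesis by (simp add: r_def algebra_simps)
  qed
  have "(r has_integral (crep a b 0 v y - crep a b 0 v x) - L * V1 x - V2 x * (L\<^sup>2 / 2)) {x..y}"
  proof -
    have id: "((\<lambda>s. s) has_integral (y\<^sup>2 - x\<^sup>2) / 2) {x..y}" using ident_has_integral[of x y] xy by simp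
    have "((\<lambda>s. s - x) has_integral (y\<^sup>2 - x\<^sup>2) / 2 - L * x) {x..y}"
      using has_integral_diff[OF id has_integral_const_real[of x x y]] xy by (simp add: L_def)
    moreover have "(y\<^sup>2 - x\<^sup>2) / 2 - L * x = L\<^sup>2 / 2"
      by (simp add: L_def power2_eq_square field_simps)
    ultimately have "((\<lambda>s. V2 x * (s - x)) has_integral V2 x * (L\<^sup>2 / 2)) {x..y}"
      by (intro has_integral_mult_right) simp
    moreover have "((\<lambda>s. V1 s - V1 x) has_integral (crep a b 0 v y - crep a b 0 v x) - L * V1 x) {x..y}"
      using has_integral_const_real[of "V1 x" x y] xy by (intro has_integral_diff primitive_onD[OF P0]) (auto simp: L_def)
    ultimately show ?thesis unfolding r_def by (rule has_integral_diff[rotated])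
  qed
  then have I: "\<bar>(crep a b 0 v y - crep a b 0 v x) - L * V1 x - V2 x * (L\<^sup>2 / 2)\<bar> \<le> (L * ?R) * L"
    unfolding L_def by (rule has_integral_abs_le) (use r R0 L xy in \<open>auto simp: L_def\<close>)
  let ?d = "(crep a b 0 v y - crep a b 0 v x) / L" and ?i = "(crep a b 0 v y - crep a b 0 v x) - L * V1 x - V2 x * (L\<^sup>2 / 2)"
  have "V1 x + V1 y - 2 * ?d = r y - 2 * (?i / L)"
    using L by (simp add: r_def L_def[symmetric] field_simps power2_eq_square)
  moreover have "\<bar>?i / L\<bar> \<le> L * ?R"
    using I L by (simp add: pos_divide_le_eq)
  moreover have "\<bar>r y\<bar> \<le> L * ?R" using xy by (intro r) auto
  ultimately show ?thesis unfolding V1_def[symmetric] L_def[symmetric] by linarith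
qed

section \<open>Interpolation on a moving mesh\<close>

declare One_nat_def [simp del]

text \<open>This form has no case distinction on the position of \<open>x\<close> among the nodes,
  so continuity follows at once, in \<open>x\<close> and also in time when the nodes move past
  \<open>x\<close>. At the two end nodes the missing flank is replaced by the constant 1.\<close>

lemma hat_eq_max_min:
  assumes p: "\<And>i. i \<in> {1..<N} \<Longrightarrow> p i < p (i + 1)" and i: "i \<in> {1..N}" and N: "2 \<le> N" and x: "x \<in> {p 1..p N}"
  shows "hat N p i x = max 0 (min (if 1 < i then (x - p (i - 1)) / (p i - p (i - 1)) else 1)
      (if i < N then (p (i + 1) - x) / (p (i + 1) - p i) else 1))"
proof -
  have l: "p (i - 1) < p i" if "1 < i"
  proof -
    have "i - 1 \<in> {1..<N}" "i - 1 + 1 = i" using that i by (simp_all, linarith+)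
    with p[of "i - 1"] show ?thesis by metis
  qed
  have r: "i < N \<Longrightarrow> p i < p (i + 1)" using p[of i] i by auto
  have l1: "(x - p (i - 1)) / (p i - p (i - 1)) \<le> 1 \<longleftrightarrow> x \<le> p i" "0 \<le> (x - p (i - 1)) / (p i - p (i - 1)) \<longleftrightarrow> p (i - 1) \<le> x"
    if "1 < i" using l[OF that] by (auto simp: divide_le_eq_1 zero_le_divide_iff)
  have r1: "(p (i + 1) - x) / (p (i + 1) - p i) \<le> 1 \<longleftrightarrow> p i \<le> x" "0 \<le> (p (i + 1) - x) / (p (i + 1) - p i) \<longleftrightarrow> x \<le> p (i + 1)"
    if "i < N" using r[OF that] by (auto simp: divide_le_eq_1 zero_le_divide_iff)
  define A where "A = (if 1 < i then (x - p (i - 1)) / (p i - p (i - 1)) else 1)"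
  define B where "B = (if i < N then (p (i + 1) - x) / (p (i + 1) - p i) else 1)"
  show ?thesis unfolding A_def[symmetric] B_def[symmetric]
  proof (cases "x \<le> p i")
    case xi: True
    have B: "1 \<le> B" using r r1 xi by (cases "i < N") (auto simp: B_def le_divide_eq_1)
    show "hat N p i x = max 0 (min A B)"
    proof (cases "1 < i")
      case True
      have A: "A \<le> 1" "0 \<le> A \<longleftrightarrow> p (i - 1) \<le> x" using l1[OF True] xi True by (simp_all add: A_def)
      have "hat N p i x = (if p (i - 1) \<le> x then A else 0)"
        using True xi l unfolding hat_def A_def by auto
      then show ?thesis using A B by auto
    next
      case False
      then have i1: "i = 1" using i by auto
      then have "x = p i" "i < N" using x xi N by auto
      then show ?thesis using i1 r by (auto simp: hat_def A_def B_def)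
    qed
  next
    case xi: False
    then have iN: "i < N" using x i by (cases "i = N") auto
    have A: "1 \<le> A" using l xi by (auto simp: A_def le_divide_eq_1)
    have B: "B \<le> 1" "0 \<le> B \<longleftrightarrow> x \<le> p (i + 1)" using r1[OF iN] xi iN by (simp_all add: B_def)
    have "hat N p i x = (if x \<le> p (i + 1) then B else 0)"
      using xi iN unfolding hat_def B_def by auto
    then show "hat N p i x = max 0 (min A B)" using A B by auto
  qed
qed

lemma hat_nonneg: "0 \<le> hat N p i x" and hat_le_1: "hat N p i x \<le> 1"
  by (auto simp: hat_def divide_le_eq_1 zero_le_divide_iff)

lemma sum_hat_element:
  assumes p: "\<And>i. i \<in> {1..<N} \<Longrightarrow> p i < p (i + 1)" and N: "2 \<le> N" and j: "j \<in> {1..<N}" and x: "x \<in> {p j..p (j + 1)}"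
  shows "(\<Sum>i = 1..N. c i * hat N p i x) = ((p (j + 1) - x) * c j + (x - p j) * c (j + 1)) / (p (j + 1) - p j)"
proof -
  let ?L = "p (j + 1) - p j"
  have "(\<Sum>i = 1..N. c i * hat N p i x) = (\<Sum>i = 1..N. (if i = j then (p (j + 1) - x) / ?L * c j else 0)
      + (if i = j + 1 then (x - p j) / ?L * c (j + 1) else 0))"
  proof (intro sum.cong refl)
    fix i assume i: "i \<in> {1..N}"
    have "hat N p i (p j) = (if i = j then 1 else 0)" "hat N p i (p (j + 1)) = (if i = j + 1 then 1 else 0)"
      using hat_node[where N = N and p = p, OF p N i, of j] hat_node[where N = N and p = p, OF p N i, of "j + 1"] j by auto
    then show "c i * hat N p i x = (if i = j then (p (j + 1) - x) / ?L * c j else 0)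
      + (if i = j + 1 then (x - p j) / ?L * c (j + 1) else 0)"
      using hat_affine[where N = N and p = p, OF p i j x] by simp
  qed
  also have "\<dots> = (p (j + 1) - x) / ?L * c j + (x - p j) / ?L * c (j + 1)"
    using j by (simp add: sum.distrib)
  finally show ?thesis by (simp add: add_divide_distrib)
qed

lemma interp_element:
  assumes "\<And>i. i \<in> {1..<N} \<Longrightarrow> p i < p (i + 1)" "2 \<le> N" "j \<in> {1..<N}" "x \<in> {p j..p (j + 1)}"
  shows "interp N p v x = ((p (j + 1) - x) * v (p j) + (x - p j) * v (p (j + 1))) / (p (j + 1) - p j)"
  unfolding interp_def by (rule sum_hat_element) (use assms in auto)

lemma ex_element:
  fixes p :: "nat \<Rightarrow> real"
  assumes "1 \<le> N" "p 1 < x" "x < p N" "\<And>i. i \<in> {1..N} \<Longrightarrow> x \<noteq> p i"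
  shows "\<exists>j\<in>{1..<N}. p j < x \<and> x < p (j + 1)"
  using assms
proof (induction N rule: dec_induct)
  case (step N)
  show ?case
  proof (cases "x < p N")
    case True
    then have "\<exists>j\<in>{1..<N}. p j < x \<and> x < p (j + 1)" using step by auto
    then show ?thesis by auto
  next
    case False
    then have "p N < x" using step.prems(3)[of N] step.hyps(1) by auto
    then show ?thesis using step.prems(2) step.hyps(1) by (intro bexI[of _ N]) (auto simp: Suc_eq_plus1)
  qed
qed simp

lemma sum_integral_elements:
  fixes f :: "real \<Rightarrow> real" and p :: "nat \<Rightarrow> real"
  assumes "1 \<le> N" "\<And>i. i \<in> {1..<N} \<Longrightarrow> p i \<le> p (i + 1)" "f integrable_on {p 1..p N}"
  shows "p 1 \<le> p N \<and> (\<Sum>j = 1..<N. integral {p j..p (j + 1)} f) = integral {p 1..p N} f"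
  using assms
proof (induction N rule: dec_induct)
  case (step N)
  have le: "p 1 \<le> p N" "p N \<le> p (Suc N)"
  proof -
    have "p 1 \<le> p N"
      using step.hyps(1) step.prems(1)
    proof (induction N rule: dec_induct)
      case (step n)
      then show ?case using step.prems[of n] by (auto simp: Suc_eq_plus1 intro: order_trans)
    qed simp
    then show "p 1 \<le> p N" "p N \<le> p (Suc N)" using step.prems(1)[of N] step.hyps(1) by (auto simp: Suc_eq_plus1)
  qed
  have "f integrable_on {p 1..p N}"
    by (rule integrable_on_subinterval[OF step.prems(2)]) (use le in auto)
  then have "(\<Sum>j = 1..<N. integral {p j..p (j + 1)} f) = integral {p 1..p N} f"
    using step.IH step.prems(1) by auto
  moreover have "integral {p 1..p N} f + integral {p N..p (Suc N)} f = integral {p 1..p (Suc N)} f"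
    using le step.prems(2) by (intro Henstock_Kurzweil_Integration.integral_combine) auto
  moreover have "(\<Sum>j = 1..<Suc N. integral {p j..p (j + 1)} f)
      = (\<Sum>j = 1..<N. integral {p j..p (j + 1)} f) + integral {p N..p (N + 1)} f"
    using step.hyps(1) by simp
  ultimately show ?case using le by (simp only: Suc_eq_plus1) linarith
qed simp

text \<open>A single slab in isolation, on which nodes move along straight lines. \<open>h\<close>
  and \<open>W\<close> are mere upper bounds: \<open>W\<close> will be the norm in L^infinity of the
  mesh velocity for (i) and its norm in W^{1,infinity} for (ii).\<close>

locale mesh_slab = regular_function +
  fixes N :: nat and q w :: "nat \<Rightarrow> real" and t0 t1 h W :: real
  assumes N: "2 \<le> N" and t01: "0 \<le> t0" "t0 < t1" "t1 \<le> T"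
    and q1: "q 1 = a" and qN: "q N = b" and w1: "w 1 = 0" and wN: "w N = 0"
    and mono: "\<And>t i. t \<in> {t0..t1} \<Longrightarrow> i \<in> {1..<N} \<Longrightarrow> q i + w i * (t - t0) < q (i + 1) + w (i + 1) * (t - t0)"
    and mesh: "\<And>t i. t \<in> {t0..t1} \<Longrightarrow> i \<in> {1..<N} \<Longrightarrow>
      (q (i + 1) + w (i + 1) * (t - t0)) - (q i + w i * (t - t0)) \<le> h"
    and w_le: "\<And>i. i \<in> {1..N} \<Longrightarrow> \<bar>w i\<bar> \<le> W"
begin

definition p :: "real \<Rightarrow> nat \<Rightarrow> real" where "p t i = q i + w i * (t - t0)"

abbreviation "S \<equiv> {t0<..<t1}"

lemma p_mono: "t \<in> {t0..t1} \<Longrightarrow> i \<in> {1..<N} \<Longrightarrow> p t i < p t (i + 1)"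
  using mono by (simp add: p_def)

lemma p_less: "t \<in> {t0..t1} \<Longrightarrow> 1 \<le> i \<Longrightarrow> i < j \<Longrightarrow> j \<le> N \<Longrightarrow> p t i < p t j"
  by (rule nodes_mono[of N "p t"]) (auto intro: p_mono)

lemma p_ends: "p t 1 = a" "p t N = b"
  by (simp_all add: p_def q1 qN w1 wN)

lemma p_in: "t \<in> {t0..t1} \<Longrightarrow> i \<in> {1..N} \<Longrightarrow> p t i \<in> {a..b}"
  using p_less[of t 1 i] p_less[of t i N] p_ends[of t] by (cases "i = 1"; cases "i = N") (auto intro: less_imp_le)

lemma p_in_open: "t \<in> {t0..t1} \<Longrightarrow> i \<in> {1..N} \<Longrightarrow> p t i \<in> \<Omega> \<or> w i = 0 \<and> p t i \<in> {a..b}"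
  using p_less[of t 1 i] p_less[of t i N] p_ends[of t] w1 wN p_in[of t i]
  by (cases "i = 1"; cases "i = N") auto

lemma p_continuous: "continuous_on A (\<lambda>t. p t i)"
  unfolding p_def by (intro continuous_intros)

lemma p_unique:
  assumes t: "t \<in> {t0..t1}" and "j \<in> {1..<N}" "k \<in> {1..<N}" "p t j < x" "x < p t (j + 1)" "p t k < x" "x < p t (k + 1)"
  shows "j = k"
proof (rule ccontr)
  assume "j \<noteq> k"
  then consider "j + 1 \<le> k" | "k + 1 \<le> j" by linarith
  then show False
  proof cases
    case 1
    then have "p t (j + 1) \<le> p t k" using p_less[OF t, of "j + 1" k] assms by (cases "j + 1 = k") auto
    then show False using assms by simp
  next
    case 2
    then have "p t (k + 1) \<le> p t j" using p_less[OF t, of "k + 1" j] assms by (cases "k + 1 = j") auto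
    then show False using assms by simp
  qed
qed

definition secant :: "nat \<Rightarrow> real \<Rightarrow> real" where
  "secant j t = (\<phi> t (p t (j + 1)) - \<phi> t (p t j)) / (p t (j + 1) - p t j)"

text \<open>The integrand of the error on the \<open>j\<close>-th element: the interpolant of \<open>w \<partial>\<^sub>x\<phi>\<close> minus
  \<open>w \<partial>\<^sub>x(\<Pi>\<^sub>h\<phi>)\<close>. It arises because the hat functions are transported by the mesh velocity.\<close>

definition elt :: "nat \<Rightarrow> real \<Rightarrow> real \<Rightarrow> real" where
  "elt j t x = ((p t (j + 1) - x) * (w j * (dx t (p t j) - secant j t))
      + (x - p t j) * (w (j + 1) * (dx t (p t (j + 1)) - secant j t))) / (p t (j + 1) - p t j)"

text \<open>A sum of indicators instead of a choice of the element containing \<open>x\<close>: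
  joint measurability in time and space, required by Fubini, is then visible from the formula. At
  the nodes the value is 0.\<close>

definition err :: "real \<Rightarrow> real \<Rightarrow> real" where
  "err t x = (\<Sum>j = 1..<N. indicator {p t j<..<p t (j + 1)} x * elt j t x)"

lemma err_elt:
  assumes t: "t \<in> {t0..t1}" and j: "j \<in> {1..<N}" and x: "p t j < x" "x < p t (j + 1)"
  shows "err t x = elt j t x"
proof -
  have "err t x = (\<Sum>k = 1..<N. if k = j then elt j t x else 0)"
    unfolding err_def
  proof (intro sum.cong refl)
    fix k assume k: "k \<in> {1..<N}"
    have "x \<in> {p t k<..<p t (k + 1)} \<longleftrightarrow> k = j"
      using p_unique[OF t k j _ _ x] x by auto
    then show "indicator {p t k<..<p t (k + 1)} x * elt k t x = (if k = j then elt j t x else 0)"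
      by (auto simp only: indicator_simps if_True if_False mult_1 mult_zero_left split: if_splits)
  qed
  then show ?thesis using j by simp
qed

lemma has_deriv_interp:
  assumes t: "t \<in> S" and j: "j \<in> {1..<N}" and x: "p t j < x" "x < p t (j + 1)"
  shows "((\<lambda>s. interp N (p s) (\<phi> s) x) has_real_derivative elt j t x + interp N (p t) (dt t) x) (at t)"
proof -
  have tJ: "t \<in> J" and t': "t \<in> {t0..t1}" using t t01 by auto
  have pd: "((\<lambda>s. p s i) has_real_derivative w i) (at t)" for i
    unfolding p_def by (auto intro!: derivative_eq_intros)
  have fd: "((\<lambda>s. \<phi> s (p s i)) has_real_derivative dt t (p t i) + w i * dx t (p t i)) (at t)" if "i \<in> {1..N}" for i
    using p_in_open[OF t' that] by (intro has_deriv_path[OF tJ]) (simp_all add: p_def algebra_simps)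
  let ?n = "\<lambda>s. (p s (j + 1) - x) * \<phi> s (p s j) + (x - p s j) * \<phi> s (p s (j + 1))"
  let ?L = "\<lambda>s. p s (j + 1) - p s j"
  have jN: "j \<in> {1..N}" "j + 1 \<in> {1..N}" using j by auto
  have L: "?L t > 0" using p_mono[OF t' j] by simp
  let ?f = "\<phi> t (p t j)" and ?g = "\<phi> t (p t (j + 1))"
  let ?f' = "dt t (p t j) + w j * dx t (p t j)" and ?g' = "dt t (p t (j + 1)) + w (j + 1) * dx t (p t (j + 1))"
  let ?raw = "(((w (j + 1) - 0) * ?f + ?f' * (p t (j + 1) - x) + ((0 - w j) * ?g + ?g' * (x - p t j))) * ?L t
      - ?n t * (w (j + 1) - w j)) / (?L t * ?L t)"
  have "((\<lambda>s. ?n s / ?L s) has_real_derivative ?raw) (at t)"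
    using L by (intro DERIV_divide DERIV_add DERIV_mult DERIV_diff pd fd jN DERIV_const) simp
  also have "?raw = elt j t x + ((p t (j + 1) - x) * dt t (p t j) + (x - p t j) * dt t (p t (j + 1))) / ?L t"
  proof -
    have alg: "(((w2 - 0) * f + (d1 + w1 * x1) * (p2 - x) + ((0 - w1) * g + (d2 + w2 * x2) * (x - p1))) * (p2 - p1)
          - ((p2 - x) * f + (x - p1) * g) * (w2 - w1)) / ((p2 - p1) * (p2 - p1))
        = ((p2 - x) * (w1 * (x1 - (g - f) / (p2 - p1))) + (x - p1) * (w2 * (x2 - (g - f) / (p2 - p1)))) / (p2 - p1)
          + ((p2 - x) * d1 + (x - p1) * d2) / (p2 - p1)"
      if "p2 - p1 \<noteq> 0" for w1 w2 f g p1 p2 x1 x2 d1 d2 :: real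
    proof -
      \<comment> \<open>Writing \<open>g = f + r * M\<close> with the slope \<open>r\<close> of the
        secant removes the inner quotient; the numerator of the quotient rule is then
        \<open>M\<close> times the polynomial \<open>m\<close>.\<close>
      define M where "M = p2 - p1"
      define r where "r = (g - f) / M"
      define m where "m = ((p2 - x) * (w1 * (x1 - r)) + (x - p1) * (w2 * (x2 - r))) + ((p2 - x) * d1 + (x - p1) * d2)"
      have M: "M \<noteq> 0" "p2 = M + p1" using that by (auto simp: M_def)
      have g: "g = f + r * M" using M(1) by (simp add: r_def)
      have "(((w2 - 0) * f + (d1 + w1 * x1) * (p2 - x) + ((0 - w1) * g + (d2 + w2 * x2) * (x - p1))) * M
          - ((p2 - x) * f + (x - p1) * g) * (w2 - w1)) = M * m"
        unfolding m_def g M(2) by (simp add: algebra_simps)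
      then show ?thesis
        unfolding M_def[symmetric] r_def[symmetric] using M(1) by (simp add: m_def add_divide_distrib)
    qed
    show ?thesis unfolding elt_def secant_def using L by (intro alg) simp
  qed
  also have "((p t (j + 1) - x) * dt t (p t j) + (x - p t j) * dt t (p t (j + 1))) / ?L t = interp N (p t) (dt t) x"
    by (rule interp_element[where p = "p t", OF p_mono[OF t'] N j, symmetric]) (use x in auto)
  finally have D: "((\<lambda>s. ?n s / ?L s) has_real_derivative elt j t x + interp N (p t) (dt t) x) (at t)" .
  \<comment> \<open>Lying strictly inside the moving element is an open condition on time, so the
    formula for this element is valid in a neighbourhood of \<open>t\<close>.\<close>
  have "continuous_on UNIV (\<lambda>s. p s j)" "continuous_on UNIV (\<lambda>s. p s (j + 1))" by (rule p_continuous)+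
  then have "open {s. p s j < x}" "open {s. x < p s (j + 1)}"
    by (auto intro!: open_Collect_less continuous_on_const)
  then have "open ({s. p s j < x} \<inter> {s. x < p s (j + 1)} \<inter> S)" by (intro open_Int) auto
  with D show ?thesis
  proof (rule has_field_derivative_transform_within_open)
    show "t \<in> {s. p s j < x} \<inter> {s. x < p s (j + 1)} \<inter> S" using t x by auto
    fix s assume "s \<in> {s. p s j < x} \<inter> {s. x < p s (j + 1)} \<inter> S"
    then show "?n s / ?L s = interp N (p s) (\<phi> s) x"
      by (intro interp_element[where p = "p s", OF p_mono N j, symmetric]) auto
  qed
qed

lemma continuous_hat:
  assumes A: "A \<subseteq> {t0..t1}" and i: "i \<in> {1..N}" and x: "x \<in> {a..b}"
  shows "continuous_on A (\<lambda>t. hat N (p t) i x)"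
proof -
  let ?m = "\<lambda>t. max 0 (min (if 1 < i then (x - p t (i - 1)) / (p t i - p t (i - 1)) else 1)
      (if i < N then (p t (i + 1) - x) / (p t (i + 1) - p t i) else 1))"
  have l: "1 < i \<Longrightarrow> t \<in> A \<Longrightarrow> p t i - p t (i - 1) \<noteq> 0" for t using p_mono[of t "i - 1"] A i by fastforce
  have r: "i < N \<Longrightarrow> t \<in> A \<Longrightarrow> p t (i + 1) - p t i \<noteq> 0" for t using p_mono[of t i] A i by fastforce
  have "continuous_on A ?m"
  proof (intro continuous_on_max continuous_on_min continuous_on_const)
    show "continuous_on A (\<lambda>t. if 1 < i then (x - p t (i - 1)) / (p t i - p t (i - 1)) else 1)"
      using l by (cases "1 < i") (auto intro!: continuous_intros p_continuous)
    show "continuous_on A (\<lambda>t. if i < N then (p t (i + 1) - x) / (p t (i + 1) - p t i) else 1)"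
      using r by (cases "i < N") (auto intro!: continuous_intros p_continuous)
  qed
  moreover have "?m t = hat N (p t) i x" if "t \<in> A" for t
    using that A x by (intro hat_eq_max_min[where p = "p t", symmetric] p_mono i N) (auto simp: p_ends)
  ultimately show ?thesis by (metis (no_types, lifting) continuous_on_cong)
qed

text \<open>A moving node passes \<open>x\<close> at one time at most, and the fundamental theorem
  tolerates finitely many exceptions and asks for continuity alone at the ends of the slab. A node
  resting at \<open>x\<close> would make all times exceptional, hence the hypothesis
  \<open>bad\<close>.\<close>

lemma interp_has_integral:
  assumes x: "x \<in> \<Omega>" and bad: "\<And>i. i \<in> {1..N} \<Longrightarrow> w i = 0 \<Longrightarrow> x \<noteq> q i"
  shows "((\<lambda>t. err t x + interp N (p t) (dt t) x) has_integral
      (interp N (p t1) (\<phi> t1) x - interp N (p t0) (\<phi> t0) x)) {t0..t1}"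
proof (rule fundamental_theorem_of_calculus_interior_strong)
  \<comment> \<open>The times of passage. A node at rest contributes just \<open>t0\<close>, because
    division by 0 gives 0.\<close>
  let ?X = "(\<lambda>i. t0 + (x - q i) / w i) ` {1..N}"
  show "finite ?X" by simp
  show "t0 \<le> t1" using t01 by simp
  show "continuous_on {t0..t1} (\<lambda>t. interp N (p t) (\<phi> t) x)"
    unfolding interp_def using x p_in t01
    by (intro continuous_intros continuous_hat continuous_path[OF p_continuous]) auto
  fix t assume t: "t \<in> {t0<..<t1} - ?X"
  then have t': "t \<in> {t0..t1}" by auto
  have "x \<noteq> p t i" if i: "i \<in> {1..N}" for i
  proof
    assume eq: "x = p t i"
    show False
    proof (cases "w i = 0")
      case True
      then show False using bad[OF i] eq by (simp add: p_def)
    next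
      case False
      then have "t = t0 + (x - q i) / w i" using eq by (simp add: p_def)
      then show False using t i by blast
    qed
  qed
  then obtain j where j: "j \<in> {1..<N}" "p t j < x" "x < p t (j + 1)"
    using ex_element[of N "p t" x] N x p_ends[of t] by auto
  then show "((\<lambda>t. interp N (p t) (\<phi> t) x) has_vector_derivative err t x + interp N (p t) (dt t) x) (at t)"
    using has_deriv_interp[of t j x] t err_elt[OF t' j] by (simp add: has_real_derivative_iff_has_vector_derivative)
qed

section \<open>Integrability of the error integrand in time and space\<close>

lemma measurable_continuous_S:
  fixes f :: "real \<Rightarrow> real"
  shows "continuous_on S f \<Longrightarrow> f \<in> borel_measurable (lebesgue_on S)"
  by (rule continuous_imp_measurable_on_sets_lebesgue) auto

lemma S_J: "t \<in> S \<Longrightarrow> t \<in> J" using t01 by auto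

lemma dx_secant_continuous:
  assumes j: "j \<in> {1..<N}"
  shows "continuous_on S (\<lambda>t. dx t (p t j) - secant j t)" "continuous_on S (\<lambda>t. dx t (p t (j + 1)) - secant j t)"
proof -
  have i: "continuous_on S (\<lambda>t. dx t (p t i))" "continuous_on S (\<lambda>t. \<phi> t (p t i))" if "i \<in> {1..N}" for i
    using t01 p_in[OF _ that] by (auto intro!: dt_dx_continuous_path(2) continuous_path p_continuous)
  have jN: "j \<in> {1..N}" "j + 1 \<in> {1..N}" using j by auto
  have L: "p t (j + 1) - p t j \<noteq> 0" if "t \<in> S" for t using p_mono[of t j] j that by auto
  have "continuous_on S (secant j)"
    unfolding secant_def[abs_def] by (intro continuous_intros i jN p_continuous ballI L)
  with i(1)[OF jN(1)] i(1)[OF jN(2)]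
  show "continuous_on S (\<lambda>t. dx t (p t j) - secant j t)" "continuous_on S (\<lambda>t. dx t (p t (j + 1)) - secant j t)"
    by (auto intro: continuous_on_diff)
qed

lemma err_measurable: "(\<lambda>(t, x). err t x) \<in> borel_measurable (lebesgue_on S \<Otimes>\<^sub>M lebesgue_on \<Omega>)"
proof -
  let ?M = "lebesgue_on S" and ?X = "lebesgue_on \<Omega>"
  have [measurable]: "(\<lambda>x. x) \<in> borel_measurable ?X" by (intro borel_measurable_lebesgue_on) simp
  have [measurable]: "(\<lambda>t. p t i) \<in> borel_measurable ?M" for i by (intro measurable_continuous_S p_continuous)
  have "(\<lambda>z. (if p (fst z) j < snd z \<and> snd z < p (fst z) (j + 1) then 1 else 0) * elt j (fst z) (snd z))
      \<in> borel_measurable (?M \<Otimes>\<^sub>M ?X)" if j: "j \<in> {1..<N}" for j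
  proof -
    have [measurable]: "(\<lambda>t. dx t (p t j) - secant j t) \<in> borel_measurable ?M"
      "(\<lambda>t. dx t (p t (j + 1)) - secant j t) \<in> borel_measurable ?M"
      by (intro measurable_continuous_S dx_secant_continuous j)+
    show ?thesis unfolding elt_def by measurable
  qed
  then have "(\<lambda>z. \<Sum>j = 1..<N. (if p (fst z) j < snd z \<and> snd z < p (fst z) (j + 1) then 1 else 0) * elt j (fst z) (snd z))
      \<in> borel_measurable (?M \<Otimes>\<^sub>M ?X)" by (rule borel_measurable_sum)
  moreover have "(\<lambda>z. \<Sum>j = 1..<N. (if p (fst z) j < snd z \<and> snd z < p (fst z) (j + 1) then 1 else 0) * elt j (fst z) (snd z))
      = (\<lambda>(t, x). err t x)"
    by (rule ext, unfold case_prod_beta err_def, rule sum.cong[OF refl]) (auto split: split_indicator)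
  ultimately show ?thesis by simp
qed

lemma dx_minus_secant_le:
  assumes t: "t \<in> S" and j: "j \<in> {1..<N}" and z: "z \<in> {p t j..p t (j + 1)}"
  shows "\<bar>dx t z - secant j t\<bar> \<le> integral {p t j..p t (j + 1)} (\<lambda>s. \<bar>weak_deriv \<Omega> 2 (\<phi> t) s\<bar>)"
proof -
  have tt: "t \<in> {t0..t1}" "t \<in> J" using t S_J by auto
  have i: "p t j \<in> {a..b}" "p t (j + 1) \<in> {a..b}" using p_in[OF tt(1), of j] p_in[OF tt(1), of "j + 1"] j by auto
  have "\<bar>crep a b 1 (\<phi> t) z - (crep a b 0 (\<phi> t) (p t (j + 1)) - crep a b 0 (\<phi> t) (p t j)) / (p t (j + 1) - p t j)\<bar>
    \<le> integral {p t j..p t (j + 1)} (\<lambda>s. \<bar>weak_deriv \<Omega> 2 (\<phi> t) s\<bar>)"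
    using i p_mono[OF tt(1) j] z by (intro tangent_minus_secant_le[OF sobolev_3[OF tt(2)]] ab) auto
  then show ?thesis unfolding dx_def secant_def crep_phi[OF tt(2) i(1)] crep_phi[OF tt(2) i(2)] .
qed

text \<open>On the element the function is a convex combination of its two nodal values, each a
  velocity times the difference between a tangent and the secant.\<close>

lemma elt_le:
  assumes t: "t \<in> S" and j: "j \<in> {1..<N}" and x: "x \<in> {p t j..p t (j + 1)}"
  shows "\<bar>elt j t x\<bar> \<le> W * integral {p t j..p t (j + 1)} (\<lambda>s. \<bar>weak_deriv \<Omega> 2 (\<phi> t) s\<bar>)" (is "_ \<le> W * ?R")
proof -
  have tt: "t \<in> {t0..t1}" using t by auto
  let ?L = "p t (j + 1) - p t j"
  have L: "?L > 0" using p_mono[OF tt j] by simp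
  have W: "\<bar>w j\<bar> \<le> W" "\<bar>w (j + 1)\<bar> \<le> W" using j by (auto intro!: w_le)
  have A: "\<bar>w j * (dx t (p t j) - secant j t)\<bar> \<le> W * ?R" "\<bar>w (j + 1) * (dx t (p t (j + 1)) - secant j t)\<bar> \<le> W * ?R"
    unfolding abs_mult using L W dx_minus_secant_le[OF t j] by (auto intro!: mult_mono)
  let ?A = "w j * (dx t (p t j) - secant j t)" and ?B = "w (j + 1) * (dx t (p t (j + 1)) - secant j t)"
  have "\<bar>(p t (j + 1) - x) * ?A + (x - p t j) * ?B\<bar> \<le> (p t (j + 1) - x) * \<bar>?A\<bar> + (x - p t j) * \<bar>?B\<bar>"
    using x by (intro order_trans[OF abs_triangle_ineq]) (auto simp: abs_mult)
  also have "\<dots> \<le> (p t (j + 1) - x) * (W * ?R) + (x - p t j) * (W * ?R)"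
    using A x by (intro add_mono mult_left_mono) auto
  also have "\<dots> = (W * ?R) * ?L" by (simp add: algebra_simps)
  finally have "\<bar>(p t (j + 1) - x) * ?A + (x - p t j) * ?B\<bar> / ?L \<le> W * ?R"
    using L by (simp add: pos_divide_le_eq)
  then show ?thesis using L by (simp add: elt_def abs_divide)
qed

text \<open>A crude bound that grows with the number of elements. It serves integrability on the
  product space only and leaves no trace in the estimates.\<close>

lemma err_bounded: obtains B where "\<And>t x. t \<in> S \<Longrightarrow> \<bar>err t x\<bar> \<le> B"
proof -
  obtain C where C: "\<And>t. t \<in> J \<Longrightarrow> sobolev_norm \<Omega> 2 (\<phi> t) \<le> C" using sobolev_norm_2_bounded by blast
  have W0: "0 \<le> W" using w_le[of 1] N by auto
  define B where "B = W * (sqrt (b - a) * C)"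
  have "\<bar>elt j t x\<bar> \<le> B" if t: "t \<in> S" and j: "j \<in> {1..<N}" and x: "x \<in> {p t j..p t (j + 1)}" for t j x
  proof -
    have tt: "t \<in> {t0..t1}" using t by auto
    have w: "weak_deriv \<Omega> 2 (\<phi> t) \<in> L2_space \<Omega>"
      by (rule has_weak_deriv_weak_deriv(2)[OF sobolev_3[OF S_J[OF t]] _ ab]) simp
    then have wi: "integrable (lebesgue_on \<Omega>) (\<lambda>s. \<bar>weak_deriv \<Omega> 2 (\<phi> t) s\<bar>)" using L2_space_integrable by auto
    have i: "p t j \<in> {a..b}" "p t (j + 1) \<in> {a..b}" using p_in[OF tt, of j] p_in[OF tt, of "j + 1"] j by auto
    have "integral {p t j..p t (j + 1)} (\<lambda>s. \<bar>weak_deriv \<Omega> 2 (\<phi> t) s\<bar>) \<le> integral {a..b} (\<lambda>s. \<bar>weak_deriv \<Omega> 2 (\<phi> t) s\<bar>)"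
      using i p_mono[OF tt j] by (intro integral_subinterval_le[OF wi]) auto
    also have "\<dots> = (\<integral>s. \<bar>weak_deriv \<Omega> 2 (\<phi> t) s\<bar> \<partial>lebesgue_on \<Omega>)" by (rule integral_Icc_eq_lebesgue_on[OF wi ab])
    also have "\<dots> \<le> sqrt (b - a) * L2_norm \<Omega> (weak_deriv \<Omega> 2 (\<phi> t))" by (rule integral_abs_le_L2_norm[OF w ab])
    also have "\<dots> \<le> sqrt (b - a) * C"
      using ab by (intro mult_left_mono order_trans[OF L2_norm_le_sobolev_norm C[OF S_J[OF t]]]) auto
    finally show ?thesis
      using elt_le[OF t j x] W0 unfolding B_def by (meson mult_left_mono order_trans)
  qed
  then have "\<bar>indicator {p t j<..<p t (j + 1)} x * elt j t x\<bar> \<le> \<bar>B\<bar>" if "t \<in> S" "j \<in> {1..<N}" for t j x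
    using that by (cases "x \<in> {p t j<..<p t (j + 1)}") (auto intro: order_trans[OF _ abs_ge_self])
  then have "\<bar>err t x\<bar> \<le> (\<Sum>j = 1..<N. \<bar>B\<bar>)" if "t \<in> S" for t x
    unfolding err_def using that by (intro order_trans[OF sum_abs] sum_mono) auto
  then show ?thesis by (rule that)
qed

lemma err_integrable: "integrable (lebesgue_on S \<Otimes>\<^sub>M lebesgue_on \<Omega>) (\<lambda>(t, x). err t x)"
  "integrable (lebesgue_on S \<Otimes>\<^sub>M lebesgue_on \<Omega>) (\<lambda>(t, x). (err t x)\<^sup>2)"
proof -
  interpret S: finite_measure "lebesgue_on S" by (rule finite_measure_lebesgue_on_interval)
  interpret X: finite_measure "lebesgue_on \<Omega>" by (rule finite_measure_lebesgue_on_interval)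
  interpret P: pair_sigma_finite "lebesgue_on S" "lebesgue_on \<Omega>" ..
  interpret F: finite_measure "lebesgue_on S \<Otimes>\<^sub>M lebesgue_on \<Omega>"
    by (intro finite_measure_pair_measure finite_measure_lebesgue_on_interval)
  obtain B where B: "\<And>t x. t \<in> S \<Longrightarrow> \<bar>err t x\<bar> \<le> B" using err_bounded by blast
  show "integrable (lebesgue_on S \<Otimes>\<^sub>M lebesgue_on \<Omega>) (\<lambda>(t, x). err t x)"
    by (rule F.integrable_const_bound[of _ B]) (use B err_measurable in \<open>auto simp: space_pair_measure\<close>)
  have "(\<lambda>z. (case z of (t, x) \<Rightarrow> err t x)\<^sup>2) \<in> borel_measurable (lebesgue_on S \<Otimes>\<^sub>M lebesgue_on \<Omega>)"
    using err_measurable by measurable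
  then have m: "(\<lambda>(t, x). (err t x)\<^sup>2) \<in> borel_measurable (lebesgue_on S \<Otimes>\<^sub>M lebesgue_on \<Omega>)"
    by (simp add: case_prod_beta)
  have "(err t x)\<^sup>2 \<le> B\<^sup>2" if "t \<in> S" for t x
    using power_mono[OF B[OF that] abs_ge_zero, of x 2] by simp
  then show "integrable (lebesgue_on S \<Otimes>\<^sub>M lebesgue_on \<Omega>) (\<lambda>(t, x). (err t x)\<^sup>2)"
    by (intro F.integrable_const_bound[of _ "B\<^sup>2"] m) (auto simp: space_pair_measure)
qed

lemma integral_lebesgue_on_Icc_eq_Ioo:
  fixes f :: "real \<Rightarrow> real"
  assumes "integrable (lebesgue_on {c<..<d}) f"
  shows "(\<integral>t. f t \<partial>lebesgue_on {c..d}) = (\<integral>t. f t \<partial>lebesgue_on {c<..<d})"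
proof -
  have "f absolutely_integrable_on {c<..<d}"
    using assms by (simp add: set_integrable_def integrable_restrict_space)
  then have "f absolutely_integrable_on {c..d}"
    using absolutely_integrable_on_open_interval[where f = f and a = c and b = d] by (simp add: box_real)
  then have "integrable (lebesgue_on {c..d}) f"
    by (simp add: set_integrable_def integrable_restrict_space)
  then have "(f has_integral (\<integral>t. f t \<partial>lebesgue_on {c..d})) {c..d}"
    by (rule has_integral_integral_lebesgue_on) simp
  moreover have "(f has_integral (\<integral>t. f t \<partial>lebesgue_on {c<..<d})) {c<..<d}"
    using assms by (rule has_integral_integral_lebesgue_on) simp
  ultimately show ?thesis
    by (auto simp: has_integral_Icc_iff_Ioo dest: has_integral_unique)
qed

lemma error_identity:
  "AE x in lebesgue_on \<Omega>. (interp N (p t1) (\<phi> t1) x - interp N (p t0) (\<phi> t0) x)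
      - (\<integral>t. interp N (p t) (time_deriv \<phi> t) x \<partial>lebesgue_on {t0..t1}) = (\<integral>t. err t x \<partial>lebesgue_on S)"
proof -
  let ?M = "lebesgue_on S"
  interpret M: finite_measure ?M by (rule finite_measure_lebesgue_on_interval)
  interpret X: finite_measure "lebesgue_on \<Omega>" by (rule finite_measure_lebesgue_on_interval)
  interpret P: pair_sigma_finite ?M "lebesgue_on \<Omega>" ..
  \<comment> \<open>A node at rest stays at its initial position, so excluding all initial positions
    meets the hypothesis on nodes at rest at the price of a null set.\<close>
  have "q ` {1..N} \<in> null_sets lebesgue"
    by (subst negligible_iff_null_sets[symmetric]) (simp add: negligible_finite)
  then have "AE x in lebesgue. x \<in> \<Omega> \<longrightarrow> x \<notin> q ` {1..N}"
    by (rule eventually_mono[OF AE_not_in]) simp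
  then have "AE x in lebesgue_on \<Omega>. x \<notin> q ` {1..N}"
    by (subst AE_restrict_space_iff) auto
  moreover have "AE x in lebesgue_on \<Omega>. integrable ?M (\<lambda>t. err t x)"
    using P.AE_integrable_snd[of err] err_integrable(1) by simp
  ultimately show ?thesis
    using AE_space
  proof eventually_elim
    case (elim x)
    then have x: "x \<in> \<Omega>" by simp
    let ?g = "\<lambda>t. interp N (p t) (dt t) x"
    obtain B where B: "\<And>t x. t \<in> J \<Longrightarrow> x \<in> {a..b} \<Longrightarrow> \<bar>dt t x\<bar> \<le> B" using dt_bounded by blast
    have "\<bar>?g t\<bar> \<le> (\<Sum>i = 1..N. \<bar>B\<bar>)" if t: "t \<in> S" for t
      unfolding interp_def
    proof (intro order_trans[OF sum_abs] sum_mono)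
      fix i assume i: "i \<in> {1..N}"
      have "p t i \<in> {a..b}" using t i by (intro p_in) auto
      then have "\<bar>dt t (p t i)\<bar> \<le> \<bar>B\<bar>" using B[OF S_J[OF t]] by (meson abs_ge_self order_trans)
      then show "\<bar>dt t (p t i) * hat N (p t) i x\<bar> \<le> \<bar>B\<bar>"
        using hat_nonneg hat_le_1 unfolding abs_mult by (intro order_trans[OF mult_left_le]) auto
    qed
    moreover have "continuous_on S ?g"
      unfolding interp_def using x p_in t01
      by (intro continuous_intros continuous_hat dt_dx_continuous_path(1) p_continuous) auto
    ultimately have g: "integrable ?M ?g"
      by (intro M.integrable_const_bound[of _ "\<Sum>i = 1..N. \<bar>B\<bar>"] measurable_continuous_S) auto
    have eq: "interp N (p t) (time_deriv \<phi> t) x = ?g t" if t: "t \<in> S" for t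
      unfolding interp_def using t p_in[of t] by (intro sum.cong) (auto simp: time_deriv_eq[OF S_J[OF t]])
    \<comment> \<open>The closed slab may contain 0 or \<open>T\<close>, where
      \<open>time_deriv\<close> is not known to equal \<open>dt\<close>; its end points are dropped
      before the two are identified.\<close>
    have "(\<integral>t. interp N (p t) (time_deriv \<phi> t) x \<partial>lebesgue_on {t0..t1}) = (\<integral>t. interp N (p t) (time_deriv \<phi> t) x \<partial>?M)"
      using g by (intro integral_lebesgue_on_Icc_eq_Ioo) (subst Bochner_Integration.integrable_cong[OF refl eq], auto)
    also have "\<dots> = (\<integral>t. ?g t \<partial>?M)"
      by (intro Bochner_Integration.integral_cong) (auto simp: eq)
    finally have G: "(\<integral>t. interp N (p t) (time_deriv \<phi> t) x \<partial>lebesgue_on {t0..t1}) = (\<integral>t. ?g t \<partial>?M)" .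
    have "((\<lambda>t. err t x + ?g t) has_integral (\<integral>t. err t x + ?g t \<partial>?M)) S"
      using g elim(2) by (intro has_integral_integral_lebesgue_on) auto
    moreover have "((\<lambda>t. err t x + ?g t) has_integral
        (interp N (p t1) (\<phi> t1) x - interp N (p t0) (\<phi> t0) x)) {t0..t1}"
      using elim(1) by (intro interp_has_integral x) auto
    ultimately have "(\<integral>t. err t x + ?g t \<partial>?M) = interp N (p t1) (\<phi> t1) x - interp N (p t0) (\<phi> t0) x"
      by (auto simp: has_integral_Icc_iff_Ioo dest: has_integral_unique)
    then show ?case using G g elim(2) by simp
  qed
qed

end

section \<open>Error estimates on a time slab\<close>

lemma integral_indicator_eq_integral:
  fixes g :: "real \<Rightarrow> real"
  assumes "integrable (lebesgue_on {a<..<b}) g" "a \<le> x" "x \<le> y" "y \<le> b"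
  shows "(\<integral>z. indicator {x<..<y} z * g z \<partial>lebesgue_on {a<..<b}) = integral {x..y} g"
  using has_integral_lebesgue_on_interval[OF assms] by (simp add: integral_unique)

context mesh_slab
begin

lemma W_nonneg: "0 \<le> W" using w_le[of 1] N by auto

lemma element_in:
  assumes t: "t \<in> {t0..t1}" and j: "j \<in> {1..<N}"
  shows "a \<le> p t j" "p t j < p t (j + 1)" "p t (j + 1) \<le> b" "p t (j + 1) - p t j \<le> h"
  using p_in[OF t, of j] p_in[OF t, of "j + 1"] p_mono[OF t j] mesh[OF t j] j by (auto simp: p_def)

lemma h_pos: "0 < h"
  using element_in[of t0 1] N t01 by auto

lemma sum_elements:
  fixes g :: "real \<Rightarrow> real"
  assumes t: "t \<in> {t0..t1}" and g: "integrable (lebesgue_on \<Omega>) g"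
  shows "(\<Sum>j = 1..<N. integral {p t j..p t (j + 1)} g) = (\<integral>x. g x \<partial>lebesgue_on \<Omega>)"
proof -
  have "g integrable_on {p t 1..p t N}"
    unfolding p_ends using g ab by (intro integrable_lebesgue_on_interval_imp_integrable_on) auto
  then have "(\<Sum>j = 1..<N. integral {p t j..p t (j + 1)} g) = integral {p t 1..p t N} g"
    using sum_integral_elements[of N "p t" g] N p_mono[OF t] by (auto intro: less_imp_le)
  then show ?thesis unfolding p_ends using integral_Icc_eq_lebesgue_on[OF g ab] by simp
qed

text \<open>On an element of length L the integrand is at most \<open>W\<close> times the integral
  of the modulus of the second derivative. Squaring and Cauchy-Schwarz give one factor L,
  integrating over the element another; so the square carries \<open>h * h\<close>, and the sum over
  the elements restores the global norm.\<close>

lemma err_square_integral_le: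
  assumes t: "t \<in> S"
  shows "(\<integral>x. (err t x)\<^sup>2 \<partial>lebesgue_on \<Omega>) \<le> (W * h * sobolev_norm \<Omega> 2 (\<phi> t))\<^sup>2"
proof -
  interpret X: finite_measure "lebesgue_on \<Omega>" by (rule finite_measure_lebesgue_on_interval)
  have tt: "t \<in> {t0..t1}" using t by auto
  let ?D = "weak_deriv \<Omega> 2 (\<phi> t)"
  have D: "?D \<in> L2_space \<Omega>" by (rule has_weak_deriv_weak_deriv(2)[OF sobolev_3[OF S_J[OF t]] _ ab]) simp
  have D2: "integrable (lebesgue_on \<Omega>) (\<lambda>x. (?D x)\<^sup>2)" using D by (simp add: L2_space_def)
  let ?r = "\<lambda>j. integral {p t j..p t (j + 1)} (\<lambda>s. \<bar>?D s\<bar>)"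
  let ?c = "\<lambda>j. W\<^sup>2 * (?r j)\<^sup>2"
  let ?ind = "\<lambda>j. indicator {p t j<..<p t (j + 1)} :: real \<Rightarrow> real"
  have ind: "integrable (lebesgue_on \<Omega>) (\<lambda>x. ?ind j x * c)" for j c
    by (intro integrable_times_indicator_interval) auto
  have le: "(err t x)\<^sup>2 \<le> (\<Sum>j = 1..<N. ?ind j x * ?c j)" for x
  proof (cases "\<exists>j\<in>{1..<N}. p t j < x \<and> x < p t (j + 1)")
    case True
    then obtain j where j: "j \<in> {1..<N}" "p t j < x" "x < p t (j + 1)" by blast
    have "\<bar>err t x\<bar> \<le> W * ?r j"
      using err_elt[OF tt j] elt_le[OF t j(1), of x] j by simp
    then have "(err t x)\<^sup>2 \<le> ?c j" using power_mono[of "\<bar>err t x\<bar>" "W * ?r j" 2] by (simp add: power_mult_distrib)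
    also have "\<dots> = ?ind j x * ?c j" using j by simp
    also have "\<dots> \<le> (\<Sum>j = 1..<N. ?ind j x * ?c j)"
      using j by (intro member_le_sum) auto
    finally show ?thesis .
  next
    case False
    then have "err t x = 0" unfolding err_def by (intro sum.neutral) (auto simp: indicator_def)
    then show ?thesis by (simp add: sum_nonneg)
  qed
  have "(\<integral>x. (err t x)\<^sup>2 \<partial>lebesgue_on \<Omega>) \<le> (\<integral>x. (\<Sum>j = 1..<N. ?ind j x * ?c j) \<partial>lebesgue_on \<Omega>)"
  proof (rule integral_mono_AE')
    show "integrable (lebesgue_on \<Omega>) (\<lambda>x. \<Sum>j = 1..<N. ?ind j x * ?c j)"
      by (intro Bochner_Integration.integrable_sum ind)
    show "AE x in lebesgue_on \<Omega>. (err t x)\<^sup>2 \<le> (\<Sum>j = 1..<N. ?ind j x * ?c j)"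
      by (rule AE_I2) (rule le)
    show "AE x in lebesgue_on \<Omega>. 0 \<le> (\<Sum>j = 1..<N. ?ind j x * ?c j)"
      by (intro AE_I2 sum_nonneg) simp
  qed
  also have "\<dots> = (\<Sum>j = 1..<N. (\<integral>x. ?ind j x * 1 \<partial>lebesgue_on \<Omega>) * ?c j)"
    by (subst Bochner_Integration.integral_sum[OF ind]) simp
  also have "\<dots> = (\<Sum>j = 1..<N. (p t (j + 1) - p t j) * ?c j)"
  proof (intro sum.cong refl)
    fix j assume j: "j \<in> {1..<N}"
    have "(\<integral>x. ?ind j x * 1 \<partial>lebesgue_on \<Omega>) = integral {p t j..p t (j + 1)} (\<lambda>x. 1)"
      using element_in[OF tt j] by (intro integral_indicator_eq_integral) auto
    also have "\<dots> = p t (j + 1) - p t j" using element_in[OF tt j] by simp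
    finally show "(\<integral>x. ?ind j x * 1 \<partial>lebesgue_on \<Omega>) * ?c j = (p t (j + 1) - p t j) * ?c j" by simp
  qed
  also have "\<dots> \<le> (\<Sum>j = 1..<N. (W * h)\<^sup>2 * integral {p t j..p t (j + 1)} (\<lambda>s. (?D s)\<^sup>2))"
  proof (intro sum_mono)
    fix j assume j: "j \<in> {1..<N}"
    let ?q = "integral {p t j..p t (j + 1)} (\<lambda>s. (?D s)\<^sup>2)" and ?L = "p t (j + 1) - p t j"
    note e = element_in[OF tt j]
    have q0: "0 \<le> ?q"
      using e by (intro Henstock_Kurzweil_Integration.integral_nonneg integrable_lebesgue_on_interval_imp_integrable_on[OF D2]) auto
    have "(?r j)\<^sup>2 \<le> ?L * ?q" by (rule Cauchy_Schwarz_integral_interval[OF D e(1-3)])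
    then have "?L * ?c j \<le> ?L * (W\<^sup>2 * (?L * ?q))" using e by (intro mult_left_mono) auto
    also have "\<dots> = W\<^sup>2 * (?L * ?L) * ?q" by (simp add: mult_ac)
    also have "\<dots> \<le> W\<^sup>2 * (h * h) * ?q"
      using e q0 by (intro mult_right_mono mult_left_mono mult_mono) auto
    also have "\<dots> = (W * h)\<^sup>2 * ?q" by (simp add: power_mult_distrib power2_eq_square)
    finally show "?L * ?c j \<le> (W * h)\<^sup>2 * ?q" .
  qed
  also have "\<dots> = (W * h)\<^sup>2 * (L2_norm \<Omega> ?D)\<^sup>2"
    unfolding sum_distrib_left[symmetric] sum_elements[OF tt D2] L2_norm_power2 ..
  also have "\<dots> \<le> (W * h)\<^sup>2 * (sobolev_norm \<Omega> 2 (\<phi> t))\<^sup>2"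
    by (intro mult_left_mono power_mono L2_norm_le_sobolev_norm L2_norm_nonneg) auto
  finally show ?thesis by (simp add: power_mult_distrib)
qed

text \<open>An affine function is integrated exactly by the trapezoidal rule.\<close>

lemma integral_elt:
  assumes t: "t \<in> {t0..t1}" and j: "j \<in> {1..<N}"
  shows "(elt j t has_integral (p t (j + 1) - p t j) / 2 *
      (w j * (dx t (p t j) - secant j t) + w (j + 1) * (dx t (p t (j + 1)) - secant j t))) {p t j..p t (j + 1)}"
proof -
  define x y A B where "x = p t j" and "y = p t (j + 1)" and "A = w j * (dx t (p t j) - secant j t)"
    and "B = w (j + 1) * (dx t (p t (j + 1)) - secant j t)"
  have xy: "x < y" using p_mono[OF t j] by (simp add: x_def y_def)
  have id: "((\<lambda>s. s) has_integral (y\<^sup>2 - x\<^sup>2) / 2) {x..y}" using ident_has_integral[of x y] xy by simp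
  have c: "((\<lambda>s. c) has_integral (y - x) * c) {x..y}" for c
    using has_integral_const_real[of c x y] xy by simp
  have e: "(y - x) * y - (y\<^sup>2 - x\<^sup>2) / 2 = (y - x)\<^sup>2 / 2" "(y\<^sup>2 - x\<^sup>2) / 2 - (y - x) * x = (y - x)\<^sup>2 / 2"
    by (simp_all add: power2_eq_square left_diff_distrib right_diff_distrib diff_divide_distrib add_divide_distrib)
  have "((\<lambda>s. (y - s) * A + (s - x) * B) has_integral ((y - x)\<^sup>2 / 2 * A + (y - x)\<^sup>2 / 2 * B)) {x..y}"
    using has_integral_add[OF has_integral_mult_left[OF has_integral_diff[OF c[of y] id], where c = A]
        has_integral_mult_left[OF has_integral_diff[OF id c[of x]], where c = B]] unfolding e .
  from has_integral_mult_left[OF this, of "inverse (y - x)"]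
  have "((\<lambda>s. ((y - s) * A + (s - x) * B) / (y - x)) has_integral
      ((y - x)\<^sup>2 / 2 * A + (y - x)\<^sup>2 / 2 * B) / (y - x)) {x..y}" unfolding divide_inverse .
  moreover have "((y - x)\<^sup>2 / 2 * A + (y - x)\<^sup>2 / 2 * B) / (y - x) = (y - x) / 2 * (A + B)"
    using xy by (simp add: power2_eq_square divide_simps) (simp add: algebra_simps)
  moreover have "elt j t = (\<lambda>s. ((y - s) * A + (s - x) * B) / (y - x))"
    by (simp add: fun_eq_iff elt_def x_def y_def A_def B_def)
  ultimately have "(elt j t has_integral (y - x) / 2 * (A + B)) {x..y}" by (simp only:)
  then show ?thesis by (simp only: x_def y_def A_def B_def)
qed

text \<open>The key is \<open>w j * \<alpha> + w (j + 1) * \<beta> = w j * (\<alpha> + \<beta>) + (w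
  (j + 1) - w j) * \<beta>\<close>. The first summand contains the trapezoidal error, the second a
  velocity difference that \<open>V\<close> controls; each is of order one in the length, and the
  integral contributes a second factor.\<close>

lemma integral_elt_le:
  assumes t: "t \<in> S" and j: "j \<in> {1..<N}" and V: "\<bar>w (j + 1) - w j\<bar> \<le> V * (p t (j + 1) - p t j)"
  shows "\<bar>integral {p t j..p t (j + 1)} (elt j t)\<bar> \<le> h\<^sup>2 *
      (2 * W * integral {p t j..p t (j + 1)} (\<lambda>s. \<bar>weak_deriv \<Omega> 3 (\<phi> t) s\<bar>)
        + V * integral {p t j..p t (j + 1)} (\<lambda>s. \<bar>weak_deriv \<Omega> 2 (\<phi> t) s\<bar>))"
proof -
  define x y where "x = p t j" and "y = p t (j + 1)"
  have tt: "t \<in> {t0..t1}" using t by auto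
  have e: "a \<le> x" "x < y" "y \<le> b" "y - x \<le> h" using element_in[OF tt j] by (auto simp: x_def y_def)
  define R2 R3 where "R2 = integral {x..y} (\<lambda>s. \<bar>weak_deriv \<Omega> 2 (\<phi> t) s\<bar>)"
    and "R3 = integral {x..y} (\<lambda>s. \<bar>weak_deriv \<Omega> 3 (\<phi> t) s\<bar>)"
  define \<alpha> \<beta> where "\<alpha> = dx t x - secant j t" and "\<beta> = dx t y - secant j t"
  have v: "\<phi> t \<in> sobolev \<Omega> 3" by (rule sobolev_3[OF S_J[OF t]])
  have R3: "\<bar>\<alpha> + \<beta>\<bar> \<le> 3 * ((y - x) * R3)"
  proof -
    have "\<bar>dx t x + dx t y - 2 * secant j t\<bar> \<le> 3 * ((y - x) * R3)"
      using endpoint_tangents_minus_secant_le[OF v ab e(1-3)] e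
      unfolding dx_def secant_def R3_def x_def[symmetric] y_def[symmetric]
      by (simp add: crep_phi[OF S_J[OF t]])
    then show ?thesis by (simp add: \<alpha>_def \<beta>_def)
  qed
  have R2: "\<bar>\<beta>\<bar> \<le> R2"
    using dx_minus_secant_le[OF t j, of y] e by (simp add: \<beta>_def R2_def x_def y_def)
  then have R20: "0 \<le> R2" by linarith
  have "0 \<le> 3 * ((y - x) * R3)" using R3 by linarith
  then have R30: "0 \<le> R3" using e by (auto simp: zero_le_mult_iff)
  have "\<bar>w j * \<alpha> + w (j + 1) * \<beta>\<bar> = \<bar>w j * (\<alpha> + \<beta>) + (w (j + 1) - w j) * \<beta>\<bar>" by (simp add: algebra_simps)
  also have "\<dots> \<le> \<bar>w j\<bar> * \<bar>\<alpha> + \<beta>\<bar> + \<bar>w (j + 1) - w j\<bar> * \<bar>\<beta>\<bar>"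
    using abs_triangle_ineq[of "w j * (\<alpha> + \<beta>)" "(w (j + 1) - w j) * \<beta>"] unfolding abs_mult .
  also have "\<dots> \<le> W * (3 * ((y - x) * R3)) + V * (y - x) * R2"
    using W_nonneg w_le[of j] j R3 R2 V by (intro add_mono mult_mono) (auto simp: x_def y_def)
  also have "\<dots> = (y - x) * (3 * W * R3 + V * R2)" by (simp add: algebra_simps)
  finally have le: "\<bar>w j * \<alpha> + w (j + 1) * \<beta>\<bar> \<le> (y - x) * (3 * W * R3 + V * R2)" .
  have V0: "0 \<le> V"
  proof -
    have "0 \<le> V * (y - x)" using V by (auto simp: x_def y_def)
    then show ?thesis using e by (simp add: zero_le_mult_iff)
  qed
  have "integral {x..y} (elt j t) = (y - x) / 2 * (w j * \<alpha> + w (j + 1) * \<beta>)"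
    unfolding x_def y_def \<alpha>_def \<beta>_def by (rule integral_unique[OF integral_elt[OF tt j]])
  then have "\<bar>integral {x..y} (elt j t)\<bar> = \<bar>(y - x) / 2\<bar> * \<bar>w j * \<alpha> + w (j + 1) * \<beta>\<bar>"
    by (simp only: abs_mult)
  also have "\<bar>(y - x) / 2\<bar> = (y - x) / 2" using e by simp
  also have "(y - x) / 2 * \<bar>w j * \<alpha> + w (j + 1) * \<beta>\<bar> \<le> (y - x) / 2 * ((y - x) * (3 * W * R3 + V * R2))"
    using le e by (intro mult_left_mono) auto
  also have "\<dots> = (y - x)\<^sup>2 * ((3 * W * R3 + V * R2) / 2)" by (simp add: power2_eq_square)
  \<comment> \<open>The coefficients 3/2 and 1/2 are rounded up to 2 and 1.\<close>
  also have "\<dots> \<le> h\<^sup>2 * (2 * W * R3 + V * R2)"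
  proof (intro mult_mono power_mono)
    have "0 \<le> W * R3" "0 \<le> V * R2" using W_nonneg R30 V0 R20 by (auto intro: mult_nonneg_nonneg)
    moreover have "(3 * A + B) / 2 \<le> 2 * A + B \<and> 0 \<le> (3 * A + B) / 2" if "0 \<le> A" "0 \<le> B" for A B :: real
      using that by simp
    ultimately show "(3 * W * R3 + V * R2) / 2 \<le> 2 * W * R3 + V * R2" "0 \<le> (3 * W * R3 + V * R2) / 2"
      unfolding mult.assoc by blast+
  qed (use e in auto)
  finally show ?thesis by (simp add: x_def y_def R2_def R3_def)
qed

text \<open>The mean of the error over an element is of higher order; what remains is paired with the
  oscillation of the test function, which gains a power of \<open>h\<close>.\<close>

lemma err_pairing_le:
  assumes t: "t \<in> S" and V: "\<And>j. j \<in> {1..<N} \<Longrightarrow> \<bar>w (j + 1) - w j\<bar> \<le> V * (p t (j + 1) - p t j)"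
    and WV: "W \<le> r" "V \<le> r"
    and \<psi>: "\<psi> \<in> sobolev \<Omega> 1" "sobolev_norm \<Omega> 1 \<psi> \<le> 1"
    and H: "L2_norm \<Omega> (weak_deriv \<Omega> 2 (\<phi> t)) \<le> H" "L2_norm \<Omega> (weak_deriv \<Omega> 3 (\<phi> t)) \<le> H"
  shows "(\<integral>x. err t x * crep a b 0 \<psi> x \<partial>lebesgue_on \<Omega>) \<le> (3 * (emb * sqrt (b - a)) + 1) * r * h\<^sup>2 * H"
proof -
  let ?M = "lebesgue_on \<Omega>"
  have tt: "t \<in> {t0..t1}" using t by auto
  define \<Psi> where "\<Psi> = crep a b 0 \<psi>"
  define D2 D3 G where "D2 = weak_deriv \<Omega> 2 (\<phi> t)" and "D3 = weak_deriv \<Omega> 3 (\<phi> t)" and "G = weak_deriv \<Omega> 1 \<psi>"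
  have v: "\<phi> t \<in> sobolev \<Omega> 3" by (rule sobolev_3[OF S_J[OF t]])
  have L2: "D2 \<in> L2_space \<Omega>" "D3 \<in> L2_space \<Omega>" "G \<in> L2_space \<Omega>"
    unfolding D2_def D3_def G_def by (intro has_weak_deriv_weak_deriv(2)[OF v _ ab] has_weak_deriv_weak_deriv(2)[OF \<psi>(1) _ ab]; simp)+
  note L1 = L2[THEN L2_space_integrable]
  have sq: "integrable ?M (\<lambda>x. (D2 x)\<^sup>2)" "integrable ?M (\<lambda>x. (G x)\<^sup>2)"
    using L2 by (auto simp: L2_space_def)
  have \<Psi>c: "continuous_on {a..b} \<Psi>" unfolding \<Psi>_def by (rule crep_props(1)[OF \<psi>(1) _ ab]) simp
  have \<Psi>P: "primitive_on a b G \<Psi>" using crep_props(3)[OF \<psi>(1) _ ab, of 0] by (simp add: \<Psi>_def G_def One_nat_def)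
  have \<Psi>le: "\<bar>\<Psi> x\<bar> \<le> emb" if "x \<in> {a..b}" for x
  proof -
    have "\<bar>\<Psi> x\<bar> \<le> emb * sobolev_norm \<Omega> 1 \<psi>" unfolding \<Psi>_def by (rule crep_le_sobolev_norm[OF \<psi>(1) _ ab that]) simp
    also have "\<dots> \<le> emb * 1" using \<psi>(2) embed_const_nonneg[OF ab] by (rule mult_left_mono)
    finally show ?thesis by simp
  qed
  have emb0: "0 \<le> emb" by (rule embed_const_nonneg[OF ab])
  have r0: "0 \<le> r" using W_nonneg WV by linarith
  have H0: "0 \<le> H" using H(1) L2_norm_nonneg order_trans by blast
  let ?I = "\<lambda>j f. integral {p t j..p t (j + 1)} f"
  have ec: "continuous_on A (elt j t)" if "j \<in> {1..<N}" for j A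
    unfolding elt_def using element_in[OF tt that] by (intro continuous_intros) auto
  have eci: "integrable ?M (\<lambda>x. elt j t x * \<Psi> x)" if "j \<in> {1..<N}" for j
    by (intro continuous_on_integrable_lebesgue_on continuous_on_mult ec that \<Psi>c)
  have D3H: "(\<integral>s. \<bar>D3 s\<bar> \<partial>?M) \<le> sqrt (b - a) * H" and D2H: "(\<integral>s. \<bar>D2 s\<bar> \<partial>?M) \<le> sqrt (b - a) * H"
    using H ab unfolding D2_def[symmetric] D3_def[symmetric]
    by (auto intro!: order_trans[OF integral_abs_le_L2_norm] mult_left_mono L2)
  have sq0: "0 \<le> ?I j (\<lambda>s. (f s)\<^sup>2)" if "integrable ?M (\<lambda>s. (f s)\<^sup>2)" "j \<in> {1..<N}" for f :: "real \<Rightarrow> real" and j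
    using element_in[OF tt that(2)] that(1)
    by (intro Henstock_Kurzweil_Integration.integral_nonneg integrable_lebesgue_on_interval_imp_integrable_on[of a b]) auto
  \<comment> \<open>A discrete Cauchy-Schwarz inequality over the elements, which will assemble the
    products of local norms into a product of global ones; the test function contributes at most
    1.\<close>
  have "(\<Sum>j = 1..<N. sqrt (?I j (\<lambda>s. (D2 s)\<^sup>2)) * sqrt (?I j (\<lambda>s. (G s)\<^sup>2)))\<^sup>2
      \<le> (\<Sum>j = 1..<N. (sqrt (?I j (\<lambda>s. (D2 s)\<^sup>2)))\<^sup>2) * (\<Sum>j = 1..<N. (sqrt (?I j (\<lambda>s. (G s)\<^sup>2)))\<^sup>2)"
    by (rule Cauchy_Schwarz_ineq_sum)
  also have "\<dots> = (\<Sum>j = 1..<N. ?I j (\<lambda>s. (D2 s)\<^sup>2)) * (\<Sum>j = 1..<N. ?I j (\<lambda>s. (G s)\<^sup>2))"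
    using sq0[OF sq(1)] sq0[OF sq(2)] by simp
  also have "\<dots> = (L2_norm \<Omega> D2)\<^sup>2 * (L2_norm \<Omega> G)\<^sup>2"
    unfolding sum_elements[OF tt sq(1)] sum_elements[OF tt sq(2)] L2_norm_power2 ..
  also have "\<dots> \<le> H\<^sup>2 * 1\<^sup>2"
    using H(1) order_trans[OF L2_norm_le_sobolev_norm \<psi>(2), of 1]
    by (intro mult_mono power_mono) (auto simp: D2_def G_def L2_norm_nonneg)
  finally have "(\<Sum>j = 1..<N. sqrt (?I j (\<lambda>s. (D2 s)\<^sup>2)) * sqrt (?I j (\<lambda>s. (G s)\<^sup>2)))\<^sup>2 \<le> H\<^sup>2"
    by (simp only: power_one mult_1_right)
  then have S: "(\<Sum>j = 1..<N. sqrt (?I j (\<lambda>s. (D2 s)\<^sup>2)) * sqrt (?I j (\<lambda>s. (G s)\<^sup>2))) \<le> H"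
    using H0 by (rule power2_le_imp_le)
  have "(\<integral>x. err t x * \<Psi> x \<partial>?M) = (\<integral>x. (\<Sum>j = 1..<N. indicator {p t j<..<p t (j + 1)} x * (elt j t x * \<Psi> x)) \<partial>?M)"
    by (intro Bochner_Integration.integral_cong) (simp_all add: err_def sum_distrib_right mult.assoc)
  also have "\<dots> = (\<Sum>j = 1..<N. (\<integral>x. indicator {p t j<..<p t (j + 1)} x * (elt j t x * \<Psi> x) \<partial>?M))"
    by (intro Bochner_Integration.integral_sum integrable_times_indicator_interval eci) auto
  also have "\<dots> = (\<Sum>j = 1..<N. ?I j (\<lambda>x. elt j t x * \<Psi> x))"
    using element_in[OF tt] by (intro sum.cong refl integral_indicator_eq_integral eci) (auto intro: less_imp_le)
  also have "\<dots> \<le> (\<Sum>j = 1..<N. emb * (h\<^sup>2 * (2 * r * ?I j (\<lambda>s. \<bar>D3 s\<bar>) + r * ?I j (\<lambda>s. \<bar>D2 s\<bar>)))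
      + r * h\<^sup>2 * (sqrt (?I j (\<lambda>s. (D2 s)\<^sup>2)) * sqrt (?I j (\<lambda>s. (G s)\<^sup>2))))"
  proof (intro sum_mono)
    fix j assume j: "j \<in> {1..<N}"
    define x y where "x = p t j" and "y = p t (j + 1)"
    have e: "a \<le> x" "x < y" "y \<le> b" "y - x \<le> h" using element_in[OF tt j] by (auto simp: x_def y_def)
    have ge0: "0 \<le> integral {x..y} f" if "integrable ?M f" "\<And>s. 0 \<le> f s" for f :: "real \<Rightarrow> real"
      using e that by (intro Henstock_Kurzweil_Integration.integral_nonneg integrable_lebesgue_on_interval_imp_integrable_on[of a b]) auto
    define R2 Q where "R2 = integral {x..y} (\<lambda>s. \<bar>D2 s\<bar>)" and "Q = integral {x..y} (\<lambda>s. \<bar>G s\<bar>)"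
    have R2Q: "0 \<le> R2" "0 \<le> Q" unfolding R2_def Q_def using L1 by (auto intro!: ge0)
    have R3: "0 \<le> integral {x..y} (\<lambda>s. \<bar>D3 s\<bar>)" using L1 by (auto intro!: ge0)
    have q0: "0 \<le> integral {x..y} (\<lambda>s. (D2 s)\<^sup>2)" "0 \<le> integral {x..y} (\<lambda>s. (G s)\<^sup>2)"
      using sq by (auto intro!: ge0)
    have m: "\<bar>integral {x..y} (elt j t)\<bar> \<le> h\<^sup>2 * (2 * r * integral {x..y} (\<lambda>s. \<bar>D3 s\<bar>) + r * R2)"
    proof -
      have "\<bar>integral {x..y} (elt j t)\<bar> \<le> h\<^sup>2 * (2 * W * integral {x..y} (\<lambda>s. \<bar>D3 s\<bar>) + V * R2)"
        using integral_elt_le[OF t j V[OF j]] by (simp add: x_def y_def D2_def D3_def R2_def)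
      also have "\<dots> \<le> h\<^sup>2 * (2 * r * integral {x..y} (\<lambda>s. \<bar>D3 s\<bar>) + r * R2)"
        using WV R2Q R3 by (intro mult_left_mono add_mono mult_right_mono) auto
      finally show ?thesis .
    qed
    have ei: "elt j t integrable_on {x..y}" "(\<lambda>z. elt j t z * (\<Psi> z - \<Psi> x)) integrable_on {x..y}"
      using e by (auto intro!: integrable_continuous_real continuous_intros ec[OF j] continuous_on_subset[OF \<Psi>c])
    have osc: "\<bar>integral {x..y} (\<lambda>z. elt j t z * (\<Psi> z - \<Psi> x))\<bar> \<le> (W * R2) * Q * (y - x)"
    proof (rule has_integral_abs_le[OF integrable_integral[OF ei(2)]])
      fix z assume z: "z \<in> {x..y}"
      have "\<bar>\<Psi> z - \<Psi> x\<bar> \<le> integral {x..z} (\<lambda>s. \<bar>G s\<bar>)"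
        using z e by (intro primitive_on_abs_le[OF \<Psi>P L1(3)]) auto
      also have "\<dots> \<le> Q" unfolding Q_def
        using z e L1(3) by (intro integral_subinterval_le[of a b]) auto
      finally have "\<bar>\<Psi> z - \<Psi> x\<bar> \<le> Q" .
      moreover have "\<bar>elt j t z\<bar> \<le> W * R2" using elt_le[OF t j, of z] z by (simp add: x_def y_def R2_def D2_def)
      ultimately show "\<bar>elt j t z * (\<Psi> z - \<Psi> x)\<bar> \<le> (W * R2) * Q"
        unfolding abs_mult using W_nonneg R2Q by (intro mult_mono) auto
    qed (use e W_nonneg R2Q in auto)
    \<comment> \<open>Each of the two local Cauchy-Schwarz inequalities yields a square root of the
      length; their product and the length of the domain of integration make up the two powers of
      \<open>h\<close>.\<close>
    have "R2 * Q \<le> (y - x) * (sqrt (integral {x..y} (\<lambda>s. (D2 s)\<^sup>2)) * sqrt (integral {x..y} (\<lambda>s. (G s)\<^sup>2)))"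
    proof -
      have "R2 \<le> sqrt ((y - x) * integral {x..y} (\<lambda>s. (D2 s)\<^sup>2))" "Q \<le> sqrt ((y - x) * integral {x..y} (\<lambda>s. (G s)\<^sup>2))"
        unfolding R2_def Q_def using Cauchy_Schwarz_integral_interval[OF L2(1) e(1-3)]
          Cauchy_Schwarz_integral_interval[OF L2(3) e(1-3)] by (auto intro: real_le_rsqrt)
      then have "R2 * Q \<le> sqrt ((y - x) * integral {x..y} (\<lambda>s. (D2 s)\<^sup>2)) * sqrt ((y - x) * integral {x..y} (\<lambda>s. (G s)\<^sup>2))"
        using R2Q q0 e by (intro mult_mono real_sqrt_ge_zero mult_nonneg_nonneg) auto
      also have "\<dots> = (sqrt (y - x) * sqrt (y - x)) * (sqrt (integral {x..y} (\<lambda>s. (D2 s)\<^sup>2)) * sqrt (integral {x..y} (\<lambda>s. (G s)\<^sup>2)))"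
        by (simp add: real_sqrt_mult mult_ac)
      finally show ?thesis using e by simp
    qed
    then have "(W * R2) * Q * (y - x) \<le> W * ((y - x) * (sqrt (integral {x..y} (\<lambda>s. (D2 s)\<^sup>2)) * sqrt (integral {x..y} (\<lambda>s. (G s)\<^sup>2)))) * (y - x)"
      using W_nonneg e unfolding mult.assoc[of W R2] by (intro mult_right_mono mult_left_mono) auto
    also have "\<dots> = W * (y - x)\<^sup>2 * (sqrt (integral {x..y} (\<lambda>s. (D2 s)\<^sup>2)) * sqrt (integral {x..y} (\<lambda>s. (G s)\<^sup>2)))"
      by (simp add: power2_eq_square mult_ac)
    also have "\<dots> \<le> r * h\<^sup>2 * (sqrt (integral {x..y} (\<lambda>s. (D2 s)\<^sup>2)) * sqrt (integral {x..y} (\<lambda>s. (G s)\<^sup>2)))"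
    proof (intro mult_right_mono mult_mono power_mono)
      show "0 \<le> sqrt (integral {x..y} (\<lambda>s. (D2 s)\<^sup>2)) * sqrt (integral {x..y} (\<lambda>s. (G s)\<^sup>2))" using q0 by auto
    qed (use WV r0 e in auto)
    finally have o: "\<bar>integral {x..y} (\<lambda>z. elt j t z * (\<Psi> z - \<Psi> x))\<bar> \<le>
        r * h\<^sup>2 * (sqrt (integral {x..y} (\<lambda>s. (D2 s)\<^sup>2)) * sqrt (integral {x..y} (\<lambda>s. (G s)\<^sup>2)))"
      using osc by linarith
    \<comment> \<open>The value of the test function at the left node is split off. The constant
      part meets the mean of the error, the rest is the oscillation.\<close>
    have "integral {x..y} (\<lambda>z. elt j t z * \<Psi> z) = integral {x..y} (\<lambda>z. elt j t z * \<Psi> x + elt j t z * (\<Psi> z - \<Psi> x))"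
      by (simp add: algebra_simps)
    also have "\<dots> = integral {x..y} (elt j t) * \<Psi> x + integral {x..y} (\<lambda>z. elt j t z * (\<Psi> z - \<Psi> x))"
      (is "_ = ?A + ?B") using ei by (subst Henstock_Kurzweil_Integration.integral_add) (auto intro: integrable_on_mult_left)
    finally have AB: "integral {x..y} (\<lambda>z. elt j t z * \<Psi> z) = ?A + ?B" .
    have "?A \<le> \<bar>\<Psi> x\<bar> * \<bar>integral {x..y} (elt j t)\<bar>"
      by (metis abs_ge_self abs_mult mult.commute)
    also have "\<dots> \<le> emb * (h\<^sup>2 * (2 * r * integral {x..y} (\<lambda>s. \<bar>D3 s\<bar>) + r * R2))"
      using \<Psi>le[of x] m e emb0 by (intro mult_mono) auto
    finally have A: "?A \<le> emb * (h\<^sup>2 * (2 * r * integral {x..y} (\<lambda>s. \<bar>D3 s\<bar>) + r * R2))" .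
    have B: "?B \<le> r * h\<^sup>2 * (sqrt (integral {x..y} (\<lambda>s. (D2 s)\<^sup>2)) * sqrt (integral {x..y} (\<lambda>s. (G s)\<^sup>2)))"
      using o by (rule order_trans[OF abs_ge_self])
    show "?I j (\<lambda>x. elt j t x * \<Psi> x) \<le> emb * (h\<^sup>2 * (2 * r * ?I j (\<lambda>s. \<bar>D3 s\<bar>) + r * ?I j (\<lambda>s. \<bar>D2 s\<bar>)))
      + r * h\<^sup>2 * (sqrt (?I j (\<lambda>s. (D2 s)\<^sup>2)) * sqrt (?I j (\<lambda>s. (G s)\<^sup>2)))"
      using add_mono[OF A B] unfolding AB[symmetric] unfolding x_def y_def R2_def .
  qed
  also have "\<dots> = emb * (h\<^sup>2 * (2 * r * (\<integral>s. \<bar>D3 s\<bar> \<partial>?M) + r * (\<integral>s. \<bar>D2 s\<bar> \<partial>?M)))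
      + r * h\<^sup>2 * (\<Sum>j = 1..<N. sqrt (?I j (\<lambda>s. (D2 s)\<^sup>2)) * sqrt (?I j (\<lambda>s. (G s)\<^sup>2)))"
  proof -
    have "(\<Sum>j = 1..<N. ?I j (\<lambda>s. \<bar>D3 s\<bar>)) = (\<integral>s. \<bar>D3 s\<bar> \<partial>?M)" "(\<Sum>j = 1..<N. ?I j (\<lambda>s. \<bar>D2 s\<bar>)) = (\<integral>s. \<bar>D2 s\<bar> \<partial>?M)"
      using L1 by (intro sum_elements[OF tt]; auto)+
    then show ?thesis by (simp only: sum.distrib sum_distrib_left[symmetric])
  qed
  \<comment> \<open>The coefficient 3 is 2 from the third derivative plus 1 from the second; the
    separate 1 comes from the oscillation terms.\<close>
  also have "\<dots>
      \<le> emb * (h\<^sup>2 * (2 * r * (sqrt (b - a) * H) + r * (sqrt (b - a) * H))) + r * h\<^sup>2 * H"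
    by (intro add_mono mult_left_mono D3H D2H S) (use r0 emb0 in auto)
  also have "\<dots> = (3 * (emb * sqrt (b - a)) + 1) * r * h\<^sup>2 * H" by (simp add: algebra_simps)
  finally show ?thesis by (simp add: \<Psi>_def)
qed

text \<open>The square of the mean over the slab is at most the mean of the squares. After Fubini
  the bound at each time is integrated, and the factor 1/(t1 - t0) enters the norm under a square
  root.\<close>

lemma L2_norm_error_le:
  assumes E: "AE x in lebesgue_on \<Omega>. E x = (\<integral>t. err t x \<partial>lebesgue_on S) / (t1 - t0)"
    and \<phi>: "integrable (lebesgue_on S) (\<lambda>t. (sobolev_norm \<Omega> 2 (\<phi> t))\<^sup>2)"
  shows "L2_norm \<Omega> E \<le> W * h / sqrt (t1 - t0) * L2_sobolev_norm S \<Omega> 2 \<phi>"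
proof -
  let ?M = "lebesgue_on \<Omega>" and ?T = "lebesgue_on S"
  interpret S: finite_measure ?T by (rule finite_measure_lebesgue_on_interval)
  interpret X: finite_measure ?M by (rule finite_measure_lebesgue_on_interval)
  interpret P: pair_sigma_finite ?T ?M ..
  let ?F = "\<lambda>x. (\<integral>t. err t x \<partial>?T) / (t1 - t0)"
  have Fi: "integrable ?M ?F" using P.integrable_snd[of err] err_integrable(1) by simp
  have L: "0 < t1 - t0" using t01 by simp
  have sq: "integrable ?M (\<lambda>x. \<integral>t. (err t x)\<^sup>2 \<partial>?T)" using P.integrable_snd[OF err_integrable(2)] .
  have aeF: "AE x in ?M. (?F x)\<^sup>2 \<le> (\<integral>t. (err t x)\<^sup>2 \<partial>?T) / (t1 - t0)"
    using P.AE_integrable_snd[OF err_integrable(1)] P.AE_integrable_snd[OF err_integrable(2)]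
  proof eventually_elim
    case (elim x)
    have e: "(\<lambda>t. err t x) \<in> L2_space S" using elim by (auto simp: L2_space_def)
    have one: "(\<lambda>t. 1) \<in> L2_space S" by (rule L2_space_bounded[of _ _ _ 1]) auto
    have "(\<integral>t. err t x \<partial>?T) = L2_inner S (\<lambda>t. err t x) (\<lambda>t. 1)" by (simp add: L2_inner_def)
    then have "\<bar>\<integral>t. err t x \<partial>?T\<bar> \<le> L2_norm S (\<lambda>t. err t x) * L2_norm S (\<lambda>t. 1)"
      using Cauchy_Schwarz_L2[OF e one] by simp
    from power_mono[OF this abs_ge_zero, of 2]
    have "(\<integral>t. err t x \<partial>?T)\<^sup>2 \<le> (\<integral>t. (err t x)\<^sup>2 \<partial>?T) * (t1 - t0)"
      using L by (simp add: power_mult_distrib L2_norm_power2 measure_restrict_space)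
    then show ?case using L by (simp add: power_divide pos_divide_le_eq power2_eq_square divide_le_eq)
  qed
  have F2: "integrable ?M (\<lambda>x. (?F x)\<^sup>2)"
  proof (rule Bochner_Integration.integrable_bound[of _ "\<lambda>x. (\<integral>t. (err t x)\<^sup>2 \<partial>?T) / (t1 - t0)"])
    show "AE x in ?M. norm ((?F x)\<^sup>2) \<le> norm ((\<integral>t. (err t x)\<^sup>2 \<partial>?T) / (t1 - t0))"
      using aeF by eventually_elim (use L in simp)
    show "(\<lambda>x. (?F x)\<^sup>2) \<in> borel_measurable ?M" using Fi by (intro borel_measurable_power borel_measurable_integrable)
  qed (use sq in auto)
  have "L2_norm \<Omega> E = L2_norm \<Omega> ?F"
    by (rule L2_norm_cong_AE[symmetric]) (use E Fi in \<open>auto elim: eventually_mono\<close>)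
  then have "(L2_norm \<Omega> E)\<^sup>2 = (\<integral>x. (?F x)\<^sup>2 \<partial>?M)" by (simp only: L2_norm_power2)
  also have "\<dots> \<le> (\<integral>x. (\<integral>t. (err t x)\<^sup>2 \<partial>?T) / (t1 - t0) \<partial>?M)"
    using F2 sq aeF by (intro integral_mono_AE) auto
  also have "\<dots> = (\<integral>x. (\<integral>t. (err t x)\<^sup>2 \<partial>?T) \<partial>?M) / (t1 - t0)" by simp
  also have "(\<integral>x. (\<integral>t. (err t x)\<^sup>2 \<partial>?T) \<partial>?M) = (\<integral>t. (\<integral>x. (err t x)\<^sup>2 \<partial>?M) \<partial>?T)"
    using P.Fubini_integral[OF err_integrable(2)] .
  also have "\<dots> / (t1 - t0) \<le> (\<integral>t. (W * h)\<^sup>2 * (sobolev_norm \<Omega> 2 (\<phi> t))\<^sup>2 \<partial>?T) / (t1 - t0)"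
    using P.integrable_fst[OF err_integrable(2)] \<phi> err_square_integral_le L
    by (intro divide_right_mono integral_mono) (auto simp: power_mult_distrib)
  also have "\<dots> = (W * h / sqrt (t1 - t0) * L2_sobolev_norm S \<Omega> 2 \<phi>)\<^sup>2"
    using L by (simp add: L2_sobolev_norm_def power_mult_distrib power_divide)
  finally show ?thesis
    using L W_nonneg h_pos by (intro power2_le_imp_le[OF _ mult_nonneg_nonneg]) (auto simp: L2_sobolev_norm_def)
qed

text \<open>Fubini moves the pairing inside the time integral. Each time of the slab obeys the same
  bound, so the mean obeys it too and no power of the time step arises.\<close>

lemma H1_dual_norm_error_le:
  assumes E: "AE x in lebesgue_on \<Omega>. E x = (\<integral>t. err t x \<partial>lebesgue_on S) / (t1 - t0)"
    and V: "\<And>t j. t \<in> S \<Longrightarrow> j \<in> {1..<N} \<Longrightarrow> \<bar>w (j + 1) - w j\<bar> \<le> V * (p t (j + 1) - p t j)"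
    and WV: "W \<le> r" "V \<le> r"
    and H: "\<And>t k. t \<in> S \<Longrightarrow> k \<le> 3 \<Longrightarrow> L2_norm \<Omega> (weak_deriv \<Omega> k (\<phi> t)) \<le> H"
  shows "H1_dual_norm \<Omega> E \<le> (3 * (emb * sqrt (b - a)) + 1) * r * h\<^sup>2 * H"
  unfolding H1_dual_norm_def
proof (rule cSUP_least)
  let ?M = "lebesgue_on \<Omega>" and ?T = "lebesgue_on S" and ?c = "(3 * (emb * sqrt (b - a)) + 1) * r * h\<^sup>2 * H"
  interpret S: finite_measure ?T by (rule finite_measure_lebesgue_on_interval)
  interpret X: finite_measure ?M by (rule finite_measure_lebesgue_on_interval)
  interpret P: pair_sigma_finite ?T ?M ..
  have L: "0 < t1 - t0" using t01 by simp
  \<comment> \<open>The supremum has to run over a nonempty set. The zero function belongs to it,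
    although the weak derivative chosen for it is known to vanish almost everywhere only.\<close>
  have zero: "has_weak_deriv \<Omega> 1 (\<lambda>x. 0) (\<lambda>x. 0)"
    by (simp add: has_weak_deriv_def locally_integrable_def set_integrable_def)
  have "AE x in ?M. 0 = weak_deriv \<Omega> 1 (\<lambda>x. 0) x"
    using weak_deriv_eq_AE[OF zero _ ab] by (auto elim: eventually_mono)
  then have "L2_norm \<Omega> (\<lambda>x. 0) = L2_norm \<Omega> (weak_deriv \<Omega> 1 (\<lambda>x. 0))"
    by (rule L2_norm_cong_AE) auto
  then have "sobolev_norm \<Omega> 1 (\<lambda>x. 0) = 0"
    by (simp add: sobolev_norm_def weak_deriv_def[of _ 0] L2_norm_def L2_inner_def One_nat_def)
  moreover have "(\<lambda>x. 0) \<in> sobolev \<Omega> 1"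
    using zero by (auto simp: sobolev_def L2_space_def intro!: exI[of _ "\<lambda>x. 0"] bexI[of _ "\<lambda>x. 0"])
  ultimately show "{\<psi> \<in> sobolev \<Omega> 1. sobolev_norm \<Omega> 1 \<psi> \<le> 1} \<noteq> {}" by force
  fix \<psi> assume "\<psi> \<in> {\<psi> \<in> sobolev \<Omega> 1. sobolev_norm \<Omega> 1 \<psi> \<le> 1}"
  then have \<psi>: "\<psi> \<in> sobolev \<Omega> 1" "sobolev_norm \<Omega> 1 \<psi> \<le> 1" by auto
  let ?\<Psi> = "crep a b 0 \<psi>"
  have \<Psi>: "?\<Psi> \<in> borel_measurable ?M" using continuous_on_integrable_lebesgue_on(2)[OF crep_props(1)[OF \<psi>(1) _ ab]] by simp
  have \<psi>\<Psi>: "AE x in ?M. ?\<Psi> x = \<psi> x"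
    using crep_props(2)[OF \<psi>(1) _ ab, of 0] by (auto simp: weak_deriv_def elim: eventually_mono)
  have \<psi>m: "\<psi> \<in> borel_measurable ?M" by (rule borel_measurable_lebesgue_on_AE[OF \<Psi> \<psi>\<Psi>]) simp
  let ?F = "\<lambda>x. (\<integral>t. err t x \<partial>?T) / (t1 - t0)"
  have Fi: "integrable ?M ?F" using P.integrable_snd[of err] err_integrable(1) by simp
  have Em: "E \<in> borel_measurable ?M"
    by (rule borel_measurable_lebesgue_on_AE[of ?F]) (use E Fi in \<open>auto elim: eventually_mono\<close>)
  \<comment> \<open>The continuous representative of the test function is bounded, so the product
    inherits integrability from the error integrand.\<close>
  have int: "integrable (?T \<Otimes>\<^sub>M ?M) (\<lambda>(t, x). err t x * ?\<Psi> x)"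
  proof -
    have m: "(\<lambda>z. ?\<Psi> (snd z)) \<in> borel_measurable (?T \<Otimes>\<^sub>M ?M)" by (rule measurable_compose[OF measurable_snd \<Psi>])
    have "integrable (?T \<Otimes>\<^sub>M ?M) (\<lambda>z. (case z of (t, x) \<Rightarrow> err t x) * ?\<Psi> (snd z))"
    proof (rule integrable_times_bounded[OF err_integrable(1) m])
      fix z assume "z \<in> space (?T \<Otimes>\<^sub>M ?M)"
      then have "snd z \<in> {a..b}" by (auto simp: space_pair_measure)
      then show "\<bar>?\<Psi> (snd z)\<bar> \<le> emb * sobolev_norm \<Omega> 1 \<psi>" by (intro crep_le_sobolev_norm[OF \<psi>(1) _ ab]) simp_all
    qed
    then show ?thesis by (simp add: case_prod_beta')
  qed
  have "L2_inner \<Omega> E \<psi> = (\<integral>x. (\<integral>t. err t x * ?\<Psi> x \<partial>?T) / (t1 - t0) \<partial>?M)"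
    unfolding L2_inner_def
  proof (rule integral_cong_AE)
    show "AE x in ?M. E x * \<psi> x = (\<integral>t. err t x * ?\<Psi> x \<partial>?T) / (t1 - t0)"
      using E \<psi>\<Psi> P.AE_integrable_snd[OF err_integrable(1)] by eventually_elim simp
    show "(\<lambda>x. (\<integral>t. err t x * ?\<Psi> x \<partial>?T) / (t1 - t0)) \<in> borel_measurable ?M"
      using P.integrable_snd[OF int] by auto
  qed (use Em \<psi>m in auto)
  also have "\<dots> = (\<integral>t. (\<integral>x. err t x * ?\<Psi> x \<partial>?M) \<partial>?T) / (t1 - t0)"
    using P.Fubini_integral[OF int] by simp
  also have "\<dots> \<le> (\<integral>t. ?c \<partial>?T) / (t1 - t0)"
  proof (intro divide_right_mono integral_mono)
    fix t assume "t \<in> space ?T"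
    then have t: "t \<in> S" by simp
    show "(\<integral>x. err t x * ?\<Psi> x \<partial>?M) \<le> ?c"
      by (rule err_pairing_le[OF t V[OF t] WV \<psi> H[OF t] H[OF t]]) simp_all
  qed (use P.integrable_fst[OF int] L in auto)
  also have "\<dots> = ?c" using L by (simp add: measure_restrict_space)
  finally show "L2_inner \<Omega> E \<psi> \<le> ?c" .
qed

end

section \<open>Norms of the mesh velocity\<close>

text \<open>\<open>Linf_norm\<close> converts an extended real number and is meaningful only for a
  finite one. The bound \<open>M\<close> excludes plus infinity, and the positive measure of the
  interval makes the essential supremum nonnegative.\<close>

lemma Linf_norm_bounds:
  assumes f: "f \<in> borel_measurable (lebesgue_on {a<..<b})" and M: "AE x in lebesgue_on {a<..<b}. \<bar>f x\<bar> \<le> M"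
    and ab: "a < b"
  shows "AE x in lebesgue_on {a<..<b}. \<bar>f x\<bar> \<le> Linf_norm {a<..<b} f" "Linf_norm {a<..<b} f \<le> M"
proof -
  let ?M = "lebesgue_on {a<..<b}"
  define e where "e = esssup ?M (\<lambda>x. ereal \<bar>f x\<bar>)"
  have "e \<le> ereal M"
    unfolding e_def by (rule esssup_I) (use f M in auto)
  moreover have AE: "AE x in ?M. ereal \<bar>f x\<bar> \<le> e" unfolding e_def by (rule esssup_AE)
  have "0 \<le> e"
  proof (rule ccontr)
    assume "\<not> 0 \<le> e"
    from AE have "AE x in ?M. False"
    proof eventually_elim
      case (elim x)
      then have "ereal 0 \<le> e" by (rule order_trans[rotated]) simp
      then show ?case using \<open>\<not> 0 \<le> e\<close> by (simp add: zero_ereal_def)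
    qed
    then have "emeasure ?M {a<..<b} = 0"
      by (subst (asm) AE_iff_measurable[of "{a<..<b}"]) auto
    then show False using ab by (simp add: emeasure_restrict_space)
  qed
  ultimately obtain r where r: "e = ereal r" by (cases e) auto
  then have L: "Linf_norm {a<..<b} f = r" by (simp add: Linf_norm_def e_def[symmetric])
  show "AE x in ?M. \<bar>f x\<bar> \<le> Linf_norm {a<..<b} f" using AE by (simp add: r L)
  show "Linf_norm {a<..<b} f \<le> M" using \<open>e \<le> ereal M\<close> by (simp add: r L)
qed

text \<open>Uniqueness of continuous representatives, applied to the positive part of
  \<open>\<bar>u x\<bar> - L\<close>.\<close>

lemma continuous_AE_le_imp_le:
  fixes u :: "real \<Rightarrow> real"
  assumes u: "continuous_on {a..b} u" and ab: "a < b"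
    and le: "AE x in lebesgue_on {a<..<b}. \<bar>u x\<bar> \<le> L" and x: "x \<in> {a..b}"
  shows "\<bar>u x\<bar> \<le> L"
proof -
  have "max 0 (\<bar>u x\<bar> - L) = 0"
  proof (rule continuous_AE_eq_imp_eq[OF _ _ ab _ x])
    show "AE x in lebesgue_on {a<..<b}. max 0 (\<bar>u x\<bar> - L) = 0" using le by eventually_elim simp
  qed (use u in \<open>auto intro!: continuous_intros\<close>)
  then show ?thesis by (simp add: max_def split: if_splits)
qed

lemma AE_lebesgue_on_subset:
  assumes "AE x in lebesgue_on A. P x" "B \<subseteq> A" "A \<in> sets lebesgue" "B \<in> sets lebesgue"
  shows "AE x in lebesgue_on B. P x"
proof -
  have "AE x in lebesgue. x \<in> A \<longrightarrow> P x" using assms(1,3) by (simp add: AE_restrict_space_iff)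
  then have "AE x in lebesgue. x \<in> B \<longrightarrow> P x" by eventually_elim (use assms(2) in blast)
  then show ?thesis using assms(4) by (simp add: AE_restrict_space_iff)
qed

lemma integrable_lebesgue_on_subset:
  fixes f :: "real \<Rightarrow> real"
  assumes "integrable (lebesgue_on A) f" "B \<subseteq> A" "A \<in> sets lebesgue" "B \<in> sets lebesgue"
  shows "integrable (lebesgue_on B) f"
proof -
  have "set_integrable lebesgue A f" using assms(1,3) by (simp add: set_integrable_def integrable_restrict_space)
  then have "set_integrable lebesgue B f" by (rule set_integrable_subset) (use assms in auto)
  then show ?thesis using assms(4) by (simp add: set_integrable_def integrable_restrict_space)
qed

text \<open>The mesh velocity at a frozen time, as a piecewise affine function with nodal values
  \<open>c\<close>. Its norms have to yield bounds on the nodal values and on their differences,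
  which is all that a slab asks for.\<close>

locale nodal_function =
  fixes a b :: real and N :: nat and x :: "nat \<Rightarrow> real" and c :: "nat \<Rightarrow> real"
  assumes N: "2 \<le> N" and ends: "x 1 = a" "x N = b" and mono: "\<And>i. i \<in> {1..<N} \<Longrightarrow> x i < x (i + 1)"
begin

definition u :: "real \<Rightarrow> real" where "u z = (\<Sum>i = 1..N. c i * hat N x i z)"
definition slope :: "nat \<Rightarrow> real" where "slope j = (c (j + 1) - c j) / (x (j + 1) - x j)"
definition g :: "real \<Rightarrow> real" where "g z = (\<Sum>j = 1..<N. indicator {x j<..<x (j + 1)} z * slope j)"

lemma x_less: "1 \<le> i \<Longrightarrow> i < j \<Longrightarrow> j \<le> N \<Longrightarrow> x i < x j"
  by (rule nodes_mono[of N x]) (auto intro: mono)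

lemma ab: "a < b" using x_less[of 1 N] N ends by auto

lemma x_in: "i \<in> {1..N} \<Longrightarrow> x i \<in> {a..b}"
  using x_less[of 1 i] x_less[of i N] ends by (cases "i = 1"; cases "i = N") (auto intro: less_imp_le)

lemma u_node: "i \<in> {1..N} \<Longrightarrow> u (x i) = c i"
proof -
  assume i: "i \<in> {1..N}"
  have "u (x i) = (\<Sum>k = 1..N. if k = i then c k else 0)"
    unfolding u_def using hat_node[where p = x, OF mono N _ i] by (intro sum.cong) auto
  then show ?thesis using i by simp
qed

lemma u_continuous: "continuous_on {a..b} u"
proof -
  have "continuous_on {a..b} (hat N x i)" if i: "i \<in> {1..N}" for i
  proof -
    let ?m = "\<lambda>z. max 0 (min (if 1 < i then (z - x (i - 1)) / (x i - x (i - 1)) else 1)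
      (if i < N then (x (i + 1) - z) / (x (i + 1) - x i) else 1))"
    have l: "x i - x (i - 1) \<noteq> 0" if "1 < i"
    proof -
      have "1 \<le> i - 1" using that by linarith
      then show ?thesis using x_less[of "i - 1" i] that i by auto
    qed
    have r: "x (i + 1) - x i \<noteq> 0" if "i < N" using x_less[of i "i + 1"] that i by auto
    have "continuous_on {a..b} ?m"
      using l r by (cases "1 < i"; cases "i < N") (auto intro!: continuous_intros)
    moreover have "?m z = hat N x i z" if "z \<in> {a..b}" for z
      using that by (intro hat_eq_max_min[where p = x, symmetric] mono i N) (auto simp: ends)
    ultimately show ?thesis by (metis (no_types, lifting) continuous_on_cong)
  qed
  then show ?thesis unfolding u_def by (intro continuous_intros) auto
qed

lemma g_eq_slope:
  assumes j: "j \<in> {1..<N}" and z: "x j < z" "z < x (j + 1)"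
  shows "g z = slope j"
proof -
  have "g z = (\<Sum>k = 1..<N. if k = j then slope k else 0)"
    unfolding g_def
  proof (intro sum.cong refl)
    fix k assume k: "k \<in> {1..<N}"
    have "z \<in> {x k<..<x (k + 1)} \<longleftrightarrow> k = j"
    proof
      assume zk: "z \<in> {x k<..<x (k + 1)}"
      have "\<not> k + 1 \<le> j" using x_less[of "k + 1" j] zk z j k by (cases "k + 1 = j") auto
      moreover have "\<not> j + 1 \<le> k" using x_less[of "j + 1" k] zk z j k by (cases "j + 1 = k") auto
      ultimately show "k = j" by linarith
    qed (use z in auto)
    then show "indicator {x k<..<x (k + 1)} z * slope k = (if k = j then slope k else 0)"
      by (auto simp only: indicator_simps if_True if_False mult_1 mult_zero_left split: if_splits)
  qed
  then show ?thesis using j by simp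
qed

lemma ex_element_of:
  assumes "z \<in> {a..b}" "z \<notin> x ` {1..N}"
  obtains j where "j \<in> {1..<N}" "x j < z" "z < x (j + 1)"
proof -
  have ne: "z \<noteq> x i" if "i \<in> {1..N}" for i using assms(2) that by blast
  have "z \<noteq> x 1" "z \<noteq> x N" using N by (intro ne; simp)+
  then have "x 1 < z" "z < x N" using assms(1) ends by auto
  then show ?thesis using ex_element[of N x z] ne N that by auto
qed

lemma u_deriv:
  assumes j: "j \<in> {1..<N}" and z: "x j < z" "z < x (j + 1)"
  shows "(u has_real_derivative g z) (at z)"
proof -
  let ?L = "x (j + 1) - x j"
  have "((\<lambda>z. ((x (j + 1) - z) * c j + (z - x j) * c (j + 1)) / ?L) has_real_derivative
      ((0 - 1) * c j + (1 - 0) * c (j + 1)) / ?L) (at z)"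
    by (intro DERIV_cdivide DERIV_add DERIV_cmult_right DERIV_diff DERIV_const DERIV_ident)
  then have "((\<lambda>z. ((x (j + 1) - z) * c j + (z - x j) * c (j + 1)) / ?L) has_real_derivative g z) (at z)"
    by (simp add: g_eq_slope[OF j z] slope_def)
  then show ?thesis
  proof (rule has_field_derivative_transform_within_open[of _ _ _ "{x j<..<x (j + 1)}"])
    fix y assume "y \<in> {x j<..<x (j + 1)}"
    then show "((x (j + 1) - y) * c j + (y - x j) * c (j + 1)) / ?L = u y"
      unfolding u_def by (intro sum_hat_element[where p = x, symmetric] mono N j) auto
  qed (use z in auto)
qed

lemma g_integrable: "integrable (lebesgue_on {a<..<b}) g"
  unfolding g_def
  by (intro Bochner_Integration.integrable_sum integrable_times_indicator_interval)
     (simp_all add: finite_measure.integrable_const finite_measure_lebesgue_on_interval)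

lemma u_primitive: "primitive_on a b g u"
  unfolding primitive_on_def
proof (intro allI impI)
  fix p q assume pq: "a \<le> p" "p \<le> q" "q \<le> b"
  show "(g has_integral (u q - u p)) {p..q}"
  proof (rule fundamental_theorem_of_calculus_interior_strong[of "x ` {1..N}"])
    show "continuous_on {p..q} u" using u_continuous pq by (auto intro: continuous_on_subset)
    fix z assume z: "z \<in> {p<..<q} - x ` {1..N}"
    then obtain j where "j \<in> {1..<N}" "x j < z" "z < x (j + 1)"
      using ex_element_of[of z] pq by auto
    then show "(u has_vector_derivative g z) (at z)"
      using u_deriv by (simp add: has_real_derivative_iff_has_vector_derivative)
  qed (use pq in auto)
qed

lemma weak_deriv_u: "AE z in lebesgue_on {a<..<b}. weak_deriv {a<..<b} 1 u z = g z"
  by (rule weak_deriv_eq_AE[OF has_weak_deriv_primitive[OF g_integrable ab u_primitive u_continuous] _ ab]) simp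

lemma u_le:
  assumes M: "\<And>i. i \<in> {1..N} \<Longrightarrow> \<bar>c i\<bar> \<le> M" and z: "z \<in> {a<..<b}"
  shows "\<bar>u z\<bar> \<le> M"
proof (cases "z \<in> x ` {1..N}")
  case True
  then show ?thesis using u_node M by auto
next
  case False
  then obtain j where j: "j \<in> {1..<N}" "x j < z" "z < x (j + 1)"
    using ex_element_of[of z] z by auto
  let ?L = "x (j + 1) - x j"
  have c: "\<bar>c j\<bar> \<le> M" "\<bar>c (j + 1)\<bar> \<le> M" using M j(1) by auto
  have "\<bar>(x (j + 1) - z) * c j + (z - x j) * c (j + 1)\<bar> \<le> (x (j + 1) - z) * \<bar>c j\<bar> + (z - x j) * \<bar>c (j + 1)\<bar>"
    using j by (intro order_trans[OF abs_triangle_ineq]) (auto simp: abs_mult)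
  also have "\<dots> \<le> (x (j + 1) - z) * M + (z - x j) * M"
    using c j by (intro add_mono mult_left_mono) auto
  also have "\<dots> = M * ?L" by (simp add: algebra_simps)
  finally have "\<bar>(x (j + 1) - z) * c j + (z - x j) * c (j + 1)\<bar> / ?L \<le> M"
    using j by (simp add: pos_divide_le_eq)
  moreover have "u z = ((x (j + 1) - z) * c j + (z - x j) * c (j + 1)) / ?L"
    unfolding u_def using j by (intro sum_hat_element[where p = x] mono N) auto
  ultimately show ?thesis using j by (simp add: abs_divide)
qed

lemma Linf_norm_u:
  assumes M: "\<And>i. i \<in> {1..N} \<Longrightarrow> \<bar>c i\<bar> \<le> M"
  shows "Linf_norm {a<..<b} u \<le> M" "i \<in> {1..N} \<Longrightarrow> \<bar>c i\<bar> \<le> Linf_norm {a<..<b} u"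
proof -
  have ae: "AE z in lebesgue_on {a<..<b}. \<bar>u z\<bar> \<le> M" using u_le[OF M] by (intro AE_I2) auto
  note L = Linf_norm_bounds[OF continuous_on_integrable_lebesgue_on(2)[OF u_continuous] ae ab]
  show "Linf_norm {a<..<b} u \<le> M" by (rule L(2))
  assume i: "i \<in> {1..N}"
  have "\<bar>u (x i)\<bar> \<le> Linf_norm {a<..<b} u" by (rule continuous_AE_le_imp_le[OF u_continuous ab L(1) x_in[OF i]])
  then show "\<bar>c i\<bar> \<le> Linf_norm {a<..<b} u" by (simp add: u_node[OF i])
qed

text \<open>The factor \<open>real N\<close> comes from summing over the elements; the first bound
  merely certifies finiteness. The second carries no such factor: \<open>g\<close> is constant on an
  element, so a bound almost everywhere on that set of positive measure bounds the slope
  itself.\<close>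

lemma Linf_norm_weak_deriv_u:
  assumes K: "\<And>j. j \<in> {1..<N} \<Longrightarrow> \<bar>slope j\<bar> \<le> K"
  shows "Linf_norm {a<..<b} (weak_deriv {a<..<b} 1 u) \<le> K * real N"
    "j \<in> {1..<N} \<Longrightarrow> \<bar>c (j + 1) - c j\<bar> \<le> Linf_norm {a<..<b} (weak_deriv {a<..<b} 1 u) * (x (j + 1) - x j)"
proof -
  let ?M = "lebesgue_on {a<..<b}" and ?D = "weak_deriv {a<..<b} 1 u"
  have K0: "0 \<le> K" using K[of 1] N by auto
  have "\<bar>g z\<bar> \<le> K * real N" for z
  proof -
    have "\<bar>g z\<bar> \<le> (\<Sum>j = 1..<N. K)"
      unfolding g_def using K K0 by (intro order_trans[OF sum_abs] sum_mono) (auto simp: indicator_def)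
    also have "\<dots> = K * real (N - 1)" by simp
    also have "\<dots> \<le> K * real N" using K0 by (intro mult_left_mono) auto
    finally show ?thesis .
  qed
  then have ae: "AE z in ?M. \<bar>?D z\<bar> \<le> K * real N"
    using weak_deriv_u by (auto elim: eventually_mono)
  have D: "?D \<in> borel_measurable ?M"
    by (rule borel_measurable_lebesgue_on_AE[OF borel_measurable_integrable[OF g_integrable]])
       (use weak_deriv_u in \<open>auto elim: eventually_mono\<close>)
  note L = Linf_norm_bounds[OF D ae ab]
  show "Linf_norm {a<..<b} ?D \<le> K * real N" by (rule L(2))
  assume j: "j \<in> {1..<N}"
  have xj: "x j \<in> {a..b}" "x (j + 1) \<in> {a..b}" using x_in[of j] x_in[of "j + 1"] j by auto
  have "AE z in ?M. \<bar>g z\<bar> \<le> Linf_norm {a<..<b} ?D"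
    using L(1) weak_deriv_u by eventually_elim simp
  then have "AE z in lebesgue_on {x j<..<x (j + 1)}. \<bar>g z\<bar> \<le> Linf_norm {a<..<b} ?D"
    by (rule AE_lebesgue_on_subset) (use xj in auto)
  then have ae: "AE z in lebesgue_on {x j<..<x (j + 1)}. \<bar>slope j\<bar> \<le> Linf_norm {a<..<b} ?D"
    using AE_space by eventually_elim (use g_eq_slope[OF j] in simp)
  have "\<bar>slope j\<bar> \<le> Linf_norm {a<..<b} ?D"
    by (rule continuous_AE_le_imp_le[OF _ mono[OF j] ae, of "x j"]) (use mono[OF j] in auto)
  then show "\<bar>c (j + 1) - c j\<bar> \<le> Linf_norm {a<..<b} ?D * (x (j + 1) - x j)"
    using mono[OF j] by (simp add: slope_def abs_divide pos_divide_le_eq)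
qed

end

subsection \<open>The moving mesh\<close>

locale moving_mesh_steps =
  fixes a b T \<Delta>t :: real and Np :: nat and P :: "nat \<Rightarrow> nat \<Rightarrow> real"
  assumes \<Delta>t: "0 < \<Delta>t" and T: "0 < T" and mesh: "moving_mesh a b (num_steps T \<Delta>t) Np P"
begin

abbreviation "NT \<equiv> num_steps T \<Delta>t"

lemma Np: "2 \<le> Np"
  and P_ends: "n \<le> NT \<Longrightarrow> P n 1 = a" "n \<le> NT \<Longrightarrow> P n Np = b"
  and P_mono: "n \<le> NT \<Longrightarrow> i \<in> {1..<Np} \<Longrightarrow> P n i < P n (i + 1)"
  using mesh by (auto simp: moving_mesh_def)

text \<open>Inside a slab the mesh is a convex combination of the meshes at the two ends. Hence the
  order of the nodes, the upper bound \<open>h\<close> and a positive lower bound on the lengths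
  persist in between.\<close>

lemma node_path_convex:
  assumes n: "n \<in> {1..NT}" and t: "t \<in> time_slab \<Delta>t n"
  obtains \<theta> where "0 \<le> \<theta>" "\<theta> \<le> 1" "\<And>i. node_path \<Delta>t P n t i = (1 - \<theta>) * P (n - 1) i + \<theta> * P n i"
proof -
  define \<theta> where "\<theta> = (t - real (n - 1) * \<Delta>t) / \<Delta>t"
  have "real n * \<Delta>t = real (n - 1) * \<Delta>t + \<Delta>t" using n by (simp add: of_nat_diff algebra_simps)
  then have "0 \<le> \<theta>" "\<theta> \<le> 1" using t \<Delta>t by (auto simp: \<theta>_def time_slab_def divide_le_eq)
  moreover have "node_path \<Delta>t P n t i = (1 - \<theta>) * P (n - 1) i + \<theta> * P n i" for i
    using \<Delta>t by (simp add: node_path_def node_velocity_def \<theta>_def field_simps)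
  ultimately show ?thesis by (rule that)
qed

lemma node_path_ends:
  assumes "n \<in> {1..NT}" "t \<in> time_slab \<Delta>t n"
  shows "node_path \<Delta>t P n t 1 = a" "node_path \<Delta>t P n t Np = b"
proof -
  obtain \<theta> where "\<And>i. node_path \<Delta>t P n t i = (1 - \<theta>) * P (n - 1) i + \<theta> * P n i"
    using node_path_convex[OF assms] by blast
  then show "node_path \<Delta>t P n t 1 = a" "node_path \<Delta>t P n t Np = b"
    using P_ends[of n] P_ends[of "n - 1"] assms(1) by (auto simp: left_diff_distrib)
qed

lemma node_path_diff_bounds:
  assumes n: "n \<in> {1..NT}" and t: "t \<in> time_slab \<Delta>t n" and i: "i \<in> {1..<Np}"
  shows "min (P (n - 1) (i + 1) - P (n - 1) i) (P n (i + 1) - P n i) \<le> node_path \<Delta>t P n t (i + 1) - node_path \<Delta>t P n t i"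
    "node_path \<Delta>t P n t (i + 1) - node_path \<Delta>t P n t i \<le> mesh_size NT Np P"
proof -
  obtain \<theta> where \<theta>: "0 \<le> \<theta>" "\<theta> \<le> 1" and p: "\<And>i. node_path \<Delta>t P n t i = (1 - \<theta>) * P (n - 1) i + \<theta> * P n i"
    using node_path_convex[OF n t] by blast
  let ?A = "P (n - 1) (i + 1) - P (n - 1) i" and ?B = "P n (i + 1) - P n i"
  have d: "node_path \<Delta>t P n t (i + 1) - node_path \<Delta>t P n t i = (1 - \<theta>) * ?A + \<theta> * ?B"
    by (simp add: p algebra_simps)
  have "(1 - \<theta>) * min ?A ?B + \<theta> * min ?A ?B \<le> (1 - \<theta>) * ?A + \<theta> * ?B"
    using \<theta> by (intro add_mono mult_left_mono) auto
  then show "min ?A ?B \<le> node_path \<Delta>t P n t (i + 1) - node_path \<Delta>t P n t i"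
    unfolding d by (simp add: algebra_simps)
  have h: "P k (i + 1) - P k i \<le> mesh_size NT Np P" if k: "k \<le> NT" for k
  proof -
    have "P k (i + 1) - P k i \<le> (MAX i\<in>{1..<Np}. P k (i + 1) - P k i)"
      using i by (intro Max_ge) auto
    also have "\<dots> \<le> mesh_size NT Np P"
      unfolding mesh_size_def using k by (intro Max_ge) auto
    finally show ?thesis .
  qed
  have "(1 - \<theta>) * ?A + \<theta> * ?B \<le> (1 - \<theta>) * mesh_size NT Np P + \<theta> * mesh_size NT Np P"
    using \<theta> n h[of n] h[of "n - 1"] by (intro add_mono mult_left_mono) auto
  then show "node_path \<Delta>t P n t (i + 1) - node_path \<Delta>t P n t i \<le> mesh_size NT Np P"
    unfolding d by (simp add: algebra_simps)
qed

lemma nodal_function: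
  assumes n: "n \<in> {1..NT}" and t: "t \<in> time_slab \<Delta>t n"
  shows "nodal_function a b Np (node_path \<Delta>t P n t)"
proof
  fix i assume i: "i \<in> {1..<Np}"
  have "0 < min (P (n - 1) (i + 1) - P (n - 1) i) (P n (i + 1) - P n i)"
    using P_mono[of n i] P_mono[of "n - 1" i] n i by auto
  then show "node_path \<Delta>t P n t i < node_path \<Delta>t P n t (i + 1)"
    using node_path_diff_bounds(1)[OF n t i] by linarith
qed (use Np node_path_ends[OF n t] in auto)

lemma mesh_velocity_eq_u:
  "n \<in> {1..NT} \<Longrightarrow> t \<in> time_slab \<Delta>t n \<Longrightarrow>
    mesh_velocity \<Delta>t Np P n t = nodal_function.u Np (node_path \<Delta>t P n t) (node_velocity \<Delta>t P n)"
  by (simp add: fun_eq_iff mesh_velocity_def nodal_function.u_def[OF nodal_function])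

text \<open>\<open>vmax\<close> and \<open>rmax\<close> depend on the whole mesh and enter no
  constant of the estimates. They show that the set in \<open>C0_slab_norm\<close> is bounded above,
  without which its \<open>Sup\<close> would not be an upper bound.\<close>

definition vmax :: real where
  "vmax = (\<Sum>n\<in>{1..NT}. \<Sum>i\<in>{1..Np}. \<bar>node_velocity \<Delta>t P n i\<bar>)"

definition rmax :: real where
  "rmax = (\<Sum>n\<in>{0..NT}. \<Sum>i\<in>{1..<Np}. 1 / (P n (i + 1) - P n i))"

lemma node_velocity_le_vmax:
  assumes "n \<in> {1..NT}" "i \<in> {1..Np}"
  shows "\<bar>node_velocity \<Delta>t P n i\<bar> \<le> vmax"
proof -
  have "\<bar>node_velocity \<Delta>t P n i\<bar> \<le> (\<Sum>i\<in>{1..Np}. \<bar>node_velocity \<Delta>t P n i\<bar>)"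
    using assms by (intro member_le_sum) auto
  also have "\<dots> \<le> vmax"
    unfolding vmax_def using assms
    by (intro member_le_sum[where f = "\<lambda>n. \<Sum>i\<in>{1..Np}. \<bar>node_velocity \<Delta>t P n i\<bar>"]) (auto intro: sum_nonneg)
  finally show ?thesis .
qed

lemma inverse_element_le_rmax:
  assumes "n \<le> NT" "i \<in> {1..<Np}"
  shows "1 / (P n (i + 1) - P n i) \<le> rmax"
proof -
  have 0: "0 \<le> 1 / (P n (i + 1) - P n i)" if "n \<le> NT" "i \<in> {1..<Np}" for n i
    using P_mono[OF that] by simp
  have "1 / (P n (i + 1) - P n i) \<le> (\<Sum>i\<in>{1..<Np}. 1 / (P n (i + 1) - P n i))"
    using assms 0[OF assms(1)] by (intro member_le_sum[where f = "\<lambda>i. 1 / (P n (i + 1) - P n i)"]) auto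
  also have "\<dots> \<le> rmax"
    unfolding rmax_def using assms 0
    by (intro member_le_sum[where f = "\<lambda>n. \<Sum>i\<in>{1..<Np}. 1 / (P n (i + 1) - P n i)"]) (auto intro!: sum_nonneg)
  finally show ?thesis .
qed

lemma slope_le:
  assumes n: "n \<in> {1..NT}" and t: "t \<in> time_slab \<Delta>t n" and j: "j \<in> {1..<Np}"
  shows "\<bar>nodal_function.slope (node_path \<Delta>t P n t) (node_velocity \<Delta>t P n) j\<bar> \<le> 2 * vmax * rmax"
proof -
  let ?L = "node_path \<Delta>t P n t (j + 1) - node_path \<Delta>t P n t j"
  interpret nodal_function a b Np "node_path \<Delta>t P n t" "node_velocity \<Delta>t P n" by (rule nodal_function[OF n t])
  have L: "0 < ?L" using mono[OF j] by simp
  have "1 / ?L \<le> rmax"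
  proof -
    have "k \<le> NT \<Longrightarrow> 0 < P k (j + 1) - P k j" for k using P_mono[of k j] j by simp
    then have pos: "0 < P n (j + 1) - P n j" "0 < P (n - 1) (j + 1) - P (n - 1) j" using n by auto
    have "P n (j + 1) - P n j \<le> ?L \<or> P (n - 1) (j + 1) - P (n - 1) j \<le> ?L"
      using node_path_diff_bounds(1)[OF n t j] by (auto simp: min_def split: if_splits)
    then show ?thesis
      using inverse_element_le_rmax[of n j] inverse_element_le_rmax[of "n - 1" j] n j pos
      by (auto intro: order_trans[OF divide_left_mono[OF _ _ mult_pos_pos]])
  qed
  moreover have "\<bar>node_velocity \<Delta>t P n (j + 1) - node_velocity \<Delta>t P n j\<bar> \<le> 2 * vmax"
    using node_velocity_le_vmax[OF n, of j] node_velocity_le_vmax[OF n, of "j + 1"] j by auto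
  ultimately have "\<bar>node_velocity \<Delta>t P n (j + 1) - node_velocity \<Delta>t P n j\<bar> * (1 / ?L) \<le> 2 * vmax * rmax"
    using L by (intro mult_mono) (auto intro: order_trans[OF abs_ge_zero])
  then show ?thesis using L by (simp add: slope_def abs_divide)
qed

lemma W1inf_norm_le:
  assumes n: "n \<in> {1..NT}" and t: "t \<in> time_slab \<Delta>t n"
  shows "W1inf_norm {a<..<b} (mesh_velocity \<Delta>t Np P n t) \<le> max vmax (2 * vmax * rmax * real Np)"
proof -
  interpret nodal_function a b Np "node_path \<Delta>t P n t" "node_velocity \<Delta>t P n" by (rule nodal_function[OF n t])
  show ?thesis
    unfolding W1inf_norm_def mesh_velocity_eq_u[OF n t]
    using Linf_norm_u(1)[OF node_velocity_le_vmax[OF n]] Linf_norm_weak_deriv_u(1)[OF slope_le[OF n t]]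
    by (auto simp: le_max_iff_disj)
qed

lemma norm_le_C0_slab_norm:
  assumes "\<And>n t. n \<in> {1..NT} \<Longrightarrow> t \<in> time_slab \<Delta>t n \<Longrightarrow> F (mesh_velocity \<Delta>t Np P n t) \<le> M"
    and n: "n \<in> {1..NT}" "t \<in> time_slab \<Delta>t n"
  shows "F (mesh_velocity \<Delta>t Np P n t) \<le> C0_slab_norm F \<Delta>t NT (mesh_velocity \<Delta>t Np P)"
  unfolding C0_slab_norm_def using assms by (intro cSup_upper) (auto intro!: bdd_aboveI[of _ M])

lemma node_velocity_le_Linf:
  assumes n: "n \<in> {1..NT}" and i: "i \<in> {1..Np}"
  shows "\<bar>node_velocity \<Delta>t P n i\<bar> \<le> C0_slab_norm (Linf_norm {a<..<b}) \<Delta>t NT (mesh_velocity \<Delta>t Np P)"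
proof -
  \<comment> \<open>Node velocities are constant on a slab, so a single time suffices; the right end
    is taken.\<close>
  have t: "real n * \<Delta>t \<in> time_slab \<Delta>t n" using \<Delta>t by (auto simp: time_slab_def)
  interpret nodal_function a b Np "node_path \<Delta>t P n (real n * \<Delta>t)" "node_velocity \<Delta>t P n" by (rule nodal_function[OF n t])
  have "\<bar>node_velocity \<Delta>t P n i\<bar> \<le> Linf_norm {a<..<b} (mesh_velocity \<Delta>t Np P n (real n * \<Delta>t))"
    unfolding mesh_velocity_eq_u[OF n t] by (rule Linf_norm_u(2)[OF node_velocity_le_vmax[OF n] i])
  also have "\<dots> \<le> C0_slab_norm (Linf_norm {a<..<b}) \<Delta>t NT (mesh_velocity \<Delta>t Np P)"
    by (rule norm_le_C0_slab_norm[where F = "Linf_norm {a<..<b}", OF _ n t, of "max vmax (2 * vmax * rmax * real Np)"])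
       (rule order_trans[OF _ W1inf_norm_le], auto simp: W1inf_norm_def)
  finally show ?thesis .
qed

text \<open>The velocity difference is constant on a slab while the length of the element changes,
  so the second bound is stated with the length at each time \<open>t\<close>.\<close>

lemma node_velocity_le_W1inf:
  assumes n: "n \<in> {1..NT}" and t: "t \<in> time_slab \<Delta>t n"
  shows "i \<in> {1..Np} \<Longrightarrow> \<bar>node_velocity \<Delta>t P n i\<bar> \<le> C0_slab_norm (W1inf_norm {a<..<b}) \<Delta>t NT (mesh_velocity \<Delta>t Np P)"
    "j \<in> {1..<Np} \<Longrightarrow> \<bar>node_velocity \<Delta>t P n (j + 1) - node_velocity \<Delta>t P n j\<bar> \<le>
      C0_slab_norm (W1inf_norm {a<..<b}) \<Delta>t NT (mesh_velocity \<Delta>t Np P) * (node_path \<Delta>t P n t (j + 1) - node_path \<Delta>t P n t j)"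
proof -
  let ?r = "C0_slab_norm (W1inf_norm {a<..<b}) \<Delta>t NT (mesh_velocity \<Delta>t Np P)"
  interpret nodal_function a b Np "node_path \<Delta>t P n t" "node_velocity \<Delta>t P n" by (rule nodal_function[OF n t])
  have r: "W1inf_norm {a<..<b} u \<le> ?r"
    using norm_le_C0_slab_norm[where F = "W1inf_norm {a<..<b}", OF W1inf_norm_le n t] by (simp add: mesh_velocity_eq_u[OF n t])
  then have r: "Linf_norm {a<..<b} u \<le> ?r" "Linf_norm {a<..<b} (weak_deriv {a<..<b} 1 u) \<le> ?r"
    by (auto simp: W1inf_norm_def)
  show "\<bar>node_velocity \<Delta>t P n i\<bar> \<le> ?r" if "i \<in> {1..Np}"
    using Linf_norm_u(2)[OF node_velocity_le_vmax[OF n] that] r(1) by simp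
  show "\<bar>node_velocity \<Delta>t P n (j + 1) - node_velocity \<Delta>t P n j\<bar> \<le> ?r * (node_path \<Delta>t P n t (j + 1) - node_path \<Delta>t P n t j)"
    if j: "j \<in> {1..<Np}"
    using Linf_norm_weak_deriv_u(2)[OF slope_le[OF n t] j] mult_right_mono[OF r(2)] mono[OF j]
    by (meson diff_ge_0_iff_ge less_imp_le order_trans)
qed

lemma mesh_slabI:
  assumes "regular_function a b T \<phi>" and n: "n \<in> {1..NT}"
    and W: "\<And>i. i \<in> {1..Np} \<Longrightarrow> \<bar>node_velocity \<Delta>t P n i\<bar> \<le> W"
  shows "mesh_slab a b T \<phi> Np (P (n - 1)) (node_velocity \<Delta>t P n) (real (n - 1) * \<Delta>t) (real n * \<Delta>t) (mesh_size NT Np P) W"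
proof -
  interpret regular_function a b T \<phi> by fact
  have slab: "time_slab \<Delta>t n = {real (n - 1) * \<Delta>t..real n * \<Delta>t}" by (simp add: time_slab_def)
  have p: "P (n - 1) i + node_velocity \<Delta>t P n i * (t - real (n - 1) * \<Delta>t) = node_path \<Delta>t P n t i" for t i
    by (simp add: node_path_def)
  show ?thesis
  proof
    show "real (n - 1) * \<Delta>t < real n * \<Delta>t" using n \<Delta>t by (simp add: of_nat_diff)
    have "real n \<le> T / \<Delta>t"
    proof -
      have "0 \<le> T / \<Delta>t" using T \<Delta>t by simp
      then have "real NT \<le> T / \<Delta>t" unfolding num_steps_def by (simp add: of_nat_floor)
      then show ?thesis using n by (meson atLeastAtMost_iff of_nat_le_iff order_trans)
    qed
    then show "real n * \<Delta>t \<le> T" using \<Delta>t by (simp add: pos_le_divide_eq)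
    show "P (n - 1) 1 = a" "P (n - 1) Np = b" using P_ends[of "n - 1"] n by auto
    show "node_velocity \<Delta>t P n 1 = 0" "node_velocity \<Delta>t P n Np = 0"
      using P_ends[of "n - 1"] P_ends[of n] n by (auto simp: node_velocity_def)
    fix t i assume t: "t \<in> {real (n - 1) * \<Delta>t..real n * \<Delta>t}" and i: "i \<in> {1..<Np}"
    show "P (n - 1) i + node_velocity \<Delta>t P n i * (t - real (n - 1) * \<Delta>t)
        < P (n - 1) (i + 1) + node_velocity \<Delta>t P n (i + 1) * (t - real (n - 1) * \<Delta>t)"
      unfolding p by (rule nodal_function.mono[OF nodal_function[OF n] i]) (use t slab in simp)
    show "P (n - 1) (i + 1) + node_velocity \<Delta>t P n (i + 1) * (t - real (n - 1) * \<Delta>t)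
        - (P (n - 1) i + node_velocity \<Delta>t P n i * (t - real (n - 1) * \<Delta>t)) \<le> mesh_size NT Np P"
      unfolding p by (rule node_path_diff_bounds(2)[OF n _ i]) (use t slab in simp)
  qed (use Np \<Delta>t W in auto)
qed

lemma interp_diff_error_AE:
  assumes \<phi>: "regular_function a b T \<phi>" and n: "n \<in> {1..NT}"
    and W: "\<And>i. i \<in> {1..Np} \<Longrightarrow> \<bar>node_velocity \<Delta>t P n i\<bar> \<le> W"
  shows "AE x in lebesgue_on {a<..<b}. interp_diff_error \<Delta>t Np P \<phi> n x =
      (\<integral>t. mesh_slab.err a b \<phi> Np (P (n - 1)) (node_velocity \<Delta>t P n) (real (n - 1) * \<Delta>t) t x
        \<partial>lebesgue_on {real (n - 1) * \<Delta>t<..<real n * \<Delta>t}) / (real n * \<Delta>t - real (n - 1) * \<Delta>t)"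
proof -
  interpret mesh_slab a b T \<phi> Np "P (n - 1)" "node_velocity \<Delta>t P n" "real (n - 1) * \<Delta>t" "real n * \<Delta>t"
    "mesh_size NT Np P" W by (rule mesh_slabI[OF \<phi> n W])
  have d: "real n * \<Delta>t - real (n - 1) * \<Delta>t = \<Delta>t" using n by (simp add: of_nat_diff algebra_simps)
  have p: "p t = node_path \<Delta>t P n t" for t by (simp add: fun_eq_iff p_def node_path_def)
  have p1: "p (real n * \<Delta>t) = P n" "p (real (n - 1) * \<Delta>t) = P (n - 1)"
    using \<Delta>t by (auto simp: fun_eq_iff p_def d node_velocity_def)
  show ?thesis
    using error_identity
  proof eventually_elim
    case (elim x)
    then show ?case
      unfolding d p1 interp_diff_error_def time_slab_def p[symmetric] by (simp add: diff_divide_distrib[symmetric])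
  qed
qed

end

declare One_nat_def [simp]

theorem theorem2:
  fixes a b T \<nu> :: real
  assumes "a < b" and "0 < T" and "0 < \<nu>"
  shows
    "(\<exists>C :: real \<Rightarrow> real. (\<forall>r. 0 < C r) \<and>
        (\<forall>u f g \<phi>0 \<phi> \<Delta>t Np P.
           solves_conv_diff a b T \<nu> u f g \<phi>0 \<phi> \<and>
           continuous_on ({0..T} \<times> {a..b}) (\<lambda>(t, x). \<phi> t x) \<and>
           \<phi> \<in> Z_space 3 {0<..<T} {a<..<b} \<inter> H_sobolev 2 {0<..<T} {a<..<b} 2
                 \<inter> H_sobolev 1 {0<..<T} {a<..<b} 3 \<and>
           0 < \<Delta>t \<and> moving_mesh a b (num_steps T \<Delta>t) Np P \<longrightarrow>
           (\<forall>n\<in>{1..num_steps T \<Delta>t}.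
              L2_norm {a<..<b} (interp_diff_error \<Delta>t Np P \<phi> n)
              \<le> C (C0_slab_norm (Linf_norm {a<..<b}) \<Delta>t (num_steps T \<Delta>t) (mesh_velocity \<Delta>t Np P))
                 * mesh_size (num_steps T \<Delta>t) Np P / sqrt \<Delta>t
                 * L2_sobolev_norm {real (n - 1) * \<Delta>t <..< real n * \<Delta>t} {a<..<b} 2 \<phi>)))
     \<and>
     (\<exists>C' :: real \<Rightarrow> real. (\<forall>r. 0 < C' r) \<and>
        (\<forall>u f g \<phi>0 \<phi> \<Delta>t Np P.
           solves_conv_diff a b T \<nu> u f g \<phi>0 \<phi> \<and>
           continuous_on ({0..T} \<times> {a..b}) (\<lambda>(t, x). \<phi> t x) \<and>
           \<phi> \<in> Z_space 3 {0<..<T} {a<..<b} \<inter> H_sobolev 2 {0<..<T} {a<..<b} 2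
                 \<inter> H_sobolev 1 {0<..<T} {a<..<b} 3 \<and>
           0 < \<Delta>t \<and> moving_mesh a b (num_steps T \<Delta>t) Np P \<longrightarrow>
           (\<forall>n\<in>{1..num_steps T \<Delta>t}.
              H1_dual_norm {a<..<b} (interp_diff_error \<Delta>t Np P \<phi> n)
              \<le> C' (C0_slab_norm (W1inf_norm {a<..<b}) \<Delta>t (num_steps T \<Delta>t) (mesh_velocity \<Delta>t Np P))
                 * (mesh_size (num_steps T \<Delta>t) Np P)\<^sup>2
                 * H_sobolev_norm 1 {0<..<T} {a<..<b} 3 \<phi>)))"
proof -
  let ?\<Omega> = "{a<..<b}" and ?J = "{0<..<T}"
  \<comment> \<open>The first factor belongs to the pairing at a fixed time, the second to the
    embedding in time; there 1 is added to secure positivity. \<open>K\<close> depends on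
    \<open>a\<close>, \<open>b\<close> and \<open>T\<close> only.\<close>
  define K where "K = (3 * (embed_const a b * sqrt (b - a)) + 1) * (embed_const 0 T + 1)"
  have K: "0 < K"
    using assms(1,2) embed_const_nonneg[of a b] embed_const_nonneg[of 0 T]
    unfolding K_def by (intro mult_pos_pos add_nonneg_pos) auto
  \<comment> \<open>The estimates are linear in the norm \<open>r\<close> of the velocity. The
    witnesses are \<open>1 + \<bar>r\<bar>\<close> and \<open>K * (1 + \<bar>r\<bar>)\<close>, since
    positivity is demanded for every real \<open>r\<close>, including 0 and negative values.\<close>
  have step: "L2_norm ?\<Omega> (interp_diff_error \<Delta>t Np P \<phi> n)
        \<le> (1 + \<bar>C0_slab_norm (Linf_norm ?\<Omega>) \<Delta>t (num_steps T \<Delta>t) (mesh_velocity \<Delta>t Np P)\<bar>)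
           * mesh_size (num_steps T \<Delta>t) Np P / sqrt \<Delta>t
           * L2_sobolev_norm {real (n - 1) * \<Delta>t<..<real n * \<Delta>t} ?\<Omega> 2 \<phi>" (is "?L2 \<le> (1 + \<bar>?r\<bar>) * ?h / _ * ?N")
    "H1_dual_norm ?\<Omega> (interp_diff_error \<Delta>t Np P \<phi> n)
        \<le> K * (1 + \<bar>C0_slab_norm (W1inf_norm ?\<Omega>) \<Delta>t (num_steps T \<Delta>t) (mesh_velocity \<Delta>t Np P)\<bar>)
           * (mesh_size (num_steps T \<Delta>t) Np P)\<^sup>2 * H_sobolev_norm 1 ?J ?\<Omega> 3 \<phi>" (is "?D \<le> K * (1 + \<bar>?r'\<bar>) * _ * ?H")
    if cont: "continuous_on ({0..T} \<times> {a..b}) (\<lambda>(t, x). \<phi> t x)"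
      and \<phi>: "\<phi> \<in> Z_space 3 ?J ?\<Omega> \<inter> H_sobolev 2 ?J ?\<Omega> 2 \<inter> H_sobolev 1 ?J ?\<Omega> 3"
      and \<Delta>t: "0 < \<Delta>t" and mesh: "moving_mesh a b (num_steps T \<Delta>t) Np P"
      and n: "n \<in> {1..num_steps T \<Delta>t}" for \<phi> \<Delta>t Np P n
  proof -
    interpret moving_mesh_steps a b T \<Delta>t Np P by standard (use \<Delta>t assms(2) mesh in auto)
    have R: "regular_function a b T \<phi>" by standard (use assms(1) cont \<phi> in auto)
    let ?t0 = "real (n - 1) * \<Delta>t" and ?t1 = "real n * \<Delta>t" and ?w = "node_velocity \<Delta>t P n"
    have d: "?t1 - ?t0 = \<Delta>t" using n by (simp add: of_nat_diff algebra_simps)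
    have slab: "t \<in> time_slab \<Delta>t n" if "t \<in> {?t0<..<?t1}" for t using that by (auto simp: time_slab_def)
    show "?L2 \<le> (1 + \<bar>?r\<bar>) * ?h / sqrt \<Delta>t * ?N"
    proof -
      interpret mesh_slab a b T \<phi> Np "P (n - 1)" ?w ?t0 ?t1 ?h ?r
        by (rule mesh_slabI[OF R n node_velocity_le_Linf[OF n]])
      have "integrable (lebesgue_on ?J) (\<lambda>t. (sobolev_norm ?\<Omega> 2 (\<phi> t))\<^sup>2)"
        using \<phi> by (auto simp: H_sobolev_def L2_sobolev_def)
      then have "integrable (lebesgue_on {?t0<..<?t1}) (\<lambda>t. (sobolev_norm ?\<Omega> 2 (\<phi> t))\<^sup>2)"
        by (rule integrable_lebesgue_on_subset) (use t01 in auto)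
      moreover have "AE x in lebesgue_on ?\<Omega>. interp_diff_error \<Delta>t Np P \<phi> n x
          = (\<integral>t. err t x \<partial>lebesgue_on {?t0<..<?t1}) / (?t1 - ?t0)"
        by (rule interp_diff_error_AE[OF R n node_velocity_le_Linf[OF n]])
      ultimately have "?L2 \<le> ?r * ?h / sqrt (?t1 - ?t0) * ?N"
        by (intro L2_norm_error_le)
      also have "\<dots> \<le> (1 + \<bar>?r\<bar>) * ?h / sqrt \<Delta>t * ?N"
        unfolding d using h_pos \<Delta>t
        by (intro mult_right_mono divide_right_mono) (auto simp: L2_sobolev_norm_def)
      finally show ?thesis .
    qed
    show "?D \<le> K * (1 + \<bar>?r'\<bar>) * ?h\<^sup>2 * ?H"
    proof -
      have t1: "?t1 \<in> time_slab \<Delta>t n" using \<Delta>t by (auto simp: time_slab_def)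
      interpret mesh_slab a b T \<phi> Np "P (n - 1)" ?w ?t0 ?t1 ?h ?r'
        by (rule mesh_slabI[OF R n node_velocity_le_W1inf(1)[OF n t1]])
      have p: "p t = node_path \<Delta>t P n t" for t by (rule ext) (simp only: p_def node_path_def)
      \<comment> \<open>The norm in W^{1,infinity} serves twice, as the bound on the velocities and
        as the constant in the bound on their differences; so \<open>W\<close>, \<open>V\<close> and
        \<open>r\<close> coincide.\<close>
      have "?D \<le> (3 * (embed_const a b * sqrt (b - a)) + 1) * ?r' * ?h\<^sup>2 * (embed_const 0 T * ?H)"
      proof (rule H1_dual_norm_error_le[OF interp_diff_error_AE[OF R n node_velocity_le_W1inf(1)[OF n t1]] _ order.refl order.refl])
        show "\<bar>?w (j + 1) - ?w j\<bar> \<le> ?r' * (p t (j + 1) - p t j)" if "t \<in> {?t0<..<?t1}" "j \<in> {1..<Np}" for t j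
          unfolding p by (rule node_velocity_le_W1inf(2)[OF n slab[OF that(1)] that(2)])
        show "L2_norm ?\<Omega> (weak_deriv ?\<Omega> k (\<phi> t)) \<le> embed_const 0 T * ?H"
          if "t \<in> {?t0<..<?t1}" "k \<le> 3" for t k
          using \<phi> S_J[OF that(1)] that(2) assms(1)
          by (intro L2_norm_le_H_sobolev_norm sobolev_3 continuous_sobolev_3) auto
      qed
      also have "\<dots> = ((3 * (embed_const a b * sqrt (b - a)) + 1) * embed_const 0 T) * ?r' * ?h\<^sup>2 * ?H"
        by (simp only: mult_ac)
      also have "\<dots> \<le> K * (1 + \<bar>?r'\<bar>) * ?h\<^sup>2 * ?H"
      proof (intro mult_right_mono mult_mono)
        show "(3 * (embed_const a b * sqrt (b - a)) + 1) * embed_const 0 T \<le> K"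
          unfolding K_def using assms(1) embed_const_nonneg[of a b] by (intro mult_left_mono) auto
      qed (use K W_nonneg in \<open>auto simp: H_sobolev_norm_def\<close>)
      finally show ?thesis .
    qed
  qed
  have pos: "0 < 1 + \<bar>r\<bar>" "0 < K * (1 + \<bar>r\<bar>)" for r :: real
    using K by (auto intro!: mult_pos_pos add_pos_nonneg)
  show ?thesis
    by (rule conjI; intro exI conjI allI impI ballI; (elim conjE)?; (rule pos step; assumption)?)
qed

end
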